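(* In the setting of the context, assume that the base manifold $\Lambda$ is simply connected. Then the holonomy groups of the equilibrium bundle $(E,\pi,\Lambda)$ (with its natural connection) are trivial and the fiber bundle is trivial.
   Context: Setting. Let $n,m,k>0$ be integers. $\Lambda\subset\mathbb{R}^m$ is a connected open set. $V\subset\mathbb{R}^n$ is a compact submanifold of codimension zero whose boundary $\partial V$ is a stratified manifold. $M=\Lambda\times V$, and $f:M\to\mathbb{R}^n$ is a real analytic map, regarded as a family of vector fields $f(\lambda,\cdot)$ on $V$ defining the systems $\dot x=f(\lambda,x)$. The system stays inside $V$: on $\partial V$ the vector field either points inward or is tangent to $\partial V$. There are $k$ smooth functions $h_1,\dots,h_k:\mathbb{R}^n\to\mathbb{R}$, not depending on $\lambda$, which are first integrals (for each $\lambda\in\Lambda$ each $h_l$ is constant along every solution $x(t)$ in $V$ of $\dot x=f(\lambda,x)$) and are independent, i.e. their gradients $\nabla h_1,\dots,\nabla h_k$ are linearly independent at every point. The equilibrium locus is $E=\{(\lambda,x)\in M: f(\lambda,x)=0\}$, assumed nonempty; it is a smooth real analytic variety of dimension $m+k$. Non-degeneracy conditions (assumed). i) The rank of the matrix $\frac{\partial f}{\partial\lambda}$ is constant equal to $\min(m,n-k)$. ii) The rank of the matrix $\frac{\partial f}{\partial x}$ is constant equal to $n-k$ for $(\lambda,x)\in E$, and equals $n-p(\lambda,x)$ at points $(\lambda,x)\notin E$, where $p(\lambda,x)\le k$. iii) For every $(\lambda,x)\in E$, $\ker\left(\frac{\partial f}{\partial x}(\lambda,x)\right)\oplus\operatorname{im}\left(\frac{\partial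 f}{\partial x}(\lambda,x)\right)=\mathbb{R}^n$. Let $\pi:E\to\Lambda$, $\pi(\lambda,x)=\lambda$, assumed surjective; $(E,\pi,\Lambda)$ is a fiber bundle, called the equilibrium bundle, with fibers $E_\lambda=\pi^{-1}(\lambda)$. Let $\pi':E\to\mathbb{R}^n$, $\pi'(\lambda,x)=x$, and $h=(h_1,\dots,h_k)$. The natural connection is the Ehresmann connection on $E$ whose horizontal space at $u=(\lambda,x)\in E$ is $H_u=T_u\big((h\circ\pi')^{-1}(h(x))\big)$; it satisfies $T_uE=V_u\oplus H_u$ with vertical space $V_u=\ker(\pi_{*,u})$. Parallel transport along a curve in $\Lambda$ is given by horizontal lifts (curves in $E$ above the given curve and tangent to $H$), and is defined along all of the curve for every starting point. The holonomy group at $\lambda\in\Lambda$ is the group of diffeomorphisms of $E_\lambda$ obtained by parallel transport along loops in $\Lambda$ based at $\lambda$. *)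

theory Defs
  imports "HOL-Analysis.Analysis" "HOL-Algebra.Bij" "HOL-Algebra.Elementary_Groups"
begin

section \<open>Real analytic and smooth maps\<close>

text \<open>Multi-indices are the functions in \<open>Basis \<rightarrow>\<^sub>E UNIV\<close>.  The values of \<open>f\<close> on a whole
  neighbourhood of each point of \<open>S\<close> matter: a map that is real analytic on a non-open set is
  represented by an analytic extension to a neighbourhood.\<close>

definition real_analytic_on ::
    "('a::euclidean_space \<Rightarrow> 'b::euclidean_space) \<Rightarrow> 'a set \<Rightarrow> bool" where
  "real_analytic_on f S \<longleftrightarrow>
    (\<forall>p\<in>S. \<exists>c r. r > 0 \<and>
      (\<forall>y\<in>ball p r. ((\<lambda>\<alpha>. (\<Prod>b\<in>Basis. ((y - p) \<bullet> b) ^ \<alpha> b) *\<^sub>R c \<alpha>) has_sum f y)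
                        (Basis \<rightarrow>\<^sub>E (UNIV :: nat set))))"

text \<open>For open \<open>S\<close>, \<open>C_on r f S\<close> says that \<open>f\<close> is of class \<open>C\<close> to the \<open>r\<close> on \<open>S\<close>.\<close>

primrec C_on ::
    "nat \<Rightarrow> ('a::euclidean_space \<Rightarrow> 'b::euclidean_space) \<Rightarrow> 'a set \<Rightarrow> bool" where
  "C_on 0 f S \<longleftrightarrow> continuous_on S f"
| "C_on (Suc r) f S \<longleftrightarrow>
    (\<forall>x\<in>S. f differentiable (at x)) \<and>
    (\<forall>v. C_on r (\<lambda>x. frechet_derivative f (at x) v) S)"

definition smooth_on ::
    "('a::euclidean_space \<Rightarrow> 'b::euclidean_space) \<Rightarrow> 'a set \<Rightarrow> bool" where
  "smooth_on f S \<longleftrightarrow> (\<forall>r. C_on r f S)"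

text \<open>Smoothness and diffeomorphisms of arbitrary subsets of Euclidean spaces, by local smooth
  extension.\<close>

definition smooth_map_on ::
    "('a::euclidean_space \<Rightarrow> 'b::euclidean_space) \<Rightarrow> 'a set \<Rightarrow> bool" where
  "smooth_map_on g S \<longleftrightarrow>
    (\<forall>p\<in>S. \<exists>U g'. open U \<and> p \<in> U \<and> smooth_on g' U \<and> (\<forall>y\<in>S \<inter> U. g' y = g y))"

definition diffeomorphism_between ::
    "'a::euclidean_space set \<Rightarrow> 'b::euclidean_space set \<Rightarrow> ('a \<Rightarrow> 'b) \<Rightarrow> bool" where
  "diffeomorphism_between S T \<phi> \<longleftrightarrow>
    (\<exists>\<psi>. homeomorphism S T \<phi> \<psi> \<and> smooth_map_on \<phi> S \<and> smooth_map_on \<psi> T)"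


section \<open>Submanifolds, stratifications, tangent spaces\<close>

text \<open>Embedded submanifolds without boundary, of dimension \<open>d\<close>; \<open>R\<close> is the regularity of the
  flattening charts.\<close>

definition submanifold ::
    "(('a::euclidean_space \<Rightarrow> 'a) \<Rightarrow> 'a set \<Rightarrow> bool) \<Rightarrow> nat \<Rightarrow> 'a set \<Rightarrow> bool" where
  "submanifold R d S \<longleftrightarrow>
    (\<forall>p\<in>S. \<exists>U W T \<phi> \<psi>. open U \<and> p \<in> U \<and> open W \<and> homeomorphism U W \<phi> \<psi> \<and>
       R \<phi> U \<and> R \<psi> W \<and> subspace T \<and> dim T = d \<and> \<phi> ` (S \<inter> U) = T \<inter> W)"

abbreviation "smooth_submanifold \<equiv> submanifold smooth_on"
abbreviation "analytic_submanifold \<equiv> submanifold real_analytic_on"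

definition stratified_manifold :: "'a::euclidean_space set \<Rightarrow> bool" where
  "stratified_manifold S \<longleftrightarrow>
    (\<exists>\<S>. \<Union>\<S> = S \<and> disjoint \<S> \<and>
       (\<forall>X\<in>\<S>. X \<noteq> {} \<and> (\<exists>d. smooth_submanifold d X)) \<and>
       (\<forall>p\<in>S. \<exists>U. open U \<and> p \<in> U \<and> finite {X\<in>\<S>. X \<inter> U \<noteq> {}}) \<and>
       (\<forall>X\<in>\<S>. \<forall>Y\<in>\<S>. X \<inter> closure Y \<noteq> {} \<longrightarrow> X \<subseteq> closure Y))"

text \<open>A submanifold of codimension zero, with a boundary that need not be smooth.  By invariance
  of domain the manifold boundary of a closed such \<open>V\<close> is \<open>frontier V\<close>.\<close>

definition codim0_submanifold :: "'a::euclidean_space set \<Rightarrow> bool" where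
  "codim0_submanifold V \<longleftrightarrow>
    (\<forall>p\<in>V. \<exists>A b B. openin (top_of_set V) A \<and> p \<in> A \<and> b \<noteq> 0 \<and>
       openin (top_of_set {x::'a. 0 \<le> b \<bullet> x}) B \<and> A homeomorphic B)"

text \<open>A set that is, inside \<open>M\<close>, cut out by real analytic submanifolds of dimension \<open>d\<close> of the
  ambient space.  In the interior of \<open>M\<close> this is an analytic submanifold without boundary; a
  boundary can occur only on the boundary of \<open>M\<close>.  (It does occur there: the fibres of the
  equilibrium bundle are compact and locally diffeomorphic, through \<open>h\<close>, to subsets of the
  Euclidean space of the same dimension.)\<close>

definition analytic_variety_in :: "'a::euclidean_space set \<Rightarrow> nat \<Rightarrow> 'a set \<Rightarrow> bool" where
  "analytic_variety_in M d E \<longleftrightarrow>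
    (\<forall>u\<in>E. \<exists>U Z. open U \<and> u \<in> U \<and> analytic_submanifold d Z \<and> E \<inter> U = Z \<inter> M \<inter> U)"

text \<open>Linear span of the velocities of one-sided \<open>C\<^sup>1\<close> curves, so that at a boundary point of a
  manifold with boundary or corners one obtains the full tangent space.\<close>

definition tangent_space :: "'a::euclidean_space set \<Rightarrow> 'a \<Rightarrow> 'a set" where
  "tangent_space S u =
    span {v. \<exists>\<gamma> \<epsilon>. \<epsilon> > 0 \<and> \<gamma> 0 = u \<and> \<gamma> ` {0..\<epsilon>} \<subseteq> S \<and>
             \<gamma> C1_differentiable_on {0..\<epsilon>} \<and> (\<gamma> has_vector_derivative v) (at 0)}"

text \<open>The (Bouligand) cone of tangent directions of a set.\<close>

definition tangent_cone :: "'a::euclidean_space set \<Rightarrow> 'a \<Rightarrow> 'a set" where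
  "tangent_cone S x =
    {v. \<exists>t y. (\<forall>i::nat. t i > 0 \<and> y i \<in> S) \<and> t \<longlonglongrightarrow> 0 \<and>
              (\<lambda>i. (y i - x) /\<^sub>R t i) \<longlonglongrightarrow> v}"

definition direct_sum :: "'a::real_vector set \<Rightarrow> 'a set \<Rightarrow> 'a set \<Rightarrow> bool" where
  "direct_sum A B C \<longleftrightarrow> A \<inter> B = {0} \<and> {a + b | a b. a \<in> A \<and> b \<in> B} = C"


section \<open>Families of vector fields and first integrals\<close>

text \<open>On the boundary of \<open>V\<close> the vector field \<open>g\<close> points inward or is tangent to the boundary.\<close>

definition inward_or_tangent ::
    "'a::euclidean_space set \<Rightarrow> ('a \<Rightarrow> 'a) \<Rightarrow> bool" where
  "inward_or_tangent V g \<longleftrightarrow>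
    (\<forall>x\<in>frontier V. g x \<in> interior (tangent_cone V x) \<or> g x \<in> tangent_cone (frontier V) x)"

definition solution_in ::
    "'a::euclidean_space set \<Rightarrow> ('a \<Rightarrow> 'a) \<Rightarrow> real set \<Rightarrow> (real \<Rightarrow> 'a) \<Rightarrow> bool" where
  "solution_in V g I x \<longleftrightarrow>
    is_interval I \<and> (\<forall>t\<in>I. x t \<in> V \<and> (x has_vector_derivative g (x t)) (at t within I))"

definition first_integral ::
    "'a::euclidean_space set \<Rightarrow> ('a \<Rightarrow> 'a) \<Rightarrow> ('a \<Rightarrow> real) \<Rightarrow> bool" where
  "first_integral V g q \<longleftrightarrow>
    (\<forall>I x. solution_in V g I x \<longrightarrow> (\<lambda>t. q (x t)) constant_on I)"

definition gradient :: "(real^'n \<Rightarrow> real) \<Rightarrow> real^'n \<Rightarrow> real^'n" where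
  "gradient q x = (\<chi> i. frechet_derivative q (at x) (axis i 1))"

definition independent_functions :: "(real^'n \<Rightarrow> real^'k) \<Rightarrow> bool" where
  "independent_functions h \<longleftrightarrow>
    (\<forall>x. inj (\<lambda>l. gradient (\<lambda>y. h y $ l) x) \<and>
         independent (range (\<lambda>l. gradient (\<lambda>y. h y $ l) x)))"

definition jacobian_param ::
    "((real^'m) \<times> (real^'n) \<Rightarrow> real^'n) \<Rightarrow> (real^'m) \<times> (real^'n) \<Rightarrow> real^'m^'n" where
  "jacobian_param f u = matrix (frechet_derivative (\<lambda>\<mu>. f (\<mu>, snd u)) (at (fst u)))"

definition jacobian_state ::
    "((real^'m) \<times> (real^'n) \<Rightarrow> real^'n) \<Rightarrow> (real^'m) \<times> (real^'n) \<Rightarrow> real^'n^'n" where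
  "jacobian_state f u = matrix (frechet_derivative (\<lambda>y. f (fst u, y)) (at (snd u)))"

definition matrix_ker :: "real^'n^'n \<Rightarrow> (real^'n) set" where
  "matrix_ker A = {v. A *v v = 0}"

definition matrix_im :: "real^'n^'n \<Rightarrow> (real^'n) set" where
  "matrix_im A = range (\<lambda>v. A *v v)"

definition equilibrium_locus ::
    "'a set \<Rightarrow> 'b set \<Rightarrow> ('a \<times> 'b \<Rightarrow> 'c::zero) \<Rightarrow> ('a \<times> 'b) set" where
  "equilibrium_locus \<Lambda> V f = {u \<in> \<Lambda> \<times> V. f u = 0}"


section \<open>Fibre bundles, connections, holonomy\<close>

text \<open>All total spaces are subsets of a product, with projection \<^const>\<open>fst\<close>.\<close>

definition trivialization ::
    "('a::euclidean_space \<times> 'b::euclidean_space) set \<Rightarrow> 'a set \<Rightarrow> 'b set \<Rightarrow>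
     ('a \<times> 'b \<Rightarrow> 'a \<times> 'b) \<Rightarrow> bool" where
  "trivialization E U F \<Phi> \<longleftrightarrow>
    diffeomorphism_between (E \<inter> fst -` U) (U \<times> F) \<Phi> \<and>
    (\<forall>u\<in>E \<inter> fst -` U. fst (\<Phi> u) = fst u)"

definition fiber_bundle ::
    "('a::euclidean_space \<times> 'b::euclidean_space) set \<Rightarrow> 'a set \<Rightarrow> bool" where
  "fiber_bundle E B \<longleftrightarrow> fst ` E = B \<and>
    (\<exists>F. \<forall>b\<in>B. \<exists>U \<Phi>. openin (top_of_set B) U \<and> b \<in> U \<and> trivialization E U F \<Phi>)"

definition trivial_fiber_bundle ::
    "('a::euclidean_space \<times> 'b::euclidean_space) set \<Rightarrow> 'a set \<Rightarrow> bool" where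
  "trivial_fiber_bundle E B \<longleftrightarrow> fst ` E = B \<and> (\<exists>F \<Phi>. trivialization E B F \<Phi>)"

definition bundle_fiber :: "('a \<times> 'b) set \<Rightarrow> 'a \<Rightarrow> ('a \<times> 'b) set" where
  "bundle_fiber E b = {u\<in>E. fst u = b}"

definition vertical_space ::
    "('a::euclidean_space \<times> 'b::euclidean_space) set \<Rightarrow> 'a \<times> 'b \<Rightarrow> ('a \<times> 'b) set" where
  "vertical_space E u = {v \<in> tangent_space E u. fst v = 0}"

text \<open>The natural connection: the tangent space at \<open>u = (\<mu>, x)\<close> of the level set through \<open>u\<close>
  of \<open>h \<circ> \<pi>'\<close>, with \<open>\<pi>'\<close> the restriction of \<^const>\<open>snd\<close> to \<open>E\<close>.\<close>

definition natural_horizontal ::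
    "('a::euclidean_space \<times> 'b::euclidean_space) set \<Rightarrow> ('b \<Rightarrow> 'c) \<Rightarrow> 'a \<times> 'b \<Rightarrow> ('a \<times> 'b) set" where
  "natural_horizontal E h u = tangent_space {w\<in>E. h (snd w) = h (snd u)} u"

definition ehresmann_splitting ::
    "('a::euclidean_space \<times> 'b::euclidean_space) set \<Rightarrow> ('a \<times> 'b \<Rightarrow> ('a \<times> 'b) set) \<Rightarrow> bool" where
  "ehresmann_splitting E H \<longleftrightarrow>
    (\<forall>u\<in>E. direct_sum (vertical_space E u) (H u) (tangent_space E u))"

text \<open>Curves are piecewise \<open>C\<^sup>1\<close>, parametrized by \<open>{0..1}\<close>.\<close>

definition horizontal_lift ::
    "('a::euclidean_space \<times> 'b::euclidean_space) set \<Rightarrow> ('a \<times> 'b \<Rightarrow> ('a \<times> 'b) set) \<Rightarrow>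
     (real \<Rightarrow> 'a) \<Rightarrow> (real \<Rightarrow> 'a \<times> 'b) \<Rightarrow> bool" where
  "horizontal_lift E H c \<gamma> \<longleftrightarrow>
    valid_path \<gamma> \<and> path_image \<gamma> \<subseteq> E \<and> (\<forall>t\<in>{0..1}. fst (\<gamma> t) = c t) \<and>
    (\<exists>X. finite X \<and> (\<forall>t\<in>{0..1} - X. \<exists>v\<in>H (\<gamma> t). (\<gamma> has_vector_derivative v) (at t)))"

definition transport_complete ::
    "('a::euclidean_space \<times> 'b::euclidean_space) set \<Rightarrow> ('a \<times> 'b \<Rightarrow> ('a \<times> 'b) set) \<Rightarrow>
     'a set \<Rightarrow> bool" where
  "transport_complete E H B \<longleftrightarrow>
    (\<forall>c. valid_path c \<and> path_image c \<subseteq> B \<longrightarrow>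
      (\<forall>u\<in>bundle_fiber E (pathstart c). \<exists>\<gamma>. horizontal_lift E H c \<gamma> \<and> pathstart \<gamma> = u))"

definition parallel_transport ::
    "('a::euclidean_space \<times> 'b::euclidean_space) set \<Rightarrow> ('a \<times> 'b \<Rightarrow> ('a \<times> 'b) set) \<Rightarrow>
     (real \<Rightarrow> 'a) \<Rightarrow> 'a \<times> 'b \<Rightarrow> 'a \<times> 'b" where
  "parallel_transport E H c u =
    (THE w. \<exists>\<gamma>. horizontal_lift E H c \<gamma> \<and> pathstart \<gamma> = u \<and> pathfinish \<gamma> = w)"

text \<open>The holonomy group as a subgroup of the group of bijections of the fibre.\<close>

definition holonomy_group ::
    "('a::euclidean_space \<times> 'b::euclidean_space) set \<Rightarrow> ('a \<times> 'b \<Rightarrow> ('a \<times> 'b) set) \<Rightarrow>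
     'a set \<Rightarrow> 'a \<Rightarrow> ('a \<times> 'b \<Rightarrow> 'a \<times> 'b) monoid" where
  "holonomy_group E H B b =
    BijGroup (bundle_fiber E b)
      \<lparr>carrier := {restrict (parallel_transport E H c) (bundle_fiber E b) | c.
         valid_path c \<and> path_image c \<subseteq> B \<and> pathstart c = b \<and> pathfinish c = b}\<rparr>"

end

theory Submission
  imports Defs
begin

text \<open>Put \<open>g (\<lambda>, x) = (\<lambda>, h x)\<close>.  The proof rests on two facts about \<open>g\<close> on the equilibrium locus \<open>E\<close>:
  it has a smooth local inverse near every point of \<open>E\<close>, and a horizontal curve keeps \<open>h\<close> constant.

  The first fact comes from the first integrals.  Their derivative along the field vanishes in the
  interior of \<open>V\<close>, because solutions exist there; \<open>V\<close> lies in the closure of its interior, so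
  differentiating this identity at an equilibrium gives \<open>Dh (\<partial>f/\<partial>x) = 0\<close>
  (\<open>first_integral_derivative_at_equilibrium\<close>).  Thus \<open>im (\<partial>f/\<partial>x)\<close> lies in \<open>ker Dh\<close>, both have
  dimension \<open>n - k\<close>, and a vector in \<open>ker (\<partial>f/\<partial>x) \<inter> ker Dh\<close> lies in \<open>ker \<inter> im = 0\<close>.  Hence
  \<open>(\<lambda>, x) \<mapsto> (f (\<lambda>, x), \<lambda>, h x)\<close> is an immersion at every equilibrium, and the inverse function
  theorem inverts \<open>g\<close> on \<open>E\<close> near it (\<open>equilibrium_locus_parametrized\<close>).

  The second fact turns parallel transport into a covering problem.  A level set \<open>L\<close> of \<open>h\<close> in \<open>E\<close>
  projects to the base locally injectively and properly, and paths lift to it because the connection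
  is complete.  Compactness of the parts of \<open>E\<close> over compact sets makes the local injectivity uniform
  (\<open>distance_gap\<close>), so short segments have short, unique lifts, and these trivialize \<open>L\<close> over small
  balls (\<open>covering_space_leaf\<close>).  Over a simply connected base the covering splits: through each point
  \<open>u\<close> of \<open>E\<close> there is a unique continuous section with \<open>h\<close> constant, the flat section of \<open>u\<close>.

  Parallel transport of \<open>u\<close> along a curve ends at the value of this section at the endpoint,
  whatever the curve.  For a loop this value is \<open>u\<close>, so the holonomy is trivial; evaluating the
  sections at one base point identifies all fibres with one of them.  Flat sections depend
  continuously on \<open>u\<close> (\<open>continuous_on_flat_section\<close>).  The identification and its inverse preserve
  \<open>h\<close>, so the local smooth inverses of \<open>g\<close> upgrade their continuity to smoothness
  (\<open>trivial_fiber_bundle_flat_section\<close>).\<close>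

section \<open>Maps of class C to the r\<close>

lemma C_on_imp_continuous_on: "C_on r f S \<Longrightarrow> continuous_on S f"
  by (cases r) (auto simp: differentiable_imp_continuous_within
      intro!: continuous_at_imp_continuous_on)

lemma C_on_Suc_has_derivative:
  "C_on (Suc r) f S \<Longrightarrow> x \<in> S \<Longrightarrow> (f has_derivative frechet_derivative f (at x)) (at x)"
  by (simp add: frechet_derivative_works)

text \<open>Openness makes equality on \<open>S\<close> an equality of germs, so the derivatives agree as well.\<close>

lemma C_on_cong:
  assumes "open S" "\<And>x. x \<in> S \<Longrightarrow> f x = g x" "C_on r f S"
  shows "C_on r g S"
  using assms
proof (induction r arbitrary: f g)
  case 0
  then show ?case by (simp cong: continuous_on_cong)
next
  case (Suc r)
  have g: "(g has_derivative frechet_derivative f (at x)) (at x)" if "x \<in> S" for x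
    using has_derivative_transform_within_open[OF C_on_Suc_has_derivative[OF Suc.prems(3) that]
        Suc.prems(1) that Suc.prems(2)] by auto
  have "C_on r (\<lambda>x. frechet_derivative g (at x) v) S" for v
  proof (rule Suc.IH[OF Suc.prems(1)])
    show "C_on r (\<lambda>x. frechet_derivative f (at x) v) S"
      using Suc.prems(3) by simp
    show "frechet_derivative f (at x) v = frechet_derivative g (at x) v" if "x \<in> S" for x
      using frechet_derivative_at[OF g[OF that]] by simp
  qed
  with g show ?case
    by (auto simp: differentiable_def)
qed

text \<open>The form in which the class is established below: any explicitly given derivative may replace the
  choice made by \<^const>\<open>frechet_derivative\<close>.\<close>

lemma C_on_SucI:
  assumes "open S" "\<And>x. x \<in> S \<Longrightarrow> (f has_derivative D x) (at x)"
    and "\<And>v. C_on r (\<lambda>x. D x v) S"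
  shows "C_on (Suc r) f S"
proof -
  have "C_on r (\<lambda>x. frechet_derivative f (at x) v) S" for v
    by (rule C_on_cong[OF assms(1) _ assms(3)[of v]])
       (metis assms(2) frechet_derivative_at)
  with assms(2) show ?thesis
    by (auto simp: differentiable_def)
qed

lemma C_on_SucD: "C_on (Suc r) f S \<Longrightarrow> C_on r f S"
proof (induction r arbitrary: f)
  case 0
  then show ?case using C_on_imp_continuous_on[OF 0] by simp
next
  case (Suc r)
  then show ?case by (metis C_on.simps(2))
qed

lemma C_on_subset: "C_on r f S \<Longrightarrow> T \<subseteq> S \<Longrightarrow> C_on r f T"
  by (induction r arbitrary: f) (auto intro: continuous_on_subset)

lemma C_on_const: "C_on r (\<lambda>x. c) S"
  by (induction r arbitrary: c) (auto simp: frechet_derivative_const)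

lemma C_on_bounded_linear:
  assumes "bounded_linear f" shows "C_on r f S"
proof (cases r)
  case 0
  then show ?thesis using assms linear_continuous_on by auto
next
  case (Suc n)
  have "(f has_derivative f) (at x)" for x
    using assms bounded_linear_imp_has_derivative by blast
  then show ?thesis
    unfolding Suc by (intro C_on_subset[OF C_on_SucI[OF open_UNIV _ C_on_const]]) auto
qed

lemma C_on_add:
  assumes "open S" "C_on r f S" "C_on r g S"
  shows "C_on r (\<lambda>x. f x + g x) S"
  using assms(2,3)
proof (induction r arbitrary: f g)
  case 0
  then show ?case by (auto intro: continuous_intros)
next
  case (Suc r)
  show ?case
    by (rule C_on_SucI[OF assms(1) has_derivative_add[OF C_on_Suc_has_derivative[OF Suc.prems(1)]
            C_on_Suc_has_derivative[OF Suc.prems(2)]]])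
       (use Suc in auto)
qed

lemma C_on_sum:
  assumes "open S" "\<And>i. i \<in> I \<Longrightarrow> C_on r (f i) S"
  shows "C_on r (\<lambda>x. \<Sum>i\<in>I. f i x) S"
  using assms(2)
  by (induction I rule: infinite_finite_induct) (auto intro: C_on_const C_on_add[OF assms(1)])

lemma C_on_scaleR:
  fixes f :: "'a::euclidean_space \<Rightarrow> real" and g :: "'a \<Rightarrow> 'b::euclidean_space"
  assumes "open S" "C_on r f S" "C_on r g S"
  shows "C_on r (\<lambda>x. f x *\<^sub>R g x) S"
  using assms(2,3)
proof (induction r arbitrary: f g)
  case 0
  then show ?case by (auto intro: continuous_intros)
next
  case (Suc r)
  show ?case
    by (rule C_on_SucI[OF assms(1) has_derivative_scaleR[OF
            C_on_Suc_has_derivative[OF Suc.prems(1)] C_on_Suc_has_derivative[OF Suc.prems(2)]]])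
       (use Suc.prems C_on_SucD[OF Suc.prems(1)] C_on_SucD[OF Suc.prems(2)]
         in \<open>auto intro!: C_on_add[OF assms(1)] Suc.IH\<close>)
qed

lemma C_on_linear_compose:
  assumes "open S" "bounded_linear L" "C_on r f S"
  shows "C_on r (\<lambda>x. L (f x)) S"
  using assms(3)
proof (induction r arbitrary: f)
  case 0
  then show ?case using assms(2) by (auto intro: bounded_linear.continuous_on)
next
  case (Suc r)
  show ?case
    by (rule C_on_SucI[OF assms(1) bounded_linear.has_derivative[OF assms(2)
            C_on_Suc_has_derivative[OF Suc.prems]]])
       (use Suc in auto)
qed

lemma C_on_Pair:
  assumes "open S" "C_on r f S" "C_on r g S"
  shows "C_on r (\<lambda>x. (f x, g x)) S"
proof -
  have "bounded_linear (\<lambda>a::'b. (a, 0::'c))" "bounded_linear (\<lambda>b::'c. (0::'b, b))"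
    by (auto intro!: bounded_linear_Pair bounded_linear_ident bounded_linear_zero)
  then have "C_on r (\<lambda>x. (f x, 0) + (0, g x)) S"
    by (intro C_on_add assms(1) C_on_linear_compose[OF assms(1) _ assms(2)]
        C_on_linear_compose[OF assms(1) _ assms(3)])
  then show ?thesis by simp
qed

lemma linear_basis_expansion:
  fixes L :: "'a::euclidean_space \<Rightarrow> 'b::real_vector"
  assumes "linear L"
  shows "L v = (\<Sum>b\<in>Basis. (v \<bullet> b) *\<^sub>R L b)"
  by (metis (no_types, lifting) assms euclidean_representation linear_cmul linear_sum sum.cong)

lemma frechet_derivative_basis_expansion:
  assumes "C_on (Suc r) f S" "x \<in> S"
  shows "frechet_derivative f (at x) v = (\<Sum>b\<in>Basis. (v \<bullet> b) *\<^sub>R frechet_derivative f (at x) b)"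
  using linear_basis_expansion[OF has_derivative_linear[OF C_on_Suc_has_derivative[OF assms]]] .

text \<open>Expanding the chain rule in the standard basis writes the derivative of the composition as a sum of
  products of maps to which the induction hypothesis applies.\<close>

lemma C_on_compose:
  assumes "open S" "open T" "C_on r f S" "C_on r g T" "f ` S \<subseteq> T"
  shows "C_on r (\<lambda>x. g (f x)) S"
  using assms(3,4)
proof (induction r arbitrary: g)
  case 0
  then show ?case using assms(5) by (auto intro: continuous_on_compose2)
next
  case (Suc r)
  have "(( \<lambda>x. g (f x)) has_derivative (\<lambda>v. \<Sum>b\<in>Basis. (frechet_derivative f (at x) v \<bullet> b) *\<^sub>R
      frechet_derivative g (at (f x)) b)) (at x)" if "x \<in> S" for x
  proof -
    have "f x \<in> T" using assms(5) that by auto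
    from has_derivative_compose[OF C_on_Suc_has_derivative[OF Suc.prems(1) that]
        C_on_Suc_has_derivative[OF Suc.prems(2) this]]
    show ?thesis
      unfolding frechet_derivative_basis_expansion[OF Suc.prems(2) \<open>f x \<in> T\<close>, of "frechet_derivative f (at x) _"] .
  qed
  then show ?case
  proof (rule C_on_SucI[OF assms(1)])
    fix v
    have "C_on r (\<lambda>x. frechet_derivative f (at x) v \<bullet> b) S" for b
      using Suc.prems(1)
      by (intro C_on_linear_compose[OF assms(1) bounded_linear_inner_left]) auto
    moreover have "C_on r (\<lambda>x. frechet_derivative g (at (f x)) b) S" for b
      using Suc.prems by (intro Suc.IH) (auto intro: C_on_SucD)
    ultimately show "C_on r (\<lambda>x. \<Sum>b\<in>Basis. (frechet_derivative f (at x) v \<bullet> b) *\<^sub>R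
      frechet_derivative g (at (f x)) b) S"
      by (intro C_on_sum C_on_scaleR assms(1))
  qed
qed

section \<open>Smoothness of inverses\<close>

text \<open>A product is differentiable at a zero of a differentiable factor even if the other factor is only
  continuous.  This gives differentiability of an operator inverse from its continuity.\<close>

lemma has_derivative_scaleR_at_zero:
  fixes \<xi> :: "'a::real_normed_vector \<Rightarrow> real" and c :: "'a \<Rightarrow> 'b::real_normed_vector"
  assumes "(\<xi> has_derivative \<xi>') (at x)" "\<xi> x = 0" "isCont c x"
  shows "((\<lambda>y. \<xi> y *\<^sub>R c y) has_derivative (\<lambda>h. \<xi>' h *\<^sub>R c x)) (at x)"
proof -
  have 1: "((\<lambda>y. \<xi> y *\<^sub>R c x) has_derivative (\<lambda>h. \<xi>' h *\<^sub>R c x)) (at x)"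
    using assms(1) by (auto intro!: derivative_eq_intros)
  have 2: "((\<lambda>y. \<xi> y *\<^sub>R (c y - c x)) has_derivative (\<lambda>h. 0)) (at x)"
  proof -
    obtain K where K: "K > 0" "\<And>h. norm (\<xi>' h) \<le> norm h * K"
      using has_derivative_bounded_linear[OF assms(1)] bounded_linear.pos_bounded by metis
    show ?thesis
      unfolding has_derivative_at_alt
    proof (intro conjI allI impI)
      fix e :: real assume "e > 0"
      define e' where "e' = e / (K + 1)"
      have e': "e' > 0" using \<open>e > 0\<close> K(1) by (simp add: e'_def)
      obtain d1 where d1: "d1 > 0" "\<And>y. norm (y - x) < d1 \<Longrightarrow> norm (\<xi> y - \<xi> x - \<xi>' (y - x)) \<le> 1 * norm (y - x)"
        using assms(1)[unfolded has_derivative_at_alt] zero_less_one by blast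
      obtain d2 where d2: "d2 > 0" "\<And>y. norm (y - x) < d2 \<Longrightarrow> norm (c y - c x) < e'"
        using assms(3)[unfolded isCont_def LIM_eq, rule_format, OF e']
        by (metis cancel_comm_monoid_add_class.diff_cancel e' norm_zero)
      show "\<exists>d>0. \<forall>y. norm (y - x) < d \<longrightarrow>
          norm (\<xi> y *\<^sub>R (c y - c x) - \<xi> x *\<^sub>R (c x - c x) - 0) \<le> e * norm (y - x)"
      proof (intro exI[of _ "min d1 d2"] conjI allI impI)
        fix y assume y: "norm (y - x) < min d1 d2"
        have "norm (\<xi> y) \<le> norm (\<xi> y - \<xi> x - \<xi>' (y - x)) + norm (\<xi>' (y - x))"
          using assms(2) by (smt (verit) real_norm_def)
        also have "\<dots> \<le> norm (y - x) * (K + 1)"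
          using d1(2)[of y] y K(2)[of "y - x"] by (auto simp: algebra_simps)
        finally have a: "norm (\<xi> y) \<le> norm (y - x) * (K + 1)" .
        have "norm (\<xi> y *\<^sub>R (c y - c x)) \<le> (norm (y - x) * (K + 1)) * e'"
          using d2(2)[of y] y a K(1) unfolding norm_scaleR
          by (intro mult_mono) auto
        also have "\<dots> = e * norm (y - x)"
          using K(1) by (simp add: e'_def)
        finally show "norm (\<xi> y *\<^sub>R (c y - c x) - \<xi> x *\<^sub>R (c x - c x) - 0) \<le> e * norm (y - x)"
          by simp
      qed (use d1 d2 in auto)
    qed auto
  qed
  show ?thesis
    using has_derivative_add[OF 1 2] by (simp add: algebra_simps)
qed

context
  fixes A B :: "'a::euclidean_space \<Rightarrow> 'b::euclidean_space \<Rightarrow> 'b" and S :: "'a set"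
  assumes S: "open S"
    and A: "\<And>x. x \<in> S \<Longrightarrow> linear (A x)"
    and BA: "\<And>x v. x \<in> S \<Longrightarrow> B x (A x v) = v"
    and AB: "\<And>x v. x \<in> S \<Longrightarrow> A x (B x v) = v"
begin

lemma linear_inverse_operator: "x \<in> S \<Longrightarrow> linear (B x)"
  using A AB BA
  by (smt (verit, ccfv_threshold) linear_iff)

text \<open>The inverses stay bounded near \<open>x\<close>, and \<open>B y - B x = - B y (A y - A x) B x\<close>.\<close>

lemma continuous_on_inverse_operator:
  assumes cont: "\<And>v. continuous_on S (\<lambda>x. A x v)"
  shows "continuous_on S (\<lambda>x. B x v)"
  unfolding continuous_on_eq_continuous_at[OF S] isCont_def
proof
  fix x assume x: "x \<in> S"
  obtain K where K: "K > 0" "\<And>w. norm (B x w) \<le> K * norm w"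
    using linear_bounded_pos[OF linear_inverse_operator[OF x]] by metis
  \<comment> \<open>\<open>\<eta>\<close> bounds the operator norm of \<open>A y - A x\<close>; once it is below
    \<open>1 / (2 * K)\<close>, the operator \<open>B y\<close> is bounded by \<open>2 * K\<close>.\<close>
  define \<eta> where "\<eta> y = (\<Sum>b\<in>Basis. norm (A y b - A x b))" for y
  have \<eta>: "norm (A y w - A x w) \<le> \<eta> y * norm w" if "y \<in> S" for y w
  proof -
    have "A y w - A x w = (\<Sum>b\<in>Basis. (w \<bullet> b) *\<^sub>R (A y b - A x b))"
      using linear_basis_expansion[OF A[OF that], of w] linear_basis_expansion[OF A[OF x], of w]
      by (simp add: sum_subtractf scaleR_right_diff_distrib)
    also have "norm \<dots> \<le> (\<Sum>b\<in>Basis. norm w * norm (A y b - A x b))"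
      by (rule sum_norm_le) (auto intro!: mult_right_mono Basis_le_norm)
    finally show ?thesis by (simp add: \<eta>_def sum_distrib_left mult.commute)
  qed
  have lim: "(\<eta> \<longlongrightarrow> 0) (at x)"
  proof -
    have "((\<lambda>y. A y b - A x b) \<longlongrightarrow> 0) (at x)" for b
      using cont[of b] x S by (simp add: continuous_on_eq_continuous_at isCont_def LIM_zero)
    then have "(\<eta> \<longlongrightarrow> (\<Sum>b\<in>(Basis::'b set). 0)) (at x)"
      unfolding \<eta>_def by (intro tendsto_sum tendsto_norm_zero)
    then show ?thesis by simp
  qed
  have ev: "\<forall>\<^sub>F y in at x. y \<in> S" "\<forall>\<^sub>F y in at x. \<eta> y < 1 / (2 * K)"
    using S x lim K(1) eventually_at_topological order_tendstoD(2)[OF lim, of "1 / (2*K)"] by auto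
  have bound: "\<forall>\<^sub>F y in at x. norm (B y v - B x v) \<le> 2 * K * (\<eta> y * norm (B x v))"
    using ev
  proof eventually_elim
    case (elim y)
    have pos: "\<eta> y \<ge> 0" by (simp add: \<eta>_def sum_nonneg)
    have "norm (B y w) \<le> 2 * K * norm w" for w
    proof -
      have "norm (B y w) = norm (B x (A x (B y w)))" using BA[OF x] by simp
      also have "\<dots> \<le> K * norm (A x (B y w))" by (rule K)
      also have "norm (A x (B y w)) \<le> norm (A y (B y w)) + norm (A y (B y w) - A x (B y w))"
        by (metis norm_minus_commute norm_triangle_sub)
      also have "\<dots> \<le> norm w + \<eta> y * norm (B y w)"
        using \<eta>[OF elim(1), of "B y w"] AB[OF elim(1), of w] by simp
      also have "\<dots> \<le> norm w + (1 / (2*K)) * norm (B y w)"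
        using elim(2) by (intro add_left_mono mult_right_mono) auto
      finally have "norm (B y w) \<le> K * (norm w + (1 / (2*K)) * norm (B y w))"
        using K(1) by simp
      then show ?thesis using K(1) by (simp add: field_simps)
    qed
    moreover have "B y v - B x v = B y (A x (B x v) - A y (B x v))"
      using linear_diff[OF linear_inverse_operator[OF elim(1)]] BA[OF elim(1)] AB[OF x] by simp
    ultimately have "norm (B y v - B x v) \<le> 2 * K * norm (A x (B x v) - A y (B x v))"
      by simp
    also have "\<dots> \<le> 2 * K * (\<eta> y * norm (B x v))"
      using \<eta>[OF elim(1)] K(1) by (metis mult_le_cancel_left_pos norm_minus_commute mult_pos_pos zero_less_numeral)
    finally show ?case .
  qed
  have "((\<lambda>y. B y v - B x v) \<longlongrightarrow> 0) (at x)"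
  proof (rule tendsto_0_le[where K=1])
    show "((\<lambda>y. 2 * K * (\<eta> y * norm (B x v))) \<longlongrightarrow> 0) (at x)"
      using lim by (auto intro!: tendsto_eq_intros)
    show "\<forall>\<^sub>F y in at x. norm (B y v - B x v) \<le> norm (2 * K * (\<eta> y * norm (B x v))) * 1"
      using bound by eventually_elim simp
  qed
  then show "((\<lambda>y. B y v) \<longlongrightarrow> B x v) (at x)" by (simp add: LIM_zero_iff)
qed

text \<open>The derivative of \<open>B v\<close> in direction \<open>h\<close> is \<open>- B (DA h) B v\<close>.  It contains \<open>B\<close> itself and only one
  derivative of \<open>A\<close>, which is what makes the induction on the differentiability class work.\<close>

lemma C_on_inverse_operator:
  assumes "\<And>v. C_on r (\<lambda>x. A x v) S"
  shows "C_on r (\<lambda>x. B x v) S"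
  using assms
proof (induction r arbitrary: v)
  case 0
  then show ?case using continuous_on_inverse_operator by simp
next
  case (Suc r)
  let ?D = "\<lambda>c x. frechet_derivative (\<lambda>x. A x c) (at x)"
  have BC: "C_on r (\<lambda>x. B x v) S" for v
    using Suc.IH Suc.prems C_on_SucD by blast
  have "((\<lambda>y. B y v) has_derivative
      (\<lambda>h. - (\<Sum>b\<in>Basis. (\<Sum>c\<in>Basis. (B x v \<bullet> c) * (?D c x h \<bullet> b)) *\<^sub>R B x b))) (at x)"
    if x: "x \<in> S" for x
  proof -
    define u where "u = B x v"
    \<comment> \<open>\<open>B y v = B x v - B y (\<xi> y)\<close>, and \<open>\<xi>\<close> vanishes at \<open>x\<close>.\<close>
    define \<xi> where "\<xi> y = A y u - A x u" for y
    have der: "((\<lambda>y. \<xi> y \<bullet> b) has_derivative (\<lambda>h. \<Sum>c\<in>Basis. (u \<bullet> c) * (?D c x h \<bullet> b))) (at x)" for b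
    proof (rule has_derivative_transform_within_open[OF _ S x])
      have "((\<lambda>y. A y c) has_derivative ?D c x) (at x)" for c
        using C_on_Suc_has_derivative[OF Suc.prems x] .
      then show "((\<lambda>y. (\<Sum>c\<in>Basis. (u \<bullet> c) * (A y c \<bullet> b)) - A x u \<bullet> b) has_derivative
          (\<lambda>h. \<Sum>c\<in>Basis. (u \<bullet> c) * (?D c x h \<bullet> b))) (at x)"
        by (auto intro!: derivative_eq_intros)
      show "(\<Sum>c\<in>Basis. (u \<bullet> c) * (A y c \<bullet> b)) - A x u \<bullet> b = \<xi> y \<bullet> b" if "y \<in> S" for y
        unfolding \<xi>_def linear_basis_expansion[OF A[OF that], of u]
        by (simp add: inner_diff_left inner_sum_left)
    qed
    have Bcont: "isCont (\<lambda>y. B y b) x" for b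
      using C_on_imp_continuous_on[OF BC] x S by (simp add: continuous_on_eq_continuous_at)
    have sm: "((\<lambda>y. B x v - (\<Sum>b\<in>Basis. (\<xi> y \<bullet> b) *\<^sub>R B y b)) has_derivative
        (\<lambda>h. 0 - (\<Sum>b\<in>Basis. (\<Sum>c\<in>Basis. (u \<bullet> c) * (?D c x h \<bullet> b)) *\<^sub>R B x b))) (at x)"
      by (intro has_derivative_diff has_derivative_const has_derivative_sum
          has_derivative_scaleR_at_zero[OF der _ Bcont]) (simp add: \<xi>_def)
    show ?thesis
    proof (rule has_derivative_transform_within_open[OF _ S x])
      show "((\<lambda>y. B x v - (\<Sum>b\<in>Basis. (\<xi> y \<bullet> b) *\<^sub>R B y b)) has_derivative
        (\<lambda>h. - (\<Sum>b\<in>Basis. (\<Sum>c\<in>Basis. (B x v \<bullet> c) * (?D c x h \<bullet> b)) *\<^sub>R B x b))) (at x)"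
        using sm by (simp add: u_def)
      show "B x v - (\<Sum>b\<in>Basis. (\<xi> y \<bullet> b) *\<^sub>R B y b) = B y v" if "y \<in> S" for y
        unfolding linear_basis_expansion[OF linear_inverse_operator[OF that], of "\<xi> y", symmetric]
        by (simp add: \<xi>_def u_def linear_diff[OF linear_inverse_operator[OF that]] AB[OF x] BA[OF that])
    qed
  qed
  then show ?case
  proof (rule C_on_SucI[OF S])
    fix h
    have "C_on r (\<lambda>x. ?D c x h) S" for c using Suc.prems by simp
    then have "C_on r (\<lambda>x. (B x v \<bullet> c) *\<^sub>R (?D c x h \<bullet> b)) S" for b c
      by (intro C_on_scaleR S C_on_linear_compose[OF S bounded_linear_inner_left] BC)
    then have "C_on r (\<lambda>x. (\<Sum>b\<in>Basis. (\<Sum>c\<in>Basis. (B x v \<bullet> c) *\<^sub>R (?D c x h \<bullet> b)) *\<^sub>R B x b)) S"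
      by (auto intro!: C_on_scaleR[OF S _ BC] C_on_sum[OF S])
    from C_on_linear_compose[OF S bounded_linear_minus[OF bounded_linear_ident] this]
    show "C_on r (\<lambda>x. - (\<Sum>b\<in>Basis. (\<Sum>c\<in>Basis. (B x v \<bullet> c) * (?D c x h \<bullet> b)) *\<^sub>R B x b)) S"
      by simp
  qed
qed

end

lemma smooth_onD: "smooth_on f S \<Longrightarrow> C_on r f S"
  by (simp add: smooth_on_def)

text \<open>The derivative of the inverse \<open>G\<close> is \<open>(DF)\<inverse> \<circ> G\<close>: if \<open>G\<close> is of class \<open>C\<close> to the \<open>r\<close>, so is this
  composition, and \<open>G\<close> gains one class.\<close>

lemma smooth_inverse_function_theorem:
  fixes F :: "'a::euclidean_space \<Rightarrow> 'a"
  assumes "open S" "smooth_on F S" "x0 \<in> S" "inj (frechet_derivative F (at x0))"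
  obtains U W G where "open U" "U \<subseteq> S" "x0 \<in> U" "open W" "homeomorphism U W F G" "smooth_on G W"
proof -
  let ?D = "\<lambda>x. frechet_derivative F (at x)"
  have D: "(F has_derivative ?D x) (at x)" if "x \<in> S" for x
    using C_on_Suc_has_derivative[OF smooth_onD[OF assms(2)] that] .
  have bl: "bounded_linear (?D x)" if "x \<in> S" for x
    using D[OF that] has_derivative_bounded_linear by blast
  have lin: "linear (?D x)" if "x \<in> S" for x
    using bl[OF that] by (simp add: bounded_linear.linear)
  have DC: "C_on r (\<lambda>x. ?D x v) S" for r v
    using smooth_onD[OF assms(2), of "Suc r"] by simp
  define F' where "F' x = Blinfun (?D x)" for x
  have F': "blinfun_apply (F' x) = ?D x" if "x \<in> S" for x
    unfolding F'_def using bl[OF that] by (rule bounded_linear_Blinfun_apply)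
  have cF': "continuous_on S F'"
  proof (rule continuous_on_blinfun_componentwise)
    fix i :: 'a assume "i \<in> Basis"
    show "continuous_on S (\<lambda>x. blinfun_apply (F' x) i)"
      using C_on_imp_continuous_on[OF DC[of 0 i]] F' by (simp cong: continuous_on_cong)
  qed
  obtain B0 where B0: "linear B0" "\<And>v. B0 (?D x0 v) = v"
    using linear_injective_left_inverse[OF lin[OF assms(3)] assms(4)] by (auto simp: o_def fun_eq_iff)
  have inv0: "Blinfun B0 o\<^sub>L F' x0 = id_blinfun"
    by (rule blinfun_eqI) (simp add: B0 F'[OF assms(3)] bounded_linear_Blinfun_apply linear_conv_bounded_linear[symmetric])
  obtain U W G G' where *: "open U" "U \<subseteq> S" "x0 \<in> U" "open W" "homeomorphism U W F G"
    and G: "\<And>y. y \<in> W \<Longrightarrow> (G has_derivative (G' y)) (at y)"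
      "\<And>y. y \<in> W \<Longrightarrow> G' y = inv_into UNIV (blinfun_apply (F'(G y)))"
      "\<And>y. y \<in> W \<Longrightarrow> bij (blinfun_apply (F'(G y)))"
    using inverse_function_theorem[OF assms(1) _ cF' assms(3) inv0, of F] D F' by metis
  have GU: "G ` W \<subseteq> U" using *(5) by (auto simp: homeomorphism_def)
  have bij: "bij (?D x)" if "x \<in> U" for x
  proof -
    have "F x \<in> W" "G (F x) = x" using *(5) that by (auto simp: homeomorphism_def)
    then show ?thesis using G(3)[of "F x"] F' that *(2) by auto
  qed
  have BC: "C_on r (\<lambda>x. inv_into UNIV (?D x) v) U" for r v
  proof (rule C_on_inverse_operator[OF *(1), of ?D])
    show "C_on r (\<lambda>x. ?D x v) U" for v using DC C_on_subset *(2) by blast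
    show "inv_into UNIV (?D x) (?D x v) = v" "?D x (inv_into UNIV (?D x) v) = v" if "x \<in> U" for x v
      using bij[OF that] by (auto simp: bij_is_inj bij_is_surj surj_f_inv_f)
  qed (use lin *(2) in auto)
  have "C_on r G W" for r
  proof (induction r)
    case 0
    then show ?case using *(5) by (simp add: homeomorphism_def)
  next
    case (Suc r)
    have "(G has_derivative inv_into UNIV (?D (G y))) (at y)" if "y \<in> W" for y
      using G(1,2)[OF that] F' GU that *(2) by (metis image_subset_iff subsetD)
    moreover have "C_on r (\<lambda>y. inv_into UNIV (?D (G y)) v) W" for v
      by (rule C_on_compose[OF *(4,1) Suc BC GU])
    ultimately show ?case by (rule C_on_SucI[OF *(4)])
  qed
  then have "smooth_on G W" by (simp add: smooth_on_def)
  with * show ?thesis using that by blast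
qed

section \<open>Smooth maps\<close>

lemma smooth_onI: "(\<And>r. C_on r f S) \<Longrightarrow> smooth_on f S"
  by (simp add: smooth_on_def)

lemma smooth_on_compose:
  assumes "open S" "open T" "smooth_on f S" "smooth_on g T" "f ` S \<subseteq> T"
  shows "smooth_on (\<lambda>x. g (f x)) S"
  by (rule smooth_onI) (rule C_on_compose[OF assms(1,2) smooth_onD[OF assms(3)] smooth_onD[OF assms(4)] assms(5)])

lemma smooth_on_Pair:
  assumes "open S" "smooth_on f S" "smooth_on g S"
  shows "smooth_on (\<lambda>x. (f x, g x)) S"
  by (rule smooth_onI) (rule C_on_Pair[OF assms(1) smooth_onD[OF assms(2)] smooth_onD[OF assms(3)]])

lemma smooth_on_bounded_linear: "bounded_linear L \<Longrightarrow> smooth_on L S"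
  by (rule smooth_onI) (rule C_on_bounded_linear)

lemma smooth_on_const: "smooth_on (\<lambda>x. c) S"
  by (rule smooth_onI) (rule C_on_const)

lemma smooth_on_linear_compose:
  assumes "open S" "bounded_linear L" "smooth_on f S"
  shows "smooth_on (\<lambda>x. L (f x)) S"
  by (rule smooth_onI) (rule C_on_linear_compose[OF assms(1,2) smooth_onD[OF assms(3)]])

lemma smooth_on_has_derivative:
  "smooth_on f S \<Longrightarrow> x \<in> S \<Longrightarrow> (f has_derivative frechet_derivative f (at x)) (at x)"
  by (rule C_on_Suc_has_derivative[OF smooth_onD])

lemma smooth_on_imp_continuous_on: "smooth_on f S \<Longrightarrow> continuous_on S f"
  by (rule C_on_imp_continuous_on[OF smooth_onD])

lemma smooth_on_vec_componentwise:
  fixes h :: "'a::euclidean_space \<Rightarrow> real^'k"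
  assumes "open S" "\<And>l. smooth_on (\<lambda>x. h x $ l) S"
  shows "smooth_on h S"
proof (rule smooth_onI)
  fix r
  have "C_on r (\<lambda>x. \<Sum>l\<in>UNIV. h x $ l *\<^sub>R (axis l 1 :: real^'k)) S"
    by (rule C_on_sum[OF assms(1)], rule C_on_scaleR[OF assms(1) smooth_onD[OF assms(2)] C_on_const])
  moreover have "(\<Sum>l\<in>UNIV. h x $ l *\<^sub>R (axis l 1 :: real^'k)) = h x" for x
    using basis_expansion[of "h x"] by (simp add: scalar_mult_eq_scaleR)
  ultimately show "C_on r h S" by simp
qed

section \<open>Real analytic maps are smooth\<close>

definition monomial_at :: "('a::euclidean_space \<Rightarrow> nat) \<Rightarrow> 'a \<Rightarrow> real" where
  "monomial_at \<alpha> y = (\<Prod>b\<in>Basis. (y \<bullet> b) ^ \<alpha> b)"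

definition cube :: "real \<Rightarrow> 'a::euclidean_space set" where
  "cube \<rho> = {y. \<forall>b\<in>Basis. \<bar>y \<bullet> b\<bar> < \<rho>}"

lemma mem_cube: "y \<in> cube \<rho> \<longleftrightarrow> (\<forall>b\<in>Basis. \<bar>y \<bullet> b\<bar> < \<rho>)"
  by (simp add: cube_def)

lemma cube_eq_box: "cube \<rho> = box (- (\<rho> *\<^sub>R One)) (\<rho> *\<^sub>R One)"
  unfolding cube_def box_def by (intro Collect_cong ball_cong refl) (simp, linarith)

lemma open_cube: "open (cube \<rho>)"
  by (simp add: cube_eq_box open_box)

lemma convex_cube: "convex (cube \<rho>)"
  by (simp add: cube_eq_box convex_box)

lemma cube_mono: "\<rho> \<le> \<rho>' \<Longrightarrow> cube \<rho> \<subseteq> cube \<rho>'"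
  using order_less_le_trans by (fastforce simp: mem_cube)

text \<open>The exponents \<open>\<alpha> i\<close> need not be distinct.  Differentiating termwise then keeps the index set and only
  changes coefficients and exponents, so no series has to be rearranged.\<close>

definition monomial_series_on :: "real \<Rightarrow> ('a::euclidean_space \<Rightarrow> 'b::euclidean_space) \<Rightarrow> bool" where
  "monomial_series_on \<rho> f \<longleftrightarrow> (\<exists>(c :: nat \<Rightarrow> 'b) (\<alpha> :: nat \<Rightarrow> 'a \<Rightarrow> nat).
     summable (\<lambda>i. norm (c i) * \<rho> ^ (\<Sum>b\<in>Basis. \<alpha> i b)) \<and>
     (\<forall>y\<in>cube \<rho>. (\<lambda>i. monomial_at (\<alpha> i) y *\<^sub>R c i) sums f y))"

lemma has_derivative_monomial_at:
  "(monomial_at \<alpha> has_derivative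
     (\<lambda>v. \<Sum>b\<in>Basis. (v \<bullet> b) * (of_nat (\<alpha> b) * monomial_at (\<alpha>(b := \<alpha> b - 1)) y))) (at y)"
proof -
  have split: "monomial_at (\<alpha>(b := k)) y = (y \<bullet> b) ^ k * (\<Prod>j\<in>Basis - {b}. (y \<bullet> j) ^ \<alpha> j)"
    if "b \<in> Basis" for b k
    unfolding monomial_at_def using that
    by (subst prod.remove[of _ b]) (auto intro!: disjI2 prod.cong)
  have "((\<lambda>y. \<Prod>b\<in>Basis. (y \<bullet> b) ^ \<alpha> b) has_derivative
     (\<lambda>v. \<Sum>b\<in>Basis. (of_nat (\<alpha> b) * (v \<bullet> b) * (y \<bullet> b) ^ (\<alpha> b - 1)) *
        (\<Prod>j\<in>Basis - {b}. (y \<bullet> j) ^ \<alpha> j))) (at y)"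
    by (intro has_derivative_prod has_derivative_power bounded_linear_imp_has_derivative
        bounded_linear_inner_left)
  moreover have "(\<lambda>v. \<Sum>b\<in>Basis. (of_nat (\<alpha> b) * (v \<bullet> b) * (y \<bullet> b) ^ (\<alpha> b - 1)) *
        (\<Prod>j\<in>Basis - {b}. (y \<bullet> j) ^ \<alpha> j)) =
     (\<lambda>v. \<Sum>b\<in>Basis. (v \<bullet> b) * (of_nat (\<alpha> b) * monomial_at (\<alpha>(b := \<alpha> b - 1)) y))"
    using split by (intro ext sum.cong refl) simp
  ultimately show ?thesis unfolding monomial_at_def[abs_def] by simp
qed

lemma abs_monomial_at_le:
  assumes "y \<in> cube \<rho>"
  shows "\<bar>monomial_at \<alpha> y\<bar> \<le> \<rho> ^ (\<Sum>b\<in>Basis. \<alpha> b)"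
proof -
  have "\<bar>monomial_at \<alpha> y\<bar> = (\<Prod>b\<in>Basis. \<bar>y \<bullet> b\<bar> ^ \<alpha> b)"
    by (simp add: monomial_at_def abs_prod power_abs)
  also have "\<dots> \<le> (\<Prod>b\<in>Basis. \<rho> ^ \<alpha> b)"
    using assms by (intro prod_mono) (auto simp: mem_cube less_imp_le intro: power_mono)
  finally show ?thesis by (simp add: power_sum)
qed

text \<open>Shrinking the cube absorbs the exponents that differentiation brings down.\<close>

lemma derived_coefficient_bound:
  fixes \<rho> \<rho>' :: real
  assumes "0 < \<rho>'" "\<rho>' < \<rho>"
  obtains K where "K \<ge> 0" "\<And>n. of_nat n * \<rho>' ^ (n - 1) \<le> K * \<rho> ^ n"
proof -
  let ?x = "\<rho>' / \<rho>"
  have "(\<lambda>n. of_nat n * ?x ^ n) \<longlonglongrightarrow> 0"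
    by (rule powser_times_n_limit_0) (use assms in auto)
  then have "Bseq (\<lambda>n. of_nat n * ?x ^ n)"
    by (intro convergent_imp_Bseq) (auto simp: convergent_def)
  then obtain C where C: "C > 0" "\<And>n. \<bar>of_nat n * ?x ^ n\<bar> \<le> C"
    by (auto simp: Bseq_def)
  have "of_nat n * \<rho>' ^ (n - 1) \<le> (C / \<rho>') * \<rho> ^ n" for n
  proof (cases n)
    case (Suc m)
    have "of_nat n * ?x ^ n \<le> C" using C(2)[of n] by (rule order_trans[OF abs_ge_self])
    then have "of_nat n * \<rho>' ^ n \<le> C * \<rho> ^ n"
      using assms by (simp add: power_divide pos_divide_le_eq)
    moreover have "of_nat n * \<rho>' ^ (n - 1) = (of_nat n * \<rho>' ^ n) / \<rho>'"
      using assms Suc by simp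
    ultimately show ?thesis
      using assms(1) by (simp add: divide_right_mono)
  qed (use C assms in auto)
  moreover have "C / \<rho>' \<ge> 0" using C assms by simp
  ultimately show ?thesis using that by blast
qed

text \<open>Termwise differentiation: on the smaller cube the series of derivatives has a summable majorant.\<close>

lemma monomial_series_on_derivative:
  fixes f :: "'a::euclidean_space \<Rightarrow> 'b::euclidean_space"
  assumes "monomial_series_on \<rho> f" "0 < \<rho>'" "\<rho>' < \<rho>"
  obtains G where "\<And>b. b \<in> Basis \<Longrightarrow> monomial_series_on \<rho>' (G b)"
    "\<And>y. y \<in> cube \<rho>' \<Longrightarrow> (f has_derivative (\<lambda>v. \<Sum>b\<in>Basis. (v \<bullet> b) *\<^sub>R G b y)) (at y)"
proof -
  obtain c :: "nat \<Rightarrow> 'b" and \<alpha> :: "nat \<Rightarrow> 'a \<Rightarrow> nat"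
    where summ: "summable (\<lambda>i. norm (c i) * \<rho> ^ (\<Sum>b\<in>Basis. \<alpha> i b))"
      and f: "\<And>y. y \<in> cube \<rho> \<Longrightarrow> (\<lambda>i. monomial_at (\<alpha> i) y *\<^sub>R c i) sums f y"
    using assms(1) unfolding monomial_series_on_def by blast
  obtain K where K: "K \<ge> 0" "\<And>n. of_nat n * \<rho>' ^ (n - 1) \<le> K * \<rho> ^ n"
    using derived_coefficient_bound[OF assms(2,3)] by blast
  have sub: "cube \<rho>' \<subseteq> (cube \<rho> :: 'a set)"
    using assms(3) by (simp add: cube_mono)
  define c' where "c' b i = of_nat (\<alpha> i b) *\<^sub>R c i" for b i
  define \<beta> where "\<beta> b i = (\<alpha> i)(b := \<alpha> i b - 1)" for b i
  define t where "t b i y = monomial_at (\<beta> b i) y *\<^sub>R c' b i" for b i y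
  define G where "G b y = (\<Sum>i. t b i y)" for b y
  define m where "m i = K * (norm (c i) * \<rho> ^ (\<Sum>b\<in>Basis. \<alpha> i b))" for i
  have m: "summable m" unfolding m_def using summ by (rule summable_mult)
  have cb: "norm (c' b i) * \<rho>' ^ (\<Sum>j\<in>Basis. \<beta> b i j) \<le> m i" if b: "b \<in> Basis" for b i
  proof (cases "\<alpha> i b = 0")
    case True
    then show ?thesis using K(1) assms by (simp add: c'_def m_def)
  next
    case False
    let ?N = "\<Sum>j\<in>Basis. \<alpha> i j"
    have s: "(\<Sum>j\<in>Basis. \<alpha> i j) = \<alpha> i b + (\<Sum>j\<in>Basis - {b}. \<alpha> i j)"
      using b by (simp add: sum.remove)
    have "(\<Sum>j\<in>Basis. \<beta> b i j) = \<beta> b i b + (\<Sum>j\<in>Basis - {b}. \<beta> b i j)"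
      using b by (simp add: sum.remove)
    also have "(\<Sum>j\<in>Basis - {b}. \<beta> b i j) = (\<Sum>j\<in>Basis - {b}. \<alpha> i j)"
      by (intro sum.cong) (auto simp: \<beta>_def)
    finally have N: "(\<Sum>j\<in>Basis. \<beta> b i j) = ?N - 1"
      using False s by (simp add: \<beta>_def)
    have "norm (c' b i) * \<rho>' ^ (\<Sum>j\<in>Basis. \<beta> b i j) = norm (c i) * (of_nat (\<alpha> i b) * \<rho>' ^ (?N - 1))"
      by (simp add: c'_def N)
    also have "\<dots> \<le> norm (c i) * (of_nat ?N * \<rho>' ^ (?N - 1))"
      using assms s by (intro mult_left_mono mult_right_mono of_nat_mono) auto
    also have "\<dots> \<le> norm (c i) * (K * \<rho> ^ ?N)"
      by (rule mult_left_mono[OF K(2) norm_ge_zero])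
    finally show ?thesis by (simp add: m_def mult_ac)
  qed
  have tb: "norm (t b i y) \<le> m i" if "b \<in> Basis" "y \<in> cube \<rho>'" for b i y
  proof -
    have "norm (t b i y) \<le> \<rho>' ^ (\<Sum>j\<in>Basis. \<beta> b i j) * norm (c' b i)"
      unfolding t_def norm_scaleR using abs_monomial_at_le[OF that(2)]
      by (intro mult_right_mono) auto
    with cb[OF that(1)] show ?thesis by (simp add: mult.commute order_trans)
  qed
  have ul: "uniform_limit (cube \<rho>') (\<lambda>n y. \<Sum>i<n. t b i y) (G b) sequentially" if "b \<in> Basis" for b
    unfolding G_def by (rule Weierstrass_m_test[OF tb[OF that] m])
  have Gs: "(\<lambda>i. t b i y) sums G b y" if "b \<in> Basis" "y \<in> cube \<rho>'" for b y
    unfolding G_def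
    by (rule summable_sums, rule summable_comparison_test'[OF m]) (use tb[OF that] in auto)
  have "monomial_series_on \<rho>' (G b)" if "b \<in> Basis" for b
    unfolding monomial_series_on_def
  proof (intro exI[of _ "c' b"] exI[of _ "\<beta> b"] conjI ballI)
    show "summable (\<lambda>i. norm (c' b i) * \<rho>' ^ (\<Sum>j\<in>Basis. \<beta> b i j))"
      by (rule summable_comparison_test'[OF m]) (use cb[OF that] assms in \<open>auto simp: abs_mult\<close>)
    show "(\<lambda>i. monomial_at (\<beta> b i) y *\<^sub>R c' b i) sums G b y" if "y \<in> cube \<rho>'" for y
      using Gs[OF \<open>b \<in> Basis\<close> that] by (simp add: t_def)
  qed
  moreover have "(f has_derivative (\<lambda>v. \<Sum>b\<in>Basis. (v \<bullet> b) *\<^sub>R G b y)) (at y)" if y: "y \<in> cube \<rho>'" for y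
  proof -
    have "\<exists>g. \<forall>x\<in>cube \<rho>'. (\<lambda>n. monomial_at (\<alpha> n) x *\<^sub>R c n) sums g x \<and>
        (g has_derivative (\<lambda>v. \<Sum>b\<in>Basis. (v \<bullet> b) *\<^sub>R G b x)) (at x within cube \<rho>')"
    proof (rule has_derivative_series[OF convex_cube _ _ y f])
      show "y \<in> cube \<rho>" using y sub by auto
      show "((\<lambda>x. monomial_at (\<alpha> n) x *\<^sub>R c n) has_derivative
          (\<lambda>v. \<Sum>b\<in>Basis. (v \<bullet> b) *\<^sub>R t b n x)) (at x within cube \<rho>')" for n x
        by (rule has_derivative_at_withinI,
            rule has_derivative_eq_rhs[OF has_derivative_scaleR_left[OF has_derivative_monomial_at]])
           (simp add: t_def c'_def \<beta>_def scaleR_sum_left mult_ac)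
      fix e :: real assume e: "e > 0"
      define e' where "e' = e / DIM('a)"
      have "e' > 0" using e by (simp add: e'_def)
      then have "\<forall>\<^sub>F n in sequentially. \<forall>b\<in>Basis. \<forall>x\<in>cube \<rho>'. dist (\<Sum>i<n. t b i x) (G b x) < e'"
        using ul by (intro eventually_ball_finite) (simp_all add: uniform_limit_iff)
      then show "\<forall>\<^sub>F n in sequentially. \<forall>x\<in>cube \<rho>'. \<forall>h.
          norm ((\<Sum>i<n. \<Sum>b\<in>Basis. (h \<bullet> b) *\<^sub>R t b i x) - (\<Sum>b\<in>Basis. (h \<bullet> b) *\<^sub>R G b x)) \<le> e * norm h"
      proof eventually_elim
        case (elim n)
        show ?case
        proof (intro ballI allI)
          fix x h :: 'a assume x: "x \<in> cube \<rho>'"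
          have "(\<Sum>i<n. \<Sum>b\<in>Basis. (h \<bullet> b) *\<^sub>R t b i x) - (\<Sum>b\<in>Basis. (h \<bullet> b) *\<^sub>R G b x) =
              (\<Sum>b\<in>Basis. (h \<bullet> b) *\<^sub>R ((\<Sum>i<n. t b i x) - G b x))"
            by (subst sum.swap) (simp add: scaleR_sum_right[symmetric] sum_subtractf[symmetric] scaleR_diff_right)
          also have "norm \<dots> \<le> (\<Sum>b\<in>(Basis::'a set). norm h * e')"
          proof (rule sum_norm_le)
            fix b :: 'a assume b: "b \<in> Basis"
            show "norm ((h \<bullet> b) *\<^sub>R ((\<Sum>i<n. t b i x) - G b x)) \<le> norm h * e'"
              unfolding norm_scaleR using elim b x Basis_le_norm[OF b, of h]
              by (intro mult_mono) (auto simp: dist_norm less_imp_le)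
          qed
          also have "\<dots> = e * norm h" by (simp add: e'_def)
          finally show "norm ((\<Sum>i<n. \<Sum>b\<in>Basis. (h \<bullet> b) *\<^sub>R t b i x) - (\<Sum>b\<in>Basis. (h \<bullet> b) *\<^sub>R G b x)) \<le> e * norm h" .
        qed
      qed
    qed
    then obtain g where g: "\<And>x. x \<in> cube \<rho>' \<Longrightarrow> (\<lambda>n. monomial_at (\<alpha> n) x *\<^sub>R c n) sums g x"
      "(g has_derivative (\<lambda>v. \<Sum>b\<in>Basis. (v \<bullet> b) *\<^sub>R G b y)) (at y within cube \<rho>')"
      using y by blast
    have "(g has_derivative (\<lambda>v. \<Sum>b\<in>Basis. (v \<bullet> b) *\<^sub>R G b y)) (at y)"
      using g(2) at_within_open[OF y open_cube] by simp
    then show ?thesis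
      by (rule has_derivative_transform_within_open[OF _ open_cube y])
         (use g(1) f sub sums_unique2 in blast)
  qed
  ultimately show ?thesis using that by blast
qed

text \<open>Each differentiation costs a bit of the cube, so the induction leaves the outer radius free and moves
  it halfway towards the fixed inner one.\<close>

lemma C_on_monomial_series:
  assumes "monomial_series_on \<rho> f" "0 < \<rho>'" "\<rho>' < \<rho>"
  shows "C_on r f (cube \<rho>')"
  using assms
proof (induction r arbitrary: f \<rho>)
  case 0
  show ?case
  proof (rule monomial_series_on_derivative[OF 0])
    fix G
    assume "\<And>y. y \<in> cube \<rho>' \<Longrightarrow> (f has_derivative (\<lambda>v. \<Sum>b\<in>Basis. (v \<bullet> b) *\<^sub>R G b y)) (at y)"
    then have "continuous (at y) f" if "y \<in> cube \<rho>'" for y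
      using has_derivative_continuous that by blast
    then have "continuous_on (cube \<rho>') f"
      by (intro continuous_at_imp_continuous_on) blast
    then show "C_on 0 f (cube \<rho>')"
      by simp
  qed
next
  case (Suc r)
  define \<rho>'' where "\<rho>'' = (\<rho> + \<rho>') / 2"
  have \<rho>'': "0 < \<rho>''" "\<rho>'' < \<rho>" "\<rho>' < \<rho>''"
    unfolding \<rho>''_def using Suc.prems(2,3) by auto
  have sub: "cube \<rho>' \<subseteq> (cube \<rho>'' :: 'a set)"
    using \<rho>''(3) by (simp add: cube_mono)
  show ?case
  proof (rule monomial_series_on_derivative[OF Suc.prems(1) \<rho>''(1,2)])
    fix G
    assume G: "\<And>b. b \<in> Basis \<Longrightarrow> monomial_series_on \<rho>'' (G b)"
      "\<And>y. y \<in> cube \<rho>'' \<Longrightarrow> (f has_derivative (\<lambda>v. \<Sum>b\<in>Basis. (v \<bullet> b) *\<^sub>R G b y)) (at y)"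
    have C: "C_on r (\<lambda>y. \<Sum>b\<in>Basis. (v \<bullet> b) *\<^sub>R G b y) (cube \<rho>')" for v
      by (rule C_on_sum[OF open_cube], rule C_on_scaleR[OF open_cube C_on_const])
         (rule Suc.IH[OF G(1) Suc.prems(2) \<rho>''(3)])
    show ?case
      by (rule C_on_SucI[OF open_cube G(2) C]) (rule subsetD[OF sub])
  qed
qed

text \<open>In finite dimensions an unconditionally convergent family converges absolutely.  At the corner of a
  cube inside the ball of convergence this gives the majorant for the whole cube; enumerating the
  multi-indices turns the family into a series.\<close>

lemma real_analytic_on_imp_monomial_series:
  fixes f :: "'a::euclidean_space \<Rightarrow> 'b::euclidean_space"
  assumes "real_analytic_on f S" "p \<in> S"
  obtains \<rho> where "\<rho> > 0" "monomial_series_on \<rho> (\<lambda>y. f (p + y))"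
proof -
  obtain c r where r: "r > 0"
    and c: "\<And>y. y \<in> ball p r \<Longrightarrow> ((\<lambda>\<alpha>. (\<Prod>b\<in>Basis. ((y - p) \<bullet> b) ^ \<alpha> b) *\<^sub>R c \<alpha>) has_sum f y)
                        (Basis \<rightarrow>\<^sub>E (UNIV :: nat set))"
    using assms unfolding real_analytic_on_def by blast
  define I where "I = (Basis :: 'a set) \<rightarrow>\<^sub>E (UNIV :: nat set)"
  define \<rho> where "\<rho> = r / (2 * DIM('a))"
  have \<rho>: "\<rho> > 0" using r by (simp add: \<rho>_def)
  have small: "norm y < r" if "\<And>b. b \<in> Basis \<Longrightarrow> \<bar>y \<bullet> b\<bar> \<le> \<rho>" for y :: 'a
  proof -
    have "norm y \<le> (\<Sum>b\<in>Basis. \<bar>y \<bullet> b\<bar>)" by (rule norm_le_l1)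
    also have "\<dots> \<le> (\<Sum>b\<in>(Basis::'a set). \<rho>)" using that by (rule sum_mono)
    also have "\<dots> < r" using r by (simp add: \<rho>_def)
    finally show ?thesis .
  qed
  have hs: "((\<lambda>\<alpha>. monomial_at \<alpha> y *\<^sub>R c \<alpha>) has_sum f (p + y)) I"
    if "\<And>b. b \<in> Basis \<Longrightarrow> \<bar>y \<bullet> b\<bar> \<le> \<rho>" for y
    using c[of "p + y"] small[OF that] by (simp add: monomial_at_def I_def dist_norm)
  have "countable I" unfolding I_def by (intro countable_PiE) auto
  moreover have "infinite I"
  proof -
    obtain b :: 'a where b: "b \<in> Basis" using nonempty_Basis by blast
    have "inj (\<lambda>n::nat. \<lambda>x\<in>(Basis::'a set). n)"
      by (rule injI) (metis b restrict_apply')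
    moreover have "range (\<lambda>n::nat. \<lambda>x\<in>(Basis::'a set). n) \<subseteq> I" by (auto simp: I_def)
    ultimately show ?thesis using range_inj_infinite finite_subset by blast
  qed
  ultimately have bij: "bij_betw (from_nat_into I) UNIV I" by (rule bij_betw_from_nat_into)
  define \<alpha> where "\<alpha> = from_nat_into I"
  have hs': "((\<lambda>i. monomial_at (\<alpha> i) y *\<^sub>R c (\<alpha> i)) has_sum f (p + y)) UNIV"
    if "\<And>b. b \<in> Basis \<Longrightarrow> \<bar>y \<bullet> b\<bar> \<le> \<rho>" for y
    using hs[OF that] has_sum_reindex_bij_betw[OF bij, of "\<lambda>\<alpha>. monomial_at \<alpha> y *\<^sub>R c \<alpha>"]
    by (simp add: \<alpha>_def)
  have "monomial_series_on \<rho> (\<lambda>y. f (p + y))"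
    unfolding monomial_series_on_def
  proof (intro exI[of _ "\<lambda>i. c (\<alpha> i)"] exI[of _ \<alpha>] conjI ballI)
    show "(\<lambda>i. monomial_at (\<alpha> i) y *\<^sub>R c (\<alpha> i)) sums f (p + y)" if "y \<in> cube \<rho>" for y
      using that by (intro has_sum_imp_sums hs') (auto simp: mem_cube intro: less_imp_le)
    define s where "s i = \<rho> ^ (\<Sum>b\<in>Basis. \<alpha> i b) *\<^sub>R c (\<alpha> i)" for i
    have "monomial_at (\<alpha> i) (\<rho> *\<^sub>R One) = \<rho> ^ (\<Sum>b\<in>Basis. \<alpha> i b)" for i
      by (simp add: monomial_at_def power_sum)
    then have "(s has_sum f (p + \<rho> *\<^sub>R One)) UNIV"
      using hs'[of "\<rho> *\<^sub>R One"] \<rho> by (simp add: s_def[abs_def])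
    then have "((\<lambda>i. s i \<bullet> b) has_sum (f (p + \<rho> *\<^sub>R One) \<bullet> b)) UNIV" for b
      by (rule has_sum_bounded_linear[OF bounded_linear_inner_left])
    then have "(\<lambda>i. s i \<bullet> b) summable_on UNIV" for b
      by (rule has_sum_imp_summable)
    then have abs_on: "(\<lambda>i. norm (s i \<bullet> b)) summable_on UNIV" for b
      by (rule iffD1[OF summable_on_iff_abs_summable_on_real])
    have "summable (\<lambda>i. \<bar>s i \<bullet> b\<bar>)" for b
      using summable_on_imp_summable[OF abs_on[of b]] unfolding real_norm_def .
    then have "summable (\<lambda>i. \<Sum>b\<in>Basis. \<bar>s i \<bullet> b\<bar>)" by (intro summable_sum) auto
    then have "summable (\<lambda>i. norm (s i))"
      by (rule summable_comparison_test'[where N=0]) (simp add: norm_le_l1)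
    then show "summable (\<lambda>i. norm (c (\<alpha> i)) * \<rho> ^ (\<Sum>b\<in>Basis. \<alpha> i b))"
      using \<rho> by (simp add: s_def mult.commute)
  qed
  with \<rho> show ?thesis using that by blast
qed

lemma real_analytic_on_imp_locally_smooth:
  assumes "real_analytic_on f S" "p \<in> S"
  obtains U where "open U" "p \<in> U" "smooth_on f U"
proof -
  obtain \<rho> where \<rho>: "\<rho> > 0" "monomial_series_on \<rho> (\<lambda>y. f (p + y))"
    using real_analytic_on_imp_monomial_series[OF assms] .
  define U where "U = (\<lambda>x. x - p) -` cube (\<rho> / 2)"
  have U: "open U" unfolding U_def by (intro open_vimage open_cube continuous_intros)
  have "C_on r f U" for r
  proof -
    have "bounded_linear (\<lambda>x::'a. x)" by (rule bounded_linear_ident)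
    then have "C_on r (\<lambda>x. x + - p) U"
      by (rule C_on_add[OF U C_on_bounded_linear C_on_const])
    then have "C_on r (\<lambda>x. x - p) U" by simp
    moreover have "C_on r (\<lambda>y. f (p + y)) (cube (\<rho> / 2))"
      using \<rho> by (intro C_on_monomial_series[OF \<rho>(2)]) auto
    ultimately have "C_on r (\<lambda>x. f (p + (x - p))) U"
      by (rule C_on_compose[OF U open_cube]) (auto simp: U_def)
    then show ?thesis by simp
  qed
  moreover have "p \<in> U" using \<rho>(1) by (simp add: U_def mem_cube)
  ultimately show ?thesis using U that by (auto simp: smooth_on_def)
qed

section \<open>Local solutions and the derivative of a first integral\<close>

text \<open>The partial derivatives are bounded on the compact ball, hence so is the operator norm of the derivative.\<close>

lemma C_on_1_imp_Lipschitz_cball: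
  fixes g :: "'a::euclidean_space \<Rightarrow> 'b::euclidean_space"
  assumes "C_on (Suc 0) g S" "cball x0 d \<subseteq> S"
  obtains L where "L \<ge> 0" "\<And>x y. x \<in> cball x0 d \<Longrightarrow> y \<in> cball x0 d \<Longrightarrow> norm (g x - g y) \<le> L * norm (x - y)"
proof -
  let ?D = "\<lambda>x. frechet_derivative g (at x)"
  have "\<exists>K. \<forall>x\<in>cball x0 d. norm (?D x b) \<le> K" for b
  proof -
    have "continuous_on (cball x0 d) (\<lambda>x. ?D x b)"
      using assms by (auto intro: continuous_on_subset)
    then have "bounded ((\<lambda>x. ?D x b) ` cball x0 d)"
      by (intro compact_imp_bounded compact_continuous_image) auto
    then show ?thesis by (auto simp: bounded_iff)
  qed
  then obtain K where K: "\<And>b x. x \<in> cball x0 d \<Longrightarrow> norm (?D x b) \<le> K b" by metis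
  define L where "L = (\<Sum>b\<in>Basis. \<bar>K b\<bar>)"
  have "norm (g x - g y) \<le> L * norm (x - y)" if "x \<in> cball x0 d" "y \<in> cball x0 d" for x y
  proof (rule differentiable_bound[OF convex_cball _ _ that])
    fix z assume z: "z \<in> cball x0 d"
    show "(g has_derivative ?D z) (at z within cball x0 d)"
      using C_on_Suc_has_derivative[OF assms(1)] z assms(2) has_derivative_at_withinI by blast
    show "onorm (?D z) \<le> L"
    proof (rule onorm_le)
      fix v
      have "?D z v = (\<Sum>b\<in>Basis. (v \<bullet> b) *\<^sub>R ?D z b)"
        using frechet_derivative_basis_expansion[OF assms(1)] z assms(2) by blast
      also have "norm \<dots> \<le> (\<Sum>b\<in>Basis. \<bar>K b\<bar> * norm v)"
      proof (rule sum_norm_le)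
        fix b :: 'a assume "b \<in> Basis"
        then have "\<bar>v \<bullet> b\<bar> \<le> norm v" by (rule Basis_le_norm)
        moreover have "norm (?D z b) \<le> \<bar>K b\<bar>" using K[OF z, of b] by linarith
        ultimately have "\<bar>v \<bullet> b\<bar> * norm (?D z b) \<le> norm v * \<bar>K b\<bar>"
          by (intro mult_mono) auto
        then show "norm ((v \<bullet> b) *\<^sub>R ?D z b) \<le> \<bar>K b\<bar> * norm v" by (simp add: mult.commute)
      qed
      also have "\<dots> = L * norm v" by (simp add: L_def sum_distrib_right)
      finally show "norm (?D z v) \<le> L * norm v" .
    qed
  qed
  moreover have "L \<ge> 0" by (simp add: L_def sum_nonneg)
  ultimately show ?thesis using that by blast
qed

text \<open>Picard iteration as a contraction of the space of bounded continuous functions on the line.\<close>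

lemma Lipschitz_integral_equation_solvable:
  fixes g :: "'a::euclidean_space \<Rightarrow> 'a"
  assumes "L \<ge> 0" "\<And>x y. norm (g x - g y) \<le> L * norm (x - y)"
  obtains a :: real and \<phi> where "a > 0" "continuous_on UNIV \<phi>"
    "\<forall>t\<in>{0..a}. \<phi> t = x0 + integral {0..t} (\<lambda>s. g (\<phi> s))"
proof -
  \<comment> \<open>This length makes the contraction constant \<open>a * L\<close> at most 1/2; freezing time outside \<open>{0..a}\<close> by \<open>cl\<close>
    keeps the iterates bounded on the whole line.\<close>
  define a where "a = 1 / (2 * (L + 1))"
  have a: "a > 0" "a * L \<le> 1 / 2" using assms(1) by (auto simp: a_def field_simps)
  define cl where "cl t = max 0 (min t a)" for t :: real
  have cl: "cl t \<in> {0..a}" for t using a(1) by (auto simp: cl_def)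
  have gcont: "continuous_on UNIV g"
  proof -
    have "L-lipschitz_on UNIV g"
      using assms by (auto intro!: lipschitz_onI simp: dist_norm)
    then show ?thesis by (rule lipschitz_on_continuous_on)
  qed
  define P where "P \<phi> t = x0 + integral {0..cl t} (\<lambda>s. g (apply_bcontfun \<phi> s))" for \<phi> t
  have gp: "continuous_on S (\<lambda>s. g (apply_bcontfun \<phi> s))" for \<phi> S
    by (rule continuous_on_compose2[OF gcont]) auto
  have "P \<phi> \<in> bcontfun" for \<phi>
    unfolding bcontfun_def mem_Collect_eq
  proof
    have I: "continuous_on {0..a} (\<lambda>t. x0 + integral {0..t} (\<lambda>s. g (apply_bcontfun \<phi> s)))"
      by (intro continuous_intros indefinite_integral_continuous_1 integrable_continuous_real gp)
    have "continuous_on UNIV cl" unfolding cl_def by (intro continuous_intros)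
    then show "continuous_on UNIV (P \<phi>)"
      unfolding P_def by (rule continuous_on_compose2[OF I]) (use cl in auto)
    have "bounded ((\<lambda>t. x0 + integral {0..t} (\<lambda>s. g (apply_bcontfun \<phi> s))) ` {0..a})"
      by (intro compact_imp_bounded compact_continuous_image I) auto
    then show "bounded (range (P \<phi>))"
      by (rule bounded_subset) (use cl in \<open>auto simp: P_def\<close>)
  qed
  then have app: "apply_bcontfun (Bcontfun (P \<phi>)) t = P \<phi> t" for \<phi> t
    by (simp add: Bcontfun_inverse)
  have "\<exists>!\<phi>. Bcontfun (P \<phi>) = \<phi>"
  proof (rule banach_fix_type[of "1/2"])
    show "\<forall>\<phi> \<psi>. dist (Bcontfun (P \<phi>)) (Bcontfun (P \<psi>)) \<le> 1 / 2 * dist \<phi> \<psi>"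
    proof (intro allI dist_bound)
      fix \<phi> \<psi> t
      have "P \<phi> t - P \<psi> t = integral {0..cl t} (\<lambda>s. g (apply_bcontfun \<phi> s) - g (apply_bcontfun \<psi> s))"
        unfolding P_def by (simp add: Henstock_Kurzweil_Integration.integral_diff integrable_continuous_real gp)
      also have "norm \<dots> \<le> (L * dist \<phi> \<psi>) * (cl t - 0)"
      proof (rule integral_bound)
        show "continuous_on {0..cl t} (\<lambda>s. g (apply_bcontfun \<phi> s) - g (apply_bcontfun \<psi> s))"
          by (intro continuous_intros gp)
        fix s
        have "norm (g (apply_bcontfun \<phi> s) - g (apply_bcontfun \<psi> s))
            \<le> L * dist (apply_bcontfun \<phi> s) (apply_bcontfun \<psi> s)"
          using assms(2) by (simp add: dist_norm)
        also have "\<dots> \<le> L * dist \<phi> \<psi>"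
          using assms(1) by (intro mult_left_mono dist_bounded)
        finally show "norm (g (apply_bcontfun \<phi> s) - g (apply_bcontfun \<psi> s)) \<le> L * dist \<phi> \<psi>" .
      qed (use cl in auto)
      also have "\<dots> \<le> (L * dist \<phi> \<psi>) * a"
        using cl[of t] assms(1) by (intro mult_left_mono) auto
      also have "\<dots> = (a * L) * dist \<phi> \<psi>" by simp
      also have "\<dots> \<le> 1 / 2 * dist \<phi> \<psi>"
        using a(2) by (intro mult_right_mono) auto
      finally show "dist (apply_bcontfun (Bcontfun (P \<phi>)) t) (apply_bcontfun (Bcontfun (P \<psi>)) t)
          \<le> 1 / 2 * dist \<phi> \<psi>"
        by (simp add: app dist_norm)
    qed
  qed auto
  then obtain \<phi> where \<phi>: "Bcontfun (P \<phi>) = \<phi>" by blast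
  show ?thesis
  proof (rule that[OF a(1)])
    show "continuous_on UNIV (apply_bcontfun \<phi>)" by simp
    show "\<forall>t\<in>{0..a}. apply_bcontfun \<phi> t = x0 + integral {0..t} (\<lambda>s. g (apply_bcontfun \<phi> s))"
    proof
      fix t assume "t \<in> {0..a}"
      then show "apply_bcontfun \<phi> t = x0 + integral {0..t} (\<lambda>s. g (apply_bcontfun \<phi> s))"
        using app[of \<phi> t] unfolding \<phi> by (simp add: P_def cl_def)
    qed
  qed
qed

text \<open>Near \<open>x0\<close> the field agrees with its composition with the nearest-point map of a closed ball.  This
  composition is globally Lipschitz, and its solution stays in the ball for a short time.\<close>

lemma local_solution_exists:
  fixes g :: "'a::euclidean_space \<Rightarrow> 'a"
  assumes "open S" "C_on (Suc 0) g S" "x0 \<in> S"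
  obtains a x where "a > 0" "x 0 = x0" "solution_in S g {0..a} x"
proof -
  obtain d where d: "d > 0" "cball x0 d \<subseteq> S"
    using assms(1,3) open_contains_cball by blast
  obtain L where L: "L \<ge> 0"
    "\<And>x y. x \<in> cball x0 d \<Longrightarrow> y \<in> cball x0 d \<Longrightarrow> norm (g x - g y) \<le> L * norm (x - y)"
    using C_on_1_imp_Lipschitz_cball[OF assms(2) d(2)] by blast
  define cp where "cp = closest_point (cball x0 d)"
  have cp: "cp y \<in> cball x0 d" for y
    unfolding cp_def using d by (intro closest_point_in_set) auto
  have cpl: "dist (cp x) (cp y) \<le> dist x y" for x y
    unfolding cp_def using d by (intro closest_point_lipschitz) auto
  have lip: "norm (g (cp x) - g (cp y)) \<le> L * norm (x - y)" for x y
  proof -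
    have "norm (g (cp x) - g (cp y)) \<le> L * norm (cp x - cp y)" using L(2) cp by blast
    also have "\<dots> \<le> L * norm (x - y)"
      using cpl[of x y] L(1) by (intro mult_left_mono) (auto simp: dist_norm)
    finally show ?thesis .
  qed
  obtain a :: real and \<phi> where a: "a > 0" and cont: "continuous_on UNIV \<phi>"
    and \<phi>: "\<forall>t\<in>{0..a}. \<phi> t = x0 + integral {0..t} (\<lambda>s. g (cp (\<phi> s)))"
    using Lipschitz_integral_equation_solvable[OF L(1) lip] by blast
  have \<phi>0: "\<phi> 0 = x0" using \<phi> a by force
  have "continuous_on UNIV (\<lambda>s. g (cp s))"
    by (rule lipschitz_on_continuous_on[of L], rule lipschitz_onI) (use lip L in \<open>auto simp: dist_norm\<close>)
  then have gc: "continuous_on {0..a} (\<lambda>s. g (cp (\<phi> s)))"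
    by (rule continuous_on_compose2) (use cont in \<open>auto intro: continuous_on_subset\<close>)
  have der: "(\<phi> has_vector_derivative g (cp (\<phi> t))) (at t within {0..a})" if "t \<in> {0..a}" for t
  proof (rule has_vector_derivative_transform[OF that])
    show "((\<lambda>t. x0 + integral {0..t} (\<lambda>s. g (cp (\<phi> s)))) has_vector_derivative g (cp (\<phi> t))) (at t within {0..a})"
      using integral_has_vector_derivative[OF gc that] by (auto intro!: derivative_eq_intros)
  qed (use \<phi> in auto)
  obtain e where e: "e > 0" "\<And>t. dist t 0 < e \<Longrightarrow> dist (\<phi> t) (\<phi> 0) < d"
    using cont d(1) unfolding continuous_on_iff by (metis UNIV_I)
  define a' where "a' = min a (e / 2)"
  have a': "a' > 0" "a' \<le> a" "a' < e" using a e by (auto simp: a'_def)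
  have inb: "\<phi> t \<in> cball x0 d" if "t \<in> {0..a'}" for t
    using e(2)[of t] that a' \<phi>0 by (auto simp: dist_commute)
  have "solution_in S g {0..a'} \<phi>"
    unfolding solution_in_def
  proof (intro conjI ballI)
    show "is_interval {0..a'}" by (rule is_interval_cc)
    fix t assume t: "t \<in> {0..a'}"
    show "\<phi> t \<in> S" using inb[OF t] d by auto
    have "cp (\<phi> t) = \<phi> t" unfolding cp_def using inb[OF t] by (rule closest_point_self)
    then show "(\<phi> has_vector_derivative g (\<phi> t)) (at t within {0..a'})"
      using der[of t] t a' has_vector_derivative_within_subset[of \<phi> _ t "{0..a}" "{0..a'}"] by auto
  qed
  with a'(1) \<phi>0 show ?thesis using that by blast
qed

text \<open>A solution through \<open>x0\<close> exists in the open set \<open>S\<close>; differentiate \<open>q\<close> along it at time 0.\<close>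

lemma first_integral_derivative_along_field:
  fixes g :: "'a::euclidean_space \<Rightarrow> 'a"
  assumes "open S" "S \<subseteq> V" "C_on (Suc 0) g S" "x0 \<in> S"
    and "first_integral V g q" "(q has_derivative q') (at x0)"
  shows "q' (g x0) = 0"
proof -
  obtain a x where a: "a > 0" "x 0 = x0" and sol: "solution_in S g {0..a} x"
    using local_solution_exists[OF assms(1,3,4)] by blast
  have "solution_in V g {0..a} x"
    using sol assms(2) by (auto simp: solution_in_def)
  then have "(\<lambda>t. q (x t)) constant_on {0..a}"
    using assms(5) unfolding first_integral_def by blast
  then obtain c where c: "\<And>t. t \<in> {0..a} \<Longrightarrow> q (x t) = c" unfolding constant_on_def by blast
  have "(x has_vector_derivative g x0) (at 0 within {0..a})"
    using sol a by (auto simp: solution_in_def)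
  then have "(x has_derivative (\<lambda>t. t *\<^sub>R g x0)) (at 0 within {0..a})"
    by (simp add: has_vector_derivative_def)
  from has_derivative_compose[OF this, of q q'] have "((\<lambda>t. q (x t)) has_derivative (\<lambda>t. q' (t *\<^sub>R g x0))) (at 0 within {0..a})"
    using assms(6) a by simp
  moreover have "q' (t *\<^sub>R g x0) = t *\<^sub>R q' (g x0)" for t
    using has_derivative_linear[OF assms(6)] by (rule linear_cmul)
  ultimately have "((\<lambda>t. q (x t)) has_vector_derivative q' (g x0)) (at 0 within {0..a})"
    by (simp add: has_vector_derivative_def)
  moreover have "((\<lambda>t. q (x t)) has_vector_derivative 0) (at 0 within {0..a})"
    by (rule has_vector_derivative_transform[of _ _ _ "\<lambda>_. c"]) (use a c in auto)
  moreover have "at 0 within {0..a} \<noteq> bot"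
    using a(1) by (simp add: at_within_Icc_at_right)
  ultimately show ?thesis
    using vector_derivative_unique_within by blast
qed

text \<open>In a chart the points of the open half space are dense, and invariance of domain shows that they come
  from interior points of \<open>V\<close>.  This lets identities that hold in the interior reach equilibria on the
  boundary.\<close>

lemma codim0_submanifold_subset_closure_interior:
  fixes V :: "'a::euclidean_space set"
  assumes "codim0_submanifold V"
  shows "V \<subseteq> closure (interior V)"
proof
  fix p assume "p \<in> V"
  then obtain A B and b :: 'a where A: "openin (top_of_set V) A" "p \<in> A" and b: "b \<noteq> 0"
    and B: "openin (top_of_set {x. 0 \<le> b \<bullet> x}) B" and "A homeomorphic B"
    using assms[unfolded codim0_submanifold_def, rule_format, OF \<open>p \<in> V\<close>] by (elim exE conjE) (rule that)
  then obtain f g where hom: "homeomorphism A B f g" unfolding homeomorphic_def by blast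
  show "p \<in> closure (interior V)"
    unfolding closure_iff_nhds_not_empty
  proof (intro allI impI)
    fix N Q assume "Q \<subseteq> N" "open Q" "p \<in> Q"
    have "openin (top_of_set A) (A \<inter> Q)" using \<open>open Q\<close> by (rule openin_open_Int)
    then have "openin (top_of_set B) (f ` (A \<inter> Q))"
      by (rule homeomorphism_imp_open_map[OF hom])
    with B have "openin (top_of_set {x. 0 \<le> b \<bullet> x}) (f ` (A \<inter> Q))"
      by (rule openin_trans[rotated])
    then obtain W where W: "open W" "f ` (A \<inter> Q) = {x. 0 \<le> b \<bullet> x} \<inter> W"
      by (auto simp: openin_open)
    define N' where "N' = W \<inter> {x. 0 < b \<bullet> x}"
    have N': "open N'" "N' \<subseteq> f ` (A \<inter> Q)"
      unfolding N'_def using W by (auto intro!: open_Int open_halfspace_gt)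
    have NB: "N' \<subseteq> B" using N'(2) hom by (auto simp: homeomorphism_def)
    have "N' \<noteq> {}"
    proof -
      \<comment> \<open>Moving from \<open>f p\<close> a little in the direction \<open>b\<close> leads into the open half space.\<close>
      have fp: "f p \<in> W" "0 \<le> b \<bullet> f p" using W(2) A(2) \<open>p \<in> Q\<close> by blast+
      have "((\<lambda>t. f p + t *\<^sub>R b) \<longlongrightarrow> f p + 0 *\<^sub>R b) (at_right 0)"
        by (intro tendsto_intros)
      then have "\<forall>\<^sub>F t in at_right 0. f p + t *\<^sub>R b \<in> W"
        using W(1) fp(1) by (auto simp: tendsto_def)
      moreover have "\<forall>\<^sub>F t::real in at_right 0. t > 0" by (simp add: eventually_at_right_less)
      ultimately have "\<forall>\<^sub>F t in at_right 0. f p + t *\<^sub>R b \<in> N'"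
      proof eventually_elim
        case (elim t)
        then have "0 < t * (b \<bullet> b)" using b by simp
        with elim fp(2) show ?case by (simp add: N'_def inner_add_right)
      qed
      then obtain t where "f p + t *\<^sub>R b \<in> N'"
        using eventually_happens' trivial_limit_at_right_real by blast
      then show ?thesis by blast
    qed
    have "continuous_on N' g"
      using homeomorphism_cont2[OF hom] NB by (rule continuous_on_subset)
    moreover have "inj_on g N'"
      using homeomorphism_apply2[OF hom] NB by (intro inj_on_inverseI[of _ f]) blast
    ultimately have "open (g ` N')" using N'(1) by (intro invariance_of_domain)
    moreover have gN: "g ` N' \<subseteq> A \<inter> Q"
      using N'(2) homeomorphism_apply1[OF hom] by fastforce
    moreover have "A \<subseteq> V" using A(1) openin_imp_subset by blast
    ultimately have "g ` N' \<subseteq> interior V" by (intro interior_maximal) auto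
    then show "interior V \<inter> N \<noteq> {}" using \<open>N' \<noteq> {}\<close> gN \<open>Q \<subseteq> N\<close> by blast
  qed
qed

text \<open>The function \<open>Dq g\<close> vanishes on the interior of \<open>V\<close>, so its derivative vanishes there and, by
  continuity, at \<open>x0\<close>.  In this derivative the term with the second derivative of \<open>q\<close> contains the
  factor \<open>g x0 = 0\<close>; what remains is \<open>Dq (Dg v)\<close>.\<close>

lemma first_integral_derivative_at_equilibrium:
  fixes g :: "'a::euclidean_space \<Rightarrow> 'a" and q :: "'a \<Rightarrow> real"
  assumes "V \<subseteq> closure (interior V)" "x0 \<in> V" "open U" "x0 \<in> U"
    and "smooth_on g U" "smooth_on q UNIV" "first_integral V g q" "g x0 = 0"
  shows "frechet_derivative q (at x0) (frechet_derivative g (at x0) v) = 0"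
proof -
  let ?Dq = "\<lambda>x. frechet_derivative q (at x)" and ?Dg = "\<lambda>x. frechet_derivative g (at x)"
  define L where "L x = (\<Sum>b\<in>Basis. (g x \<bullet> b) *\<^sub>R ?Dq x b)" for x
  have L: "L x = ?Dq x (g x)" for x
    unfolding L_def
    by (rule frechet_derivative_basis_expansion[OF smooth_onD[OF assms(6), of "Suc 0"] UNIV_I, symmetric])
  have gC: "C_on r g U" for r using assms(5) by (rule smooth_onD)
  have qC: "C_on r (\<lambda>x. ?Dq x b) U" for r b
    using smooth_onD[OF assms(6), of "Suc r"] C_on_subset[of r _ UNIV U] by auto
  have LC: "C_on r L U" for r
    unfolding L_def
    by (intro C_on_sum C_on_scaleR C_on_linear_compose[OF assms(3) bounded_linear_inner_left] assms(3) gC qC)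
  have zero: "frechet_derivative L (at x) v = 0" if x: "x \<in> interior V \<inter> U" for x
  proof -
    have op: "open (interior V \<inter> U)" using assms(3) by auto
    have "L y = 0" if "y \<in> interior V \<inter> U" for y
      unfolding L
    proof (rule first_integral_derivative_along_field[OF op _ _ that assms(7)])
      show "interior V \<inter> U \<subseteq> V" using interior_subset by blast
      show "C_on (Suc 0) g (interior V \<inter> U)" using C_on_subset[OF gC] by blast
      show "(q has_derivative ?Dq y) (at y)"
        using C_on_Suc_has_derivative[OF smooth_onD[OF assms(6)] UNIV_I] .
    qed
    then have "(L has_derivative (\<lambda>_. 0)) (at x)"
      by (intro has_derivative_transform_within_open[OF has_derivative_const op x]) auto
    then show ?thesis by (metis frechet_derivative_at)
  qed
  have DL: "frechet_derivative L (at x0) v = 0"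
  proof (rule ccontr)
    assume nz: "frechet_derivative L (at x0) v \<noteq> 0"
    define N where "N = U \<inter> (\<lambda>x. frechet_derivative L (at x) v) -` (- {0})"
    have "continuous_on U (\<lambda>x. frechet_derivative L (at x) v)"
      using LC[of "Suc 0"] by simp
    then have "open N" unfolding N_def using assms(3) by (intro continuous_open_preimage) auto
    moreover have "x0 \<in> N" "x0 \<in> closure (interior V)" using nz assms by (auto simp: N_def)
    ultimately have "interior V \<inter> N \<noteq> {}"
      by (meson closure_iff_nhds_not_empty order_refl)
    then show False using zero by (auto simp: N_def)
  qed
  have L': "(L has_derivative (\<lambda>v. \<Sum>b\<in>Basis. (?Dg x0 v \<bullet> b) *\<^sub>R ?Dq x0 b)) (at x0)"
  proof -
    have g': "(g has_derivative ?Dg x0) (at x0)"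
      using C_on_Suc_has_derivative[OF gC assms(4)] .
    have q': "((\<lambda>x. ?Dq x b) has_derivative frechet_derivative (\<lambda>x. ?Dq x b) (at x0)) (at x0)" for b
      using C_on_Suc_has_derivative[OF qC assms(4)] .
    have "(L has_derivative (\<lambda>v. \<Sum>b\<in>Basis. (g x0 \<bullet> b) *\<^sub>R frechet_derivative (\<lambda>x. ?Dq x b) (at x0) v
        + (?Dg x0 v \<bullet> b) *\<^sub>R ?Dq x0 b)) (at x0)"
      unfolding L_def[abs_def]
      by (intro has_derivative_sum has_derivative_scaleR has_derivative_inner_left g' q')
    then show ?thesis by (simp add: assms(8))
  qed
  have "(\<Sum>b\<in>Basis. (?Dg x0 v \<bullet> b) *\<^sub>R ?Dq x0 b) = ?Dq x0 (?Dg x0 v)"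
    by (rule frechet_derivative_basis_expansion[OF smooth_onD[OF assms(6), of "Suc 0"] UNIV_I, symmetric])
  from trans[OF this[symmetric] trans[OF fun_cong[OF frechet_derivative_at[OF L']] DL]]
  show ?thesis .
qed

section \<open>Local parametrization of the equilibrium locus\<close>

text \<open>If \<open>w \<mapsto> (f w, fst w, h (snd w))\<close> has injective derivative at \<open>u\<close>, composing it with a linear left
  inverse \<open>P\<close> of that derivative gives a local diffeomorphism.  On the zeros of \<open>f\<close> this diffeomorphism is
  a function of \<open>(fst w, h (snd w))\<close> alone, so its inverse recovers \<open>w\<close> from these data.\<close>

lemma zero_locus_parametrized:
  fixes f :: "'a::euclidean_space \<times> 'b::euclidean_space \<Rightarrow> 'd::euclidean_space"
    and h :: "'b \<Rightarrow> 'c::euclidean_space"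
  assumes "open U" "u \<in> U" "smooth_on f U" "smooth_on h UNIV"
    and inj: "\<And>v. frechet_derivative f (at u) (0, v) = 0 \<Longrightarrow>
      frechet_derivative h (at (snd u)) v = 0 \<Longrightarrow> v = 0"
  obtains N W Q where "open N" "u \<in> N" "open W" "smooth_on Q W"
    "\<forall>w\<in>N. f w = 0 \<longrightarrow> (fst w, h (snd w)) \<in> W \<and> Q (fst w, h (snd w)) = w"
proof -
  define G where "G w = (f w, fst w, h (snd w))" for w
  have G: "smooth_on G U"
    unfolding G_def
    by (intro smooth_on_Pair assms(1,3) smooth_on_bounded_linear bounded_linear_fst
        smooth_on_compose[OF assms(1) open_UNIV smooth_on_bounded_linear[OF bounded_linear_snd] assms(4)]) auto
  let ?Df = "frechet_derivative f (at u)" and ?Dh = "frechet_derivative h (at (snd u))"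
  define G' where "G' v = (?Df v, fst v, ?Dh (snd v))" for v
  have hs: "((\<lambda>w. h (snd w)) has_derivative (\<lambda>v. ?Dh (snd v))) (at u)"
    by (rule has_derivative_compose[OF has_derivative_snd[OF has_derivative_ident] smooth_on_has_derivative[OF assms(4)]]) simp
  have DG: "(G has_derivative G') (at u)"
    unfolding G_def[abs_def] G'_def[abs_def]
    by (intro has_derivative_Pair smooth_on_has_derivative[OF assms(3,2)] hs has_derivative_fst has_derivative_ident)
  have linG': "linear G'" by (rule has_derivative_linear[OF DG])
  have "inj G'"
    unfolding linear_injective_0[OF linG']
  proof (intro allI impI)
    fix v assume "G' v = 0"
    then have "?Df v = 0" "fst v = 0" "?Dh (snd v) = 0" by (auto simp: G'_def prod_eq_iff)
    moreover from this have "v = (0, snd v)" by (simp add: prod_eq_iff)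
    ultimately show "v = 0" using inj[of "snd v"] by (simp add: zero_prod_def)
  qed
  then obtain P where P: "linear P" "P \<circ> G' = id"
    using linear_injective_left_inverse[OF linG'] by blast
  have blP: "bounded_linear P" using P(1) by (simp add: linear_conv_bounded_linear)
  define F where "F w = P (G w)" for w
  have F: "smooth_on F U"
    unfolding F_def by (rule smooth_on_linear_compose[OF assms(1) blP G])
  have "(F has_derivative (\<lambda>v. P (G' v))) (at u)"
    unfolding F_def[abs_def] by (rule bounded_linear.has_derivative[OF blP DG])
  then have "(F has_derivative id) (at u)" using P(2) by (simp add: o_def)
  then have "frechet_derivative F (at u) = id" by (rule frechet_derivative_at[symmetric])
  then have injF: "inj (frechet_derivative F (at u))" by (simp only: inj_on_id)
  show ?thesis
  proof (rule smooth_inverse_function_theorem[OF assms(1) F assms(2) injF])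
    fix N W' Q'
    assume N: "open N" "u \<in> N" and W': "open W'" and hom: "homeomorphism N W' F Q'"
      and Q': "smooth_on Q' W'"
    have bl0: "bounded_linear (\<lambda>y. P (0, y))"
      by (rule bounded_linear_compose[OF blP]) (intro bounded_linear_Pair bounded_linear_zero bounded_linear_ident)
    define W where "W = (\<lambda>y. P (0, y)) -` W'"
    have W: "open W"
      unfolding W_def by (rule open_vimage[OF W' linear_continuous_on[OF bl0]])
    have "smooth_on (\<lambda>y. Q' (P (0, y))) W"
      by (rule smooth_on_compose[OF W W' smooth_on_bounded_linear[OF bl0] Q']) (auto simp: W_def)
    moreover have "\<forall>w\<in>N. f w = 0 \<longrightarrow> (fst w, h (snd w)) \<in> W \<and> Q' (P (0, (fst w, h (snd w)))) = w"
    proof (intro ballI impI)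
      fix w assume w: "w \<in> N" "f w = 0"
      then have "P (0, (fst w, h (snd w))) = F w" by (simp add: F_def G_def)
      moreover have "F w \<in> W'" "Q' (F w) = w" using hom w(1) by (auto simp: homeomorphism_def)
      ultimately show "(fst w, h (snd w)) \<in> W \<and> Q' (P (0, (fst w, h (snd w)))) = w"
        by (simp add: W_def)
    qed
    ultimately show ?thesis by (rule that[OF N W])
  qed
qed

lemma gradient_inner:
  assumes "(q has_derivative q') (at x)"
  shows "gradient q x \<bullet> v = q' v"
proof -
  have q': "frechet_derivative q (at x) = q'" using frechet_derivative_at[OF assms] by simp
  have "q' v = (\<Sum>b\<in>Basis. (v \<bullet> b) *\<^sub>R q' b)"
    by (rule linear_basis_expansion[OF has_derivative_linear[OF assms]])
  also have "\<dots> = (\<Sum>i\<in>UNIV. v $ i * q' (axis i 1))"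
    by (simp add: Basis_vec_def sum.reindex inj_on_def axis_eq_axis inner_axis UNION_singleton_eq_range)
  also have "\<dots> = gradient q x \<bullet> v"
    by (simp add: gradient_def inner_vec_def q' mult.commute)
  finally show ?thesis by simp
qed

text \<open>The kernel of the derivative is the orthogonal complement of the span of the gradients.\<close>

lemma dim_kernel_independent_functions:
  fixes h :: "real^'n \<Rightarrow> real^'k"
  assumes "independent_functions h" "(h has_derivative h') (at x)"
  shows "dim {v. h' v = 0} + CARD('k) = CARD('n)"
proof -
  let ?g = "\<lambda>l. gradient (\<lambda>y. h y $ l) x"
  have ind: "inj ?g" "independent (range ?g)"
    using assms(1) by (auto simp: independent_functions_def)
  have g: "?g l \<bullet> v = h' v $ l" for l v
    by (rule gradient_inner) (rule bounded_linear.has_derivative[OF bounded_linear_vec_nth assms(2)])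
  have "{v. h' v = 0} = {y \<in> UNIV. \<forall>x\<in>span (range ?g). orthogonal x y}"
  proof (intro equalityI subsetI)
    fix v assume "v \<in> {v. h' v = 0}"
    then have "orthogonal v y" if "y \<in> range ?g" for y
      using that g by (auto simp: orthogonal_def inner_commute)
    then have "orthogonal v y" if "y \<in> span (range ?g)" for y
      using orthogonal_to_span[OF that] by blast
    then show "v \<in> {y \<in> UNIV. \<forall>x\<in>span (range ?g). orthogonal x y}"
      by (simp add: orthogonal_commute)
  next
    fix v assume "v \<in> {y \<in> UNIV. \<forall>x\<in>span (range ?g). orthogonal x y}"
    then have "?g l \<bullet> v = 0" for l by (auto simp: orthogonal_def intro: span_base)
    then have "h' v $ l = 0" for l unfolding g .
    then show "v \<in> {v. h' v = 0}" by (simp add: vec_eq_iff)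
  qed
  moreover have "dim (span (range ?g)) = CARD('k)"
    using ind by (simp add: dim_eq_card_independent card_image)
  moreover have "dim {y \<in> UNIV. \<forall>x\<in>span (range ?g). orthogonal x y} + dim (span (range ?g)) = dim (UNIV :: (real^'n) set)"
    by (rule dim_subspace_orthogonal_to_vectors) (auto intro: subspace_UNIV)
  ultimately show ?thesis by simp
qed

text \<open>The image of \<open>A\<close> lies in the kernel of \<open>h'\<close> and has the same dimension, so \<open>v\<close> lies in the kernel and in
  the image of \<open>A\<close>.\<close>

lemma kernel_Int_annihilated_by_first_integrals:
  fixes h :: "real^'n \<Rightarrow> real^'k" and A :: "real^'n^'n"
  assumes "independent_functions h" "(h has_derivative h') (at x)"
    and "rank A = CARD('n) - CARD('k)" "direct_sum (matrix_ker A) (matrix_im A) UNIV"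
    and "\<And>v. h' (A *v v) = 0"
    and "A *v v = 0" "h' v = 0"
  shows "v = 0"
proof -
  have lin: "linear h'" by (rule has_derivative_linear[OF assms(2)])
  have "range ((*v) A) = {v. h' v = 0}"
  proof (rule subspace_dim_equal)
    show "subspace (range ((*v) A))"
      by (rule linear_subspace_image[OF matrix_vector_mul_linear subspace_UNIV])
    show "subspace {v. h' v = 0}" by (rule linear_subspace_kernel[OF lin])
    show "range ((*v) A) \<subseteq> {v. h' v = 0}" using assms(5) by auto
    show "dim {v. h' v = 0} \<le> dim (range ((*v) A))"
      using dim_kernel_independent_functions[OF assms(1,2)] assms(3) by (simp add: rank_dim_range)
  qed
  then have "v \<in> matrix_ker A \<inter> matrix_im A"
    using assms(6,7) by (auto simp: matrix_ker_def matrix_im_def)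
  then show ?thesis using assms(4) by (auto simp: direct_sum_def)
qed

text \<open>The first integrals make the partial derivative of \<open>f\<close> in the state and the derivative of \<open>h\<close> jointly
  injective, which is the hypothesis of \<open>zero_locus_parametrized\<close>.\<close>

lemma equilibrium_locus_parametrized:
  fixes f :: "(real^'m) \<times> (real^'n) \<Rightarrow> real^'n" and h :: "real^'n \<Rightarrow> real^'k"
  assumes "V \<subseteq> closure (interior V)" "u \<in> equilibrium_locus \<Lambda> V f"
    and "real_analytic_on f (\<Lambda> \<times> V)"
    and "\<And>\<mu> l. \<mu> \<in> \<Lambda> \<Longrightarrow> first_integral V (\<lambda>x. f (\<mu>, x)) (\<lambda>x. h x $ l)"
    and "smooth_on h UNIV" "independent_functions h"
    and "rank (jacobian_state f u) = CARD('n) - CARD('k)"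
    and "direct_sum (matrix_ker (jacobian_state f u)) (matrix_im (jacobian_state f u)) UNIV"
  obtains N W Q where "open N" "u \<in> N" "open W" "smooth_on Q W"
    "\<forall>w\<in>N. f w = 0 \<longrightarrow> (fst w, h (snd w)) \<in> W \<and> Q (fst w, h (snd w)) = w"
proof -
  obtain \<mu> x where u: "u = (\<mu>, x)" by (cases u)
  have mem: "\<mu> \<in> \<Lambda>" "x \<in> V" "f (\<mu>, x) = 0" "u \<in> \<Lambda> \<times> V"
    using assms(2) by (auto simp: equilibrium_locus_def u)
  obtain U where U: "open U" "u \<in> U" "smooth_on f U"
    using real_analytic_on_imp_locally_smooth[OF assms(3) mem(4)] by blast
  define g where "g y = f (\<mu>, y)" for y
  define U' where "U' = Pair \<mu> -` U"
  have U': "open U'" "x \<in> U'"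
    using U u by (auto simp: U'_def intro!: open_vimage continuous_intros)
  have "bounded_linear (\<lambda>y::real^'n. y)" by (rule bounded_linear_ident)
  then have g: "smooth_on g U'"
    unfolding g_def
    by (intro smooth_on_compose[OF U'(1) U(1) _ U(3)] smooth_on_Pair U'(1) smooth_on_const smooth_on_bounded_linear)
       (auto simp: U'_def)
  have Dg: "(g has_derivative frechet_derivative g (at x)) (at x)"
    by (rule smooth_on_has_derivative[OF g U'(2)])
  have "((\<lambda>y. (\<mu>, y)) has_derivative (\<lambda>v. (0, v))) (at x)"
    by (intro has_derivative_Pair has_derivative_const has_derivative_ident)
  from has_derivative_compose[OF this, of f "frechet_derivative f (at u)"]
  have "(g has_derivative (\<lambda>v. frechet_derivative f (at u) (0, v))) (at x)"
    using smooth_on_has_derivative[OF U(3,2)] by (simp add: u g_def[abs_def])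
  then have Dgf: "frechet_derivative g (at x) = (\<lambda>v. frechet_derivative f (at u) (0, v))"
    by (rule frechet_derivative_at[symmetric])
  have J: "jacobian_state f u *v v = frechet_derivative g (at x) v" for v
    unfolding jacobian_state_def u fst_conv snd_conv g_def[symmetric]
    by (rule fun_cong[OF matrix_vector_mul(2)]) (rule has_derivative_linear[OF Dg])
  let ?Dh = "frechet_derivative h (at x)"
  have Dh: "(h has_derivative ?Dh) (at x)" by (rule smooth_on_has_derivative[OF assms(5)]) simp
  have "?Dh (frechet_derivative g (at x) v) = 0" for v
  proof -
    have "?Dh (frechet_derivative g (at x) v) $ l = 0" for l
    proof -
      have bl: "bounded_linear (\<lambda>y::real^'k. y $ l)" by (rule bounded_linear_vec_nth)
      have sm: "smooth_on (\<lambda>y. h y $ l) UNIV"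
        by (rule smooth_on_linear_compose[OF open_UNIV bl assms(5)])
      have "frechet_derivative (\<lambda>y. h y $ l) (at x) = (\<lambda>v. ?Dh v $ l)"
        by (rule frechet_derivative_at[symmetric]) (rule bounded_linear.has_derivative[OF bl Dh])
      moreover have "frechet_derivative (\<lambda>y. h y $ l) (at x) (frechet_derivative g (at x) v) = 0"
        by (rule first_integral_derivative_at_equilibrium[OF assms(1) mem(2) U' g sm])
           (use assms(4)[OF mem(1)] mem(3) in \<open>simp_all add: g_def[abs_def]\<close>)
      ultimately show ?thesis by simp
    qed
    then show ?thesis by (simp add: vec_eq_iff)
  qed
  then have ann: "?Dh (jacobian_state f u *v v) = 0" for v unfolding J .
  have inj: "v = 0" if "frechet_derivative f (at u) (0, v) = 0" "frechet_derivative h (at (snd u)) v = 0" for v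
  proof (rule kernel_Int_annihilated_by_first_integrals[OF assms(6) Dh assms(7,8) ann])
    show "jacobian_state f u *v v = 0" using that(1) by (simp add: J Dgf)
    show "?Dh v = 0" using that(2) by (simp add: u)
  qed
  from zero_locus_parametrized[OF U assms(5) inj] that show ?thesis by blast
qed

section \<open>Flat families over a simply connected base\<close>

text \<open>The topological part of the argument uses only these properties of \<open>E\<close> and of the conserved quantity
  \<open>q\<close>.  Only segments are required to lift; lifts of arbitrary paths follow from the covering property.\<close>

locale proper_separated_family =
  fixes E :: "('a::euclidean_space \<times> 'b::euclidean_space) set"
    and \<Lambda> :: "'a set"
    and q :: "'a \<times> 'b \<Rightarrow> 'c::euclidean_space"
  assumes open_base: "open \<Lambda>"
    and simply_connected_base: "simply_connected \<Lambda>"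
    and fst_in_base: "u \<in> E \<Longrightarrow> fst u \<in> \<Lambda>"
    and continuous_q: "continuous_on E q"
    and proper: "compact C \<Longrightarrow> C \<subseteq> \<Lambda> \<Longrightarrow> compact (E \<inter> fst -` C)"
    and locally_injective: "u \<in> E \<Longrightarrow> \<exists>N. open N \<and> u \<in> N \<and> inj_on (\<lambda>w. (fst w, q w)) (E \<inter> N)"
    and segment_lift: "u \<in> E \<Longrightarrow> closed_segment (fst u) b \<subseteq> \<Lambda> \<Longrightarrow>
      \<exists>\<gamma>. path \<gamma> \<and> path_image \<gamma> \<subseteq> E \<and> pathstart \<gamma> = u \<and>
        (\<forall>t\<in>{0..1}. fst (\<gamma> t) = linepath (fst u) b t \<and> q (\<gamma> t) = q u)"
begin

text \<open>Uniform separation over a compact set \<open>C\<close>: two points with nearly the same base point and nearly the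
  same value of \<open>q\<close> are either very close or at least \<open>\<delta>\<close> apart.\<close>

lemma distance_gap:
  assumes "compact C" "C \<subseteq> \<Lambda>"
  obtains \<delta> :: real where "\<delta> > 0"
    "\<forall>\<epsilon>>0. \<exists>\<eta>>0. \<forall>w\<in>E \<inter> fst -` C. \<forall>w'\<in>E \<inter> fst -` C.
       dist (fst w) (fst w') < \<eta> \<and> dist (q w) (q w') < \<eta> \<and> dist w w' < \<delta> \<longrightarrow> dist w w' < \<epsilon>"
proof -
  let ?K = "E \<inter> fst -` C"
  have K: "compact ?K" using proper assms .
  define \<G> where "\<G> = {N. open N \<and> inj_on (\<lambda>w. (fst w, q w)) (E \<inter> N)}"
  have "?K \<subseteq> \<Union>\<G>" using locally_injective by (fastforce simp: \<G>_def)
  then obtain e where e: "e > 0" "\<And>x. x \<in> ?K \<Longrightarrow> \<exists>N\<in>\<G>. ball x e \<subseteq> N"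
    using Heine_Borel_lemma[OF K, of \<G>] unfolding \<G>_def by blast
  have sep: "w = w'" if *: "w \<in> ?K" "w' \<in> ?K" "fst w = fst w'" "q w = q w'" "dist w w' < e" for w w'
  proof -
    obtain N where N: "inj_on (\<lambda>w. (fst w, q w)) (E \<inter> N)" "ball w e \<subseteq> N"
      using e(2)[OF *(1)] by (auto simp: \<G>_def)
    have "w \<in> E \<inter> N" "w' \<in> E \<inter> N" using N(2) * e(1) by auto
    then show ?thesis using inj_onD[OF N(1)] *(3,4) by simp
  qed
  define \<delta> where "\<delta> = e / 2"
  have d: "\<delta> > 0" "\<delta> < e" using e(1) by (auto simp: \<delta>_def)
  show ?thesis
  proof (rule that[OF d(1)], intro allI impI)
    fix \<epsilon> :: real assume \<epsilon>: "\<epsilon> > 0"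
    \<comment> \<open>On the compact set of pairs at distance between \<open>\<epsilon>\<close> and \<open>\<delta>\<close> the base points and the values of
      \<open>q\<close> cannot both agree, so their distance has a positive minimum.\<close>
    define P where "P = (?K \<times> ?K) \<inter> {p. \<epsilon> \<le> dist (fst p) (snd p)} \<inter> {p. dist (fst p) (snd p) \<le> \<delta>}"
    define F where "F p = dist (fst (fst p)) (fst (snd p)) + dist (q (fst p)) (q (snd p))" for p
    have P: "compact P"
      unfolding P_def by (intro compact_Int_closed compact_Times K closed_Collect_le continuous_intros)
    have PK: "fst ` P \<subseteq> E" "snd ` P \<subseteq> E" by (auto simp: P_def)
    have cF: "continuous_on P F"
      unfolding F_def
      by (intro continuous_intros continuous_on_compose2[OF continuous_q _ PK(1)]
          continuous_on_compose2[OF continuous_q _ PK(2)])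
    have pos: "F p > 0" if "p \<in> P" for p
    proof -
      have "fst p \<noteq> snd p" using that \<epsilon> by (auto simp: P_def)
      then have "fst (fst p) \<noteq> fst (snd p) \<or> q (fst p) \<noteq> q (snd p)"
        using sep[of "fst p" "snd p"] that d by (auto simp: P_def)
      then show ?thesis unfolding F_def by (auto intro: add_pos_nonneg add_nonneg_pos)
    qed
    obtain m where m: "m > 0" "\<And>p. p \<in> P \<Longrightarrow> m \<le> F p"
    proof (cases "P = {}")
      case False
      then obtain p where "p \<in> P" "\<And>p'. p' \<in> P \<Longrightarrow> F p \<le> F p'"
        using continuous_attains_inf[OF P _ cF] by blast
      then show ?thesis using that[of "F p"] pos by blast
    qed (use that[of 1] in auto)
    show "\<exists>\<eta>>0. \<forall>w\<in>?K. \<forall>w'\<in>?K.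
       dist (fst w) (fst w') < \<eta> \<and> dist (q w) (q w') < \<eta> \<and> dist w w' < \<delta> \<longrightarrow> dist w w' < \<epsilon>"
    proof (intro exI[of _ "m / 2"] conjI ballI impI)
      fix w w' assume w: "w \<in> ?K" "w' \<in> ?K"
        "dist (fst w) (fst w') < m / 2 \<and> dist (q w) (q w') < m / 2 \<and> dist w w' < \<delta>"
      show "dist w w' < \<epsilon>"
      proof (rule ccontr)
        assume "\<not> dist w w' < \<epsilon>"
        then have "(w, w') \<in> P" using w by (auto simp: P_def)
        from m(2)[OF this] w(3) show False by (simp add: F_def)
      qed
    qed (use m(1) in simp)
  qed
qed

text \<open>Over the ball, \<open>\<tau> \<kappa> u\<close> is the point above \<open>\<kappa>\<close> in the sheet of \<open>u\<close>; in each
  fibre \<open>\<delta>\<close> separates the sheets with the same value of \<open>q\<close>.\<close>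

definition transport_chart :: "'a \<Rightarrow> real \<Rightarrow> real \<Rightarrow> ('a \<Rightarrow> 'a \<times> 'b \<Rightarrow> 'a \<times> 'b) \<Rightarrow> bool" where
  "transport_chart \<mu> r \<delta> \<tau> \<longleftrightarrow> r > 0 \<and> \<delta> > 0 \<and> ball \<mu> r \<subseteq> \<Lambda> \<and>
    (\<forall>w\<in>E \<inter> fst -` ball \<mu> r. \<forall>w'\<in>E \<inter> fst -` ball \<mu> r.
       fst w = fst w' \<and> q w = q w' \<and> dist w w' < \<delta> \<longrightarrow> w = w') \<and>
    (\<forall>\<kappa>\<in>ball \<mu> r. \<forall>u\<in>E \<inter> fst -` ball \<mu> r. \<tau> \<kappa> u \<in> E \<and> fst (\<tau> \<kappa> u) = \<kappa> \<and> q (\<tau> \<kappa> u) = q u) \<and>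
    (\<forall>u\<in>E \<inter> fst -` ball \<mu> r. \<tau> (fst u) u = u) \<and>
    (\<forall>\<kappa>\<in>ball \<mu> r. \<forall>\<nu>\<in>ball \<mu> r. \<forall>u\<in>E \<inter> fst -` ball \<mu> r. \<tau> \<nu> (\<tau> \<kappa> u) = \<tau> \<nu> u) \<and>
    continuous_on (ball \<mu> r \<times> (E \<inter> fst -` ball \<mu> r)) (\<lambda>p. \<tau> (fst p) (snd p))"

text \<open>Lift the segment from \<open>fst u\<close> to \<open>\<kappa>\<close>.  If it is short, the distance of the lift to \<open>u\<close> cannot enter the
  gap, so the lift ends near \<open>u\<close>.  There is only one such endpoint by the gap again, which gives the
  cocycle identity and continuity.\<close>

lemma ex_transport_chart:
  assumes "\<mu> \<in> \<Lambda>"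
  shows "\<exists>r \<delta> \<tau>. transport_chart \<mu> r \<delta> \<tau>"
proof -
  obtain r0 where r0: "r0 > 0" "cball \<mu> r0 \<subseteq> \<Lambda>"
    using open_base assms open_contains_cball by blast
  let ?K = "E \<inter> fst -` cball \<mu> r0"
  obtain \<delta> where \<delta>: "\<delta> > 0"
    and gap_all: "\<forall>\<epsilon>>0. \<exists>\<eta>>0. \<forall>w\<in>?K. \<forall>w'\<in>?K.
       dist (fst w) (fst w') < \<eta> \<and> dist (q w) (q w') < \<eta> \<and> dist w w' < \<delta> \<longrightarrow> dist w w' < \<epsilon>"
    using distance_gap[OF compact_cball r0(2)] by blast
  have sep: "w = w'" if "w \<in> ?K" "w' \<in> ?K" "fst w = fst w'" "q w = q w'" "dist w w' < \<delta>" for w w'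
  proof (rule ccontr)
    assume "w \<noteq> w'"
    then have "dist w w' > 0" by simp
    then obtain \<eta> where \<eta>: "\<eta> > 0" "\<forall>v\<in>?K. \<forall>v'\<in>?K.
       dist (fst v) (fst v') < \<eta> \<and> dist (q v) (q v') < \<eta> \<and> dist v v' < \<delta> \<longrightarrow> dist v v' < dist w w'"
      using gap_all by blast
    have "dist w w' < dist w w'"
      using \<eta>(2)[rule_format, OF that(1,2)] that(3-5) \<eta>(1) by simp
    then show False by simp
  qed
  \<comment> \<open>Three such distances must still add up to less than \<open>\<delta>\<close>.\<close>
  define \<epsilon> where "\<epsilon> = \<delta> / 4"
  have \<epsilon>: "\<epsilon> > 0" using \<delta> by (simp add: \<epsilon>_def)
  obtain \<eta> where \<eta>: "\<eta> > 0" and "\<forall>w\<in>?K. \<forall>w'\<in>?K.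
       dist (fst w) (fst w') < \<eta> \<and> dist (q w) (q w') < \<eta> \<and> dist w w' < \<delta> \<longrightarrow> dist w w' < \<epsilon>"
    using gap_all \<epsilon> by blast
  note gap\<epsilon> = this(2)[rule_format, OF _ _ conjI, OF _ _ _ conjI]
  define r where "r = min r0 (\<eta> / 2)"
  have r: "r > 0" "r \<le> r0" "2 * r \<le> \<eta>" using r0 \<eta> by (auto simp: r_def)
  let ?B = "ball \<mu> r" and ?L = "E \<inter> fst -` ball \<mu> r"
  have LK: "?L \<subseteq> ?K" using r(2) by auto
  have ex: "\<exists>w\<in>E. fst w = \<kappa> \<and> q w = q u \<and> dist w u < \<epsilon>" if \<kappa>: "\<kappa> \<in> ?B" and u: "u \<in> ?L" for \<kappa> u
  proof -
    have seg: "closed_segment (fst u) \<kappa> \<subseteq> ?B"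
      using \<kappa> u by (intro closed_segment_subset) auto
    moreover have "?B \<subseteq> \<Lambda>" using r(2) r0(2) by auto
    ultimately obtain \<gamma> where \<gamma>: "path \<gamma>" "path_image \<gamma> \<subseteq> E" "pathstart \<gamma> = u"
      "\<And>t. t \<in> {0..1} \<Longrightarrow> fst (\<gamma> t) = linepath (fst u) \<kappa> t \<and> q (\<gamma> t) = q u"
      using segment_lift[of u \<kappa>] u by blast
    have \<gamma>L: "\<gamma> t \<in> ?L" if "t \<in> {0..1}" for t
    proof -
      have "linepath (fst u) \<kappa> t \<in> closed_segment (fst u) \<kappa>"
        using that by (rule linepath_in_path)
      then show ?thesis using \<gamma>(2,4) that seg by (auto simp: path_image_def)
    qed
    have "dist (\<gamma> 1) u < \<epsilon>"
    proof (rule ccontr)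
      assume "\<not> dist (\<gamma> 1) u < \<epsilon>"
      moreover have "dist (\<gamma> 0) u \<le> \<epsilon>" using \<gamma>(3) \<epsilon> by (simp add: pathstart_def)
      moreover have "continuous_on {0..1} (\<lambda>t. dist (\<gamma> t) u)"
        using \<gamma>(1) by (auto simp: path_def intro!: continuous_intros)
      ultimately obtain t where t: "0 \<le> t" "t \<le> 1" "dist (\<gamma> t) u = \<epsilon>"
        using IVT'[of "\<lambda>t. dist (\<gamma> t) u" 0 \<epsilon> 1] by auto
      have "dist (fst (\<gamma> t)) (fst u) < 2 * r"
        using \<gamma>L[of t] u t dist_triangle2[of "fst (\<gamma> t)" "fst u" \<mu>] by (auto simp: dist_commute)
      then have "dist (\<gamma> t) u < \<epsilon>"
        using gap\<epsilon>[of "\<gamma> t" u] \<gamma>L[of t] u t \<gamma>(4)[of t] r \<epsilon> \<eta> LK by (auto simp: \<epsilon>_def)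
      with t show False by simp
    qed
    then show ?thesis
      using \<gamma>L[of 1] \<gamma>(4)[of 1] by (auto simp: linepath_def intro!: bexI[of _ "\<gamma> 1"])
  qed
  define \<tau> where "\<tau> \<kappa> u = (SOME w. w \<in> E \<and> fst w = \<kappa> \<and> q w = q u \<and> dist w u < \<epsilon>)" for \<kappa> u
  have \<tau>: "\<tau> \<kappa> u \<in> E \<and> fst (\<tau> \<kappa> u) = \<kappa> \<and> q (\<tau> \<kappa> u) = q u \<and> dist (\<tau> \<kappa> u) u < \<epsilon>"
    if "\<kappa> \<in> ?B" "u \<in> ?L" for \<kappa> u
    unfolding \<tau>_def by (rule someI_ex) (use ex[OF that] in blast)
  have \<tau>L: "\<tau> \<kappa> u \<in> ?L" if "\<kappa> \<in> ?B" "u \<in> ?L" for \<kappa> u using \<tau>[OF that] that by auto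
  have uniq: "w = \<tau> \<kappa> u" if "\<kappa> \<in> ?B" "u \<in> ?L" "w \<in> E" "fst w = \<kappa>" "q w = q u" "dist w u < 3 * \<epsilon>" for \<kappa> u w
  proof (rule sep)
    show "dist w (\<tau> \<kappa> u) < \<delta>"
      using dist_triangle2[of w "\<tau> \<kappa> u" u] \<tau>[OF that(1,2)] that(6) by (simp add: \<epsilon>_def)
  qed (use \<tau>[OF that(1,2)] that LK in auto)
  show ?thesis
    unfolding transport_chart_def
  proof (rule exI[of _ r], rule exI[of _ \<delta>], rule exI[of _ \<tau>], intro conjI)
    show "r > 0" "\<delta> > 0" by fact+
    show "?B \<subseteq> \<Lambda>" using r(2) r0(2) by auto
    show "\<forall>w\<in>?L. \<forall>w'\<in>?L. fst w = fst w' \<and> q w = q w' \<and> dist w w' < \<delta> \<longrightarrow> w = w'"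
      using sep LK by blast
    show "\<forall>\<kappa>\<in>?B. \<forall>u\<in>?L. \<tau> \<kappa> u \<in> E \<and> fst (\<tau> \<kappa> u) = \<kappa> \<and> q (\<tau> \<kappa> u) = q u"
      using \<tau> by blast
    show "\<forall>u\<in>?L. \<tau> (fst u) u = u"
    proof
      fix u assume "u \<in> ?L"
      then show "\<tau> (fst u) u = u" using uniq[of "fst u" u u] \<epsilon> by auto
    qed
    show "\<forall>\<kappa>\<in>?B. \<forall>\<nu>\<in>?B. \<forall>u\<in>?L. \<tau> \<nu> (\<tau> \<kappa> u) = \<tau> \<nu> u"
    proof (intro ballI)
      fix \<kappa> \<nu> u assume *: "\<kappa> \<in> ?B" "\<nu> \<in> ?B" "u \<in> ?L"
      have "dist (\<tau> \<nu> (\<tau> \<kappa> u)) u < 3 * \<epsilon>"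
        using dist_triangle[of "\<tau> \<nu> (\<tau> \<kappa> u)" u "\<tau> \<kappa> u"] \<tau>[OF *(1,3)] \<tau>[OF *(2) \<tau>L[OF *(1,3)]] \<epsilon>
        by linarith
      then show "\<tau> \<nu> (\<tau> \<kappa> u) = \<tau> \<nu> u"
        using uniq[OF *(2,3), of "\<tau> \<nu> (\<tau> \<kappa> u)"] \<tau>[OF *(1,3)] \<tau>[OF *(2) \<tau>L[OF *(1,3)]] by simp
    qed
    show "continuous_on (?B \<times> ?L) (\<lambda>p. \<tau> (fst p) (snd p))"
      unfolding continuous_on_iff
    proof (intro ballI allI impI)
      fix p e assume p: "p \<in> ?B \<times> ?L" and e: "(0::real) < e"
      obtain \<kappa> u where pe: "p = (\<kappa>, u)" by (cases p)
      have \<kappa>u: "\<kappa> \<in> ?B" "u \<in> ?L" using p pe by auto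
      obtain \<eta>' where \<eta>'0: "\<eta>' > 0" and "\<forall>w\<in>?K. \<forall>w'\<in>?K.
          dist (fst w) (fst w') < \<eta>' \<and> dist (q w) (q w') < \<eta>' \<and> dist w w' < \<delta> \<longrightarrow> dist w w' < e"
        using gap_all e by blast
      note \<eta>' = \<eta>'0 this(2)[rule_format, OF _ _ conjI, OF _ _ _ conjI]
      obtain d where d: "d > 0" "\<forall>u'\<in>E. dist u' u < d \<longrightarrow> dist (q u') (q u) < \<eta>'"
        using continuous_q \<kappa>u(2) \<eta>'(1) unfolding continuous_on_iff by blast
      show "\<exists>d>0. \<forall>p'\<in>?B \<times> ?L. dist p' p < d \<longrightarrow> dist (\<tau> (fst p') (snd p')) (\<tau> (fst p) (snd p)) < e"
      proof (intro exI[of _ "min (min d \<epsilon>) \<eta>'"] conjI ballI impI)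
        fix p' assume p': "p' \<in> ?B \<times> ?L" and dp: "dist p' p < min (min d \<epsilon>) \<eta>'"
        obtain \<kappa>' u' where pe': "p' = (\<kappa>', u')" by (cases p')
        have \<kappa>u': "\<kappa>' \<in> ?B" "u' \<in> ?L" using p' pe' by auto
        have dd: "dist \<kappa>' \<kappa> < \<eta>'" "dist u' u < d" "dist u' u < \<epsilon>"
          using dp dist_fst_le[of p' p] dist_snd_le[of p' p] unfolding pe pe' by auto
        have "dist (\<tau> \<kappa>' u') (\<tau> \<kappa> u) \<le> dist (\<tau> \<kappa>' u') u' + (dist u' u + dist (\<tau> \<kappa> u) u)"
          using dist_triangle[of "\<tau> \<kappa>' u'" "\<tau> \<kappa> u" u'] dist_triangle2[of u' "\<tau> \<kappa> u" u] by linarith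
        also have "\<dots> < \<delta>" using \<tau>[OF \<kappa>u] \<tau>[OF \<kappa>u'] dd(3) \<epsilon> by (simp add: \<epsilon>_def)
        finally have "dist (\<tau> \<kappa>' u') (\<tau> \<kappa> u) < \<delta>" .
        moreover have "dist (q (\<tau> \<kappa>' u')) (q (\<tau> \<kappa> u)) < \<eta>'"
          using \<tau>[OF \<kappa>u] \<tau>[OF \<kappa>u'] d(2)[rule_format, OF _ dd(2)] \<kappa>u' by auto
        ultimately have "dist (\<tau> \<kappa>' u') (\<tau> \<kappa> u) < e"
          using \<eta>'(2)[of "\<tau> \<kappa>' u'" "\<tau> \<kappa> u"] \<tau>[OF \<kappa>u] \<tau>[OF \<kappa>u'] \<tau>L[OF \<kappa>u] \<tau>L[OF \<kappa>u'] r(2) dd(1)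
          by auto
        then show "dist (\<tau> (fst p') (snd p')) (\<tau> (fst p) (snd p)) < e" by (simp add: pe pe')
      qed (use d \<eta>' \<epsilon> in auto)
    qed
  qed
qed

definition leaf :: "'c \<Rightarrow> ('a \<times> 'b) set" where
  "leaf c = {w \<in> E. q w = c}"

lemma connected_base: "connected \<Lambda>"
  using simply_connected_base simply_connected_imp_connected by blast

text \<open>Transport charts show that the set of base points reached by a leaf and its complement are both open.\<close>

lemma fst_image_leaf:
  assumes "u \<in> E"
  shows "fst ` leaf (q u) = \<Lambda>"
proof
  show "fst ` leaf (q u) \<subseteq> \<Lambda>" using fst_in_base by (auto simp: leaf_def)
  have "\<mu> \<in> fst ` leaf (q u)" if "\<mu> \<in> \<Lambda>" for \<mu>
  proof (rule connected_induction_simple[OF connected_base, where a = "fst u" and b = \<mu>])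
    show "fst u \<in> fst ` leaf (q u)" using assms by (auto simp: leaf_def)
    fix \<nu> assume "\<nu> \<in> \<Lambda>"
    then obtain r \<delta> \<tau> where chart: "transport_chart \<nu> r \<delta> \<tau>" using ex_transport_chart by blast
    have r: "r > 0" "ball \<nu> r \<subseteq> \<Lambda>"
      and \<tau>: "\<forall>\<kappa>\<in>ball \<nu> r. \<forall>u\<in>E \<inter> fst -` ball \<nu> r. \<tau> \<kappa> u \<in> E \<and> fst (\<tau> \<kappa> u) = \<kappa> \<and> q (\<tau> \<kappa> u) = q u"
      using chart unfolding transport_chart_def by simp_all
    have "x \<in> fst ` leaf (q u) \<longrightarrow> y \<in> fst ` leaf (q u)" if "x \<in> ball \<nu> r" "y \<in> ball \<nu> r" for x y
    proof
      assume "x \<in> fst ` leaf (q u)"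
      then obtain w where w: "w \<in> E" "q w = q u" "fst w = x" by (auto simp: leaf_def)
      with \<tau> that have "\<tau> y w \<in> leaf (q u)" "fst (\<tau> y w) = y" by (auto simp: leaf_def)
      then show "y \<in> fst ` leaf (q u)" by force
    qed
    moreover have "openin (top_of_set \<Lambda>) (ball \<nu> r)" "\<nu> \<in> ball \<nu> r"
      using r by (simp_all add: openin_open_eq open_base)
    ultimately show "\<exists>T. openin (top_of_set \<Lambda>) T \<and> \<nu> \<in> T \<and>
        (\<forall>x\<in>T. \<forall>y\<in>T. x \<in> fst ` leaf (q u) \<longrightarrow> y \<in> fst ` leaf (q u))"
      by (intro exI[of _ "ball \<nu> r"] conjI ballI)
  qed (use fst_in_base[OF assms] that in simp_all)
  then show "\<Lambda> \<subseteq> fst ` leaf (q u)" by blast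
qed

text \<open>Over the ball of a transport chart, points of the leaf belong to the same sheet if they are transported
  to the same point above the centre.  Sheets are open because the fibre of the leaf is discrete.\<close>

lemma covering_space_leaf:
  assumes "u \<in> E"
  shows "covering_space (leaf (q u)) fst \<Lambda>"
proof
  show "continuous_on (leaf (q u)) fst" by (intro continuous_intros)
  show "fst ` leaf (q u) = \<Lambda>" using fst_image_leaf[OF assms] .
  fix \<mu> assume "\<mu> \<in> \<Lambda>"
  then obtain r \<delta> \<tau> where chart: "transport_chart \<mu> r \<delta> \<tau>" using ex_transport_chart by blast
  have r: "r > 0" "ball \<mu> r \<subseteq> \<Lambda>" and \<delta>: "\<delta> > 0"
    and sep: "\<forall>w\<in>E \<inter> fst -` ball \<mu> r. \<forall>w'\<in>E \<inter> fst -` ball \<mu> r.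
       fst w = fst w' \<and> q w = q w' \<and> dist w w' < \<delta> \<longrightarrow> w = w'"
    and \<tau>: "\<forall>\<kappa>\<in>ball \<mu> r. \<forall>u\<in>E \<inter> fst -` ball \<mu> r. \<tau> \<kappa> u \<in> E \<and> fst (\<tau> \<kappa> u) = \<kappa> \<and> q (\<tau> \<kappa> u) = q u"
    and \<tau>_id: "\<forall>u\<in>E \<inter> fst -` ball \<mu> r. \<tau> (fst u) u = u"
    and \<tau>\<tau>: "\<forall>\<kappa>\<in>ball \<mu> r. \<forall>\<nu>\<in>ball \<mu> r. \<forall>u\<in>E \<inter> fst -` ball \<mu> r. \<tau> \<nu> (\<tau> \<kappa> u) = \<tau> \<nu> u"
    and cont: "continuous_on (ball \<mu> r \<times> (E \<inter> fst -` ball \<mu> r)) (\<lambda>p. \<tau> (fst p) (snd p))"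
    using chart unfolding transport_chart_def by simp_all
  let ?B = "ball \<mu> r" and ?P = "leaf (q u) \<inter> fst -` ball \<mu> r"
  have \<mu>: "\<mu> \<in> ?B" using r by simp
  have P: "?P \<subseteq> E \<inter> fst -` ?B" by (auto simp: leaf_def)
  define sheet where "sheet w = {w' \<in> ?P. \<tau> \<mu> w' = w}" for w
  show "\<exists>T. \<mu> \<in> T \<and> openin (top_of_set \<Lambda>) T \<and>
      (\<exists>v. \<Union>v = leaf (q u) \<inter> fst -` T \<and> (\<forall>s\<in>v. openin (top_of_set (leaf (q u))) s) \<and>
         pairwise disjnt v \<and> (\<forall>s\<in>v. \<exists>g. homeomorphism s T fst g))"
  proof (intro exI[of _ ?B] exI[of _ "sheet ` {w \<in> leaf (q u). fst w = \<mu>}"] conjI ballI)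
    show "\<mu> \<in> ?B" by fact
    show "openin (top_of_set \<Lambda>) ?B" using r by (simp add: openin_open_eq open_base)
    have "\<tau> \<mu> w \<in> leaf (q u)" "fst (\<tau> \<mu> w) = \<mu>" if "w \<in> ?P" for w
      using \<tau> \<mu> that P by (auto simp: leaf_def)
    then show "\<Union> (sheet ` {w \<in> leaf (q u). fst w = \<mu>}) = leaf (q u) \<inter> fst -` ?B"
      by (auto simp: sheet_def)
    show "pairwise disjnt (sheet ` {w \<in> leaf (q u). fst w = \<mu>})"
      by (auto simp: pairwise_def disjnt_def sheet_def)
    fix s assume "s \<in> sheet ` {w \<in> leaf (q u). fst w = \<mu>}"
    then obtain w where s: "s = sheet w" and w: "w \<in> E" "q w = q u" "fst w = \<mu>"
      by (auto simp: leaf_def)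
    have wL: "w \<in> E \<inter> fst -` ?B" using w \<mu> by auto
    \<comment> \<open>In the fibre of the leaf over \<open>\<mu>\<close> the ball of radius \<open>\<delta>\<close> about \<open>w\<close> contains only \<open>w\<close>.\<close>
    have eq: "sheet w = ?P \<inter> \<tau> \<mu> -` ball w \<delta>"
    proof -
      have "\<tau> \<mu> w' = w \<longleftrightarrow> dist w (\<tau> \<mu> w') < \<delta>" if "w' \<in> ?P" for w'
      proof
        assume d: "dist w (\<tau> \<mu> w') < \<delta>"
        have "\<tau> \<mu> w' \<in> E \<and> fst (\<tau> \<mu> w') = \<mu> \<and> q (\<tau> \<mu> w') = q w'"
          using \<tau> \<mu> that P by blast
        moreover have "q w' = q u" using that by (simp add: leaf_def)
        ultimately show "\<tau> \<mu> w' = w"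
          using sep[rule_format, of w "\<tau> \<mu> w'"] wL w d \<mu> by auto
      qed (use \<delta> in auto)
      then show ?thesis
        unfolding sheet_def set_eq_iff mem_Collect_eq Int_iff[of _ ?P] vimage_eq[of _ "\<tau> \<mu>"] mem_ball[of _ w]
        by blast
    qed
    have "continuous_on ?P (\<lambda>w'. \<tau> (fst (\<mu>, w')) (snd (\<mu>, w')))"
      by (rule continuous_on_compose2[OF cont]) (use \<mu> P in \<open>auto intro!: continuous_intros\<close>)
    then have "openin (top_of_set ?P) (?P \<inter> \<tau> \<mu> -` ball w \<delta>)"
      by (intro continuous_openin_preimage_gen) auto
    moreover have "openin (top_of_set (leaf (q u))) ?P"
      by (intro continuous_openin_preimage_gen continuous_intros) auto
    ultimately show "openin (top_of_set (leaf (q u))) s"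
      unfolding s eq by (rule openin_trans)
    have "homeomorphism (sheet w) ?B fst (\<lambda>\<kappa>. \<tau> \<kappa> w)"
    proof (rule homeomorphismI)
      show "continuous_on (sheet w) fst" by (intro continuous_intros)
      have "continuous_on ?B (\<lambda>\<kappa>. \<tau> (fst (\<kappa>, w)) (snd (\<kappa>, w)))"
        by (rule continuous_on_compose2[OF cont]) (use wL in \<open>auto intro!: continuous_intros\<close>)
      then show "continuous_on ?B (\<lambda>\<kappa>. \<tau> \<kappa> w)" by simp
      show "fst ` sheet w \<subseteq> ?B" by (auto simp: sheet_def)
      show "(\<lambda>\<kappa>. \<tau> \<kappa> w) ` ?B \<subseteq> sheet w"
      proof (rule image_subsetI)
        fix \<kappa> assume \<kappa>: "\<kappa> \<in> ?B"
        have "\<tau> \<kappa> w \<in> ?P" using \<tau> \<kappa> wL w by (auto simp: leaf_def)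
        moreover have "\<tau> \<mu> (\<tau> \<kappa> w) = w" 
          using \<tau>\<tau>[rule_format, OF \<kappa> \<mu> wL] \<tau>_id[rule_format, OF wL] w(3) by simp
        ultimately show "\<tau> \<kappa> w \<in> sheet w" by (simp add: sheet_def)
      qed
      show "\<tau> (fst w') w = w'" if "w' \<in> sheet w" for w'
      proof -
        have w': "w' \<in> E \<inter> fst -` ?B" "\<tau> \<mu> w' = w" using that P by (auto simp: sheet_def)
        then have "fst w' \<in> ?B" by simp
        from \<tau>\<tau>[rule_format, OF \<mu> this w'(1)] show ?thesis
          using \<tau>_id[rule_format, OF w'(1)] w'(2) by simp
      qed
      show "fst (\<tau> \<kappa> w) = \<kappa>" if "\<kappa> \<in> ?B" for \<kappa> using \<tau> that wL by blast
    qed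
    then show "\<exists>g. homeomorphism s ?B fst g" unfolding s by blast
  qed
qed

text \<open>A section of the leaf of \<open>u\<close> through \<open>u\<close>, obtained by lifting the identity of the simply connected base
  to the covering.\<close>

definition flat_section :: "'a \<times> 'b \<Rightarrow> 'a \<Rightarrow> 'a \<times> 'b" where
  "flat_section u = (SOME g. continuous_on \<Lambda> g \<and> g \<in> \<Lambda> \<rightarrow> leaf (q u) \<and> g (fst u) = u \<and>
     (\<forall>\<kappa>\<in>\<Lambda>. fst (g \<kappa>) = \<kappa>))"

lemma flat_section:
  assumes "u \<in> E"
  shows "continuous_on \<Lambda> (flat_section u)" "flat_section u \<in> \<Lambda> \<rightarrow> leaf (q u)"
    "flat_section u (fst u) = u" "\<And>\<kappa>. \<kappa> \<in> \<Lambda> \<Longrightarrow> fst (flat_section u \<kappa>) = \<kappa>"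
proof -
  have "\<exists>g. continuous_on \<Lambda> g \<and> g \<in> \<Lambda> \<rightarrow> leaf (q u) \<and> g (fst u) = u \<and> (\<forall>\<kappa>\<in>\<Lambda>. fst (g \<kappa>) = \<kappa>)"
  proof -
    have leaf: "u \<in> leaf (q u)" using assms by (simp add: leaf_def)
    have lpc: "locally path_connected \<Lambda>"
      using open_base by (rule open_imp_locally_path_connected)
    have id: "(\<lambda>x. x) \<in> \<Lambda> \<rightarrow> \<Lambda>" by simp
    show ?thesis
    proof (rule covering_space_lift_strong[OF covering_space_leaf[OF assms] leaf fst_in_base[OF assms]
          simply_connected_base lpc continuous_on_id id refl])
      fix g
      assume "continuous_on \<Lambda> g" "g \<in> \<Lambda> \<rightarrow> leaf (q u)" "g (fst u) = u"
        "\<And>y. y \<in> \<Lambda> \<Longrightarrow> fst (g y) = y"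
      then show ?thesis by blast
    qed
  qed
  from someI_ex[OF this]
  have *: "continuous_on \<Lambda> (flat_section u) \<and> flat_section u \<in> \<Lambda> \<rightarrow> leaf (q u) \<and>
      flat_section u (fst u) = u \<and> (\<forall>\<kappa>\<in>\<Lambda>. fst (flat_section u \<kappa>) = \<kappa>)"
    unfolding flat_section_def .
  show "continuous_on \<Lambda> (flat_section u)"
    by (rule conjunct1[OF *])
  show "flat_section u \<in> \<Lambda> \<rightarrow> leaf (q u)"
    by (rule conjunct1[OF conjunct2[OF *]])
  show "flat_section u (fst u) = u"
    by (rule conjunct1[OF conjunct2[OF conjunct2[OF *]]])
  show "\<And>\<kappa>. \<kappa> \<in> \<Lambda> \<Longrightarrow> fst (flat_section u \<kappa>) = \<kappa>"
    by (rule bspec[OF conjunct2[OF conjunct2[OF conjunct2[OF *]]]])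
qed

lemma flat_section_in: "u \<in> E \<Longrightarrow> \<kappa> \<in> \<Lambda> \<Longrightarrow> flat_section u \<kappa> \<in> E"
  and q_flat_section: "u \<in> E \<Longrightarrow> \<kappa> \<in> \<Lambda> \<Longrightarrow> q (flat_section u \<kappa>) = q u"
  using funcset_mem[OF flat_section(2)] by (simp_all add: leaf_def)

text \<open>Uniqueness of lifts.  The domain of \<open>\<gamma>\<close> is general because it is used for paths, for balls in the
  base and for the whole base.\<close>

lemma flat_section_unique:
  fixes \<gamma> :: "'t::topological_space \<Rightarrow> 'a \<times> 'b"
  assumes "u \<in> E" "connected S" "continuous_on S \<gamma>" "\<gamma> ` S \<subseteq> leaf (q u)"
    and "t0 \<in> S" "\<gamma> t0 = flat_section u (fst (\<gamma> t0))" "t \<in> S"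
  shows "\<gamma> t = flat_section u (fst (\<gamma> t))"
proof -
  have base: "fst (\<gamma> t) \<in> \<Lambda>" if "t \<in> S" for t
    using assms(4) that fst_in_base unfolding leaf_def by blast
  have c: "continuous_on S (\<lambda>t. fst (\<gamma> t))" using assms(3) by (intro continuous_intros)
  show ?thesis
  proof (rule covering_space_lift_unique[OF covering_space_leaf[OF assms(1)],
        where f = "\<lambda>t. fst (\<gamma> t)" and T = S and a = t0])
    show "continuous_on S (\<lambda>t. flat_section u (fst (\<gamma> t)))"
      by (rule continuous_on_compose2[OF flat_section(1)[OF assms(1)] c]) (use base in auto)
    show "(\<lambda>t. flat_section u (fst (\<gamma> t))) \<in> S \<rightarrow> leaf (q u)"
      using flat_section(2)[OF assms(1)] base by blast
    show "fst (\<gamma> t) = fst (flat_section u (fst (\<gamma> t)))" if "t \<in> S" for t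
      using flat_section(4)[OF assms(1) base[OF that]] by simp
  qed (use assms c base in auto)
qed

lemma flat_section_flat_section:
  assumes "u \<in> E" "\<kappa> \<in> \<Lambda>" "\<nu> \<in> \<Lambda>"
  shows "flat_section (flat_section u \<kappa>) \<nu> = flat_section u \<nu>"
proof -
  let ?w = "flat_section u \<kappa>"
  have w: "?w \<in> E" "q ?w = q u" "fst ?w = \<kappa>"
    using assms flat_section_in q_flat_section flat_section(4) by auto
  have "flat_section ?w \<nu> = flat_section u (fst (flat_section ?w \<nu>))"
  proof (rule flat_section_unique[OF assms(1) connected_base, of "flat_section ?w" \<kappa>])
    show "continuous_on \<Lambda> (flat_section ?w)" using flat_section(1)[OF w(1)] .
    show "flat_section ?w ` \<Lambda> \<subseteq> leaf (q u)" using flat_section(2)[OF w(1)] w(2) by auto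
    show "flat_section ?w \<kappa> = flat_section u (fst (flat_section ?w \<kappa>))"
      using flat_section(3)[OF w(1)] flat_section(4)[OF w(1) assms(2)] w(3) by metis
  qed (use assms in auto)
  then show ?thesis using flat_section(4)[OF w(1) assms(3)] by simp
qed

text \<open>Over the ball of a transport chart all flat sections move by the same map \<open>\<tau>\<close>, which is continuous in the
  point as well.\<close>

lemma flat_section_local_transport:
  assumes "\<mu> \<in> \<Lambda>"
  obtains r :: real and \<tau> where "r > 0" "ball \<mu> r \<subseteq> \<Lambda>"
    "continuous_on (ball \<mu> r \<times> (E \<inter> fst -` ball \<mu> r)) (\<lambda>p. \<tau> (fst p) (snd p))"
    "\<forall>u\<in>E. \<forall>\<kappa>\<in>ball \<mu> r. \<forall>\<nu>\<in>ball \<mu> r. flat_section u \<nu> = \<tau> \<nu> (flat_section u \<kappa>)"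
proof -
  obtain r \<delta> \<tau> where chart: "transport_chart \<mu> r \<delta> \<tau>" using ex_transport_chart[OF assms] by blast
  have r: "r > 0" "ball \<mu> r \<subseteq> \<Lambda>"
    and \<tau>: "\<forall>\<kappa>\<in>ball \<mu> r. \<forall>u\<in>E \<inter> fst -` ball \<mu> r. \<tau> \<kappa> u \<in> E \<and> fst (\<tau> \<kappa> u) = \<kappa> \<and> q (\<tau> \<kappa> u) = q u"
    and \<tau>_id: "\<forall>u\<in>E \<inter> fst -` ball \<mu> r. \<tau> (fst u) u = u"
    and cont: "continuous_on (ball \<mu> r \<times> (E \<inter> fst -` ball \<mu> r)) (\<lambda>p. \<tau> (fst p) (snd p))"
    using chart unfolding transport_chart_def by simp_all
  let ?B = "ball \<mu> r"
  have "flat_section u \<nu> = \<tau> \<nu> (flat_section u \<kappa>)" if u: "u \<in> E" and \<kappa>: "\<kappa> \<in> ?B" and \<nu>: "\<nu> \<in> ?B" for u \<kappa> \<nu>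
  proof -
    let ?w = "flat_section u \<kappa>"
    have w: "?w \<in> E \<inter> fst -` ?B" "q ?w = q u" "fst ?w = \<kappa>"
      using flat_section_in[OF u] q_flat_section[OF u] flat_section(4)[OF u] \<kappa> r(2) by auto
    have "\<tau> \<nu> ?w = flat_section u (fst (\<tau> \<nu> ?w))"
    proof (rule flat_section_unique[OF u, of ?B "\<lambda>\<nu>. \<tau> \<nu> ?w" \<kappa>])
      have "continuous_on ?B (\<lambda>\<kappa>. \<tau> (fst (\<kappa>, ?w)) (snd (\<kappa>, ?w)))"
        by (rule continuous_on_compose2[OF cont]) (use w in \<open>auto intro!: continuous_intros\<close>)
      then show "continuous_on ?B (\<lambda>\<nu>. \<tau> \<nu> ?w)" by simp
      show "(\<lambda>\<nu>. \<tau> \<nu> ?w) ` ?B \<subseteq> leaf (q u)" using \<tau> w by (auto simp: leaf_def)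
      show "\<tau> \<kappa> ?w = flat_section u (fst (\<tau> \<kappa> ?w))" using \<tau>_id w by metis
    qed (use \<kappa> \<nu> in auto)
    moreover have "fst (\<tau> \<nu> ?w) = \<nu>" using \<tau> w \<nu> by blast
    ultimately show ?thesis by simp
  qed
  then show ?thesis using that[OF r cont] by blast
qed

text \<open>Continuity in \<open>u\<close> at a base value propagates through transport charts to nearby base values, hence to
  the whole connected base.  It holds at the base value \<open>fst u0\<close>, where the section passes through \<open>u0\<close>.\<close>

lemma tendsto_flat_section:
  assumes "u0 \<in> E" "\<kappa> \<in> \<Lambda>"
  shows "((\<lambda>u. flat_section u \<kappa>) \<longlongrightarrow> flat_section u0 \<kappa>) (at u0 within E)"
proof (rule connected_induction_simple[OF connected_base, where a = "fst u0" and b = \<kappa>])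
  have step: "((\<lambda>u. flat_section u \<nu>) \<longlongrightarrow> flat_section u0 \<nu>) (at u0 within E)"
    if r: "ball \<mu> r \<subseteq> \<Lambda>" "\<kappa> \<in> ball \<mu> r" "\<nu> \<in> ball \<mu> r"
      and cont: "continuous_on (ball \<mu> r \<times> (E \<inter> fst -` ball \<mu> r)) (\<lambda>p. \<tau> (fst p) (snd p))"
      and \<tau>: "\<forall>u\<in>E. \<forall>\<kappa>\<in>ball \<mu> r. \<forall>\<nu>\<in>ball \<mu> r. flat_section u \<nu> = \<tau> \<nu> (flat_section u \<kappa>)"
      and lim: "((\<lambda>u. flat_section u \<kappa>) \<longlongrightarrow> flat_section u0 \<kappa>) (at u0 within E)" for \<mu> r \<kappa> \<nu> \<tau>
  proof -
    have mem: "(\<nu>, flat_section u \<kappa>) \<in> ball \<mu> r \<times> (E \<inter> fst -` ball \<mu> r)" if "u \<in> E" for u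
      using r flat_section_in[OF that] flat_section(4)[OF that] by auto
    have evE: "\<forall>\<^sub>F u in at u0 within E. u \<in> E" by (simp add: eventually_at_filter)
    have eq: "\<tau> \<nu> (flat_section u \<kappa>) = flat_section u \<nu>" if "u \<in> E" for u
      by (rule \<tau>[rule_format, OF that r(2,3), symmetric])
    have "((\<lambda>u. \<tau> (fst (\<nu>, flat_section u \<kappa>)) (snd (\<nu>, flat_section u \<kappa>))) \<longlongrightarrow>
        \<tau> (fst (\<nu>, flat_section u0 \<kappa>)) (snd (\<nu>, flat_section u0 \<kappa>))) (at u0 within E)"
    proof (rule continuous_on_tendsto_compose[OF cont])
      show "((\<lambda>u. (\<nu>, flat_section u \<kappa>)) \<longlongrightarrow> (\<nu>, flat_section u0 \<kappa>)) (at u0 within E)"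
        by (intro tendsto_intros lim)
      show "(\<nu>, flat_section u0 \<kappa>) \<in> ball \<mu> r \<times> (E \<inter> fst -` ball \<mu> r)" by (rule mem[OF assms(1)])
      show "\<forall>\<^sub>F u in at u0 within E. (\<nu>, flat_section u \<kappa>) \<in> ball \<mu> r \<times> (E \<inter> fst -` ball \<mu> r)"
        using evE by eventually_elim (rule mem)
    qed
    then have "((\<lambda>u. \<tau> \<nu> (flat_section u \<kappa>)) \<longlongrightarrow> flat_section u0 \<nu>) (at u0 within E)"
      unfolding fst_conv snd_conv eq[OF assms(1)] .
    moreover have "\<forall>\<^sub>F u in at u0 within E. \<tau> \<nu> (flat_section u \<kappa>) = flat_section u \<nu>"
      using evE by eventually_elim (rule eq)
    ultimately show ?thesis by (rule Lim_transform_eventually)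
  qed
  show "((\<lambda>u. flat_section u (fst u0)) \<longlongrightarrow> flat_section u0 (fst u0)) (at u0 within E)"
  proof -
    obtain r :: real and \<tau> where r: "r > 0" "ball (fst u0) r \<subseteq> \<Lambda>"
      and cont: "continuous_on (ball (fst u0) r \<times> (E \<inter> fst -` ball (fst u0) r)) (\<lambda>p. \<tau> (fst p) (snd p))"
      and \<tau>: "\<forall>u\<in>E. \<forall>\<kappa>\<in>ball (fst u0) r. \<forall>\<nu>\<in>ball (fst u0) r. flat_section u \<nu> = \<tau> \<nu> (flat_section u \<kappa>)"
      using flat_section_local_transport[OF fst_in_base[OF assms(1)]] by blast
    have ev: "\<forall>\<^sub>F u in at u0 within E. u \<in> E \<and> fst u \<in> ball (fst u0) r"
    proof (intro eventually_conj)
      show "\<forall>\<^sub>F u in at u0 within E. u \<in> E" by (simp add: eventually_at_filter)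
      have "(fst \<longlongrightarrow> fst u0) (at u0 within E)" by (intro tendsto_intros)
      then show "\<forall>\<^sub>F u in at u0 within E. fst u \<in> ball (fst u0) r"
        by (rule topological_tendstoD) (use r in auto)
    qed
    have eq: "flat_section u (fst u0) = \<tau> (fst u0) u" if "u \<in> E" "fst u \<in> ball (fst u0) r" for u
      using \<tau>[rule_format, OF that centre_in_ball[THEN iffD2, OF r(1)]]
      unfolding flat_section(3)[OF that(1)] .
    have "((\<lambda>u. \<tau> (fst (fst u0, u)) (snd (fst u0, u))) \<longlongrightarrow>
        \<tau> (fst (fst u0, u0)) (snd (fst u0, u0))) (at u0 within E)"
    proof (rule continuous_on_tendsto_compose[OF cont])
      show "((\<lambda>u. (fst u0, u)) \<longlongrightarrow> (fst u0, u0)) (at u0 within E)" by (intro tendsto_intros)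
      show "(fst u0, u0) \<in> ball (fst u0) r \<times> (E \<inter> fst -` ball (fst u0) r)"
        using assms(1) r by simp
      show "\<forall>\<^sub>F u in at u0 within E. (fst u0, u) \<in> ball (fst u0) r \<times> (E \<inter> fst -` ball (fst u0) r)"
        using ev by eventually_elim (use r in simp)
    qed
    then have "((\<lambda>u. \<tau> (fst u0) u) \<longlongrightarrow> \<tau> (fst u0) u0) (at u0 within E)"
      unfolding fst_conv snd_conv .
    moreover have "\<tau> (fst u0) u0 = flat_section u0 (fst u0)" using eq assms(1) r by simp
    ultimately have "((\<lambda>u. \<tau> (fst u0) u) \<longlongrightarrow> flat_section u0 (fst u0)) (at u0 within E)" by (simp only:)
    moreover have "\<forall>\<^sub>F u in at u0 within E. \<tau> (fst u0) u = flat_section u (fst u0)"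
      using ev by eventually_elim (use eq in simp)
    ultimately show ?thesis by (rule Lim_transform_eventually)
  qed
  fix \<mu> assume "\<mu> \<in> \<Lambda>"
  then obtain r :: real and \<tau> where r: "r > 0" "ball \<mu> r \<subseteq> \<Lambda>"
    and cont: "continuous_on (ball \<mu> r \<times> (E \<inter> fst -` ball \<mu> r)) (\<lambda>p. \<tau> (fst p) (snd p))"
    and \<tau>: "\<forall>u\<in>E. \<forall>\<kappa>\<in>ball \<mu> r. \<forall>\<nu>\<in>ball \<mu> r. flat_section u \<nu> = \<tau> \<nu> (flat_section u \<kappa>)"
    using flat_section_local_transport by blast
  show "\<exists>T. openin (top_of_set \<Lambda>) T \<and> \<mu> \<in> T \<and>
      (\<forall>x\<in>T. \<forall>y\<in>T. ((\<lambda>u. flat_section u x) \<longlongrightarrow> flat_section u0 x) (at u0 within E) \<longrightarrow>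
         ((\<lambda>u. flat_section u y) \<longlongrightarrow> flat_section u0 y) (at u0 within E))"
  proof (intro exI[of _ "ball \<mu> r"] conjI ballI impI)
    show "openin (top_of_set \<Lambda>) (ball \<mu> r)" "\<mu> \<in> ball \<mu> r"
      using r by (simp_all add: openin_open_eq open_base)
    fix x y
    assume "x \<in> ball \<mu> r" "y \<in> ball \<mu> r"
      "((\<lambda>u. flat_section u x) \<longlongrightarrow> flat_section u0 x) (at u0 within E)"
    then show "((\<lambda>u. flat_section u y) \<longlongrightarrow> flat_section u0 y) (at u0 within E)"
      by (rule step[OF r(2) _ _ cont \<tau>])
  qed
qed (use assms(2) fst_in_base[OF assms(1)] in simp_all)

lemma continuous_on_flat_section:
  "continuous_on (\<Lambda> \<times> E) (\<lambda>p. flat_section (snd p) (fst p))"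
  unfolding continuous_on_def
proof
  fix p assume "p \<in> \<Lambda> \<times> E"
  then obtain \<kappa> u0 where p: "p = (\<kappa>, u0)" "\<kappa> \<in> \<Lambda>" "u0 \<in> E" by auto
  obtain r :: real and \<tau> where r: "r > 0" "ball \<kappa> r \<subseteq> \<Lambda>"
    and cont: "continuous_on (ball \<kappa> r \<times> (E \<inter> fst -` ball \<kappa> r)) (\<lambda>p. \<tau> (fst p) (snd p))"
    and \<tau>: "\<forall>u\<in>E. \<forall>\<kappa>'\<in>ball \<kappa> r. \<forall>\<nu>\<in>ball \<kappa> r. flat_section u \<nu> = \<tau> \<nu> (flat_section u \<kappa>')"
    using flat_section_local_transport[OF p(2)] by blast
  let ?F = "at p within \<Lambda> \<times> E"
  have snd_lim: "((\<lambda>p. flat_section (snd p) \<kappa>) \<longlongrightarrow> flat_section u0 \<kappa>) ?F"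
  proof -
    have "continuous_on E (\<lambda>u. flat_section u \<kappa>)"
      unfolding continuous_on_def using tendsto_flat_section p(2) by blast
    then have "continuous_on (\<Lambda> \<times> E) (\<lambda>p. flat_section (snd p) \<kappa>)"
      by (rule continuous_on_compose2) (auto intro!: continuous_intros)
    then show ?thesis using p unfolding continuous_on_def by (metis mem_Times_iff snd_conv fst_conv)
  qed
  have ev: "\<forall>\<^sub>F x in ?F. fst x \<in> ball \<kappa> r \<and> snd x \<in> E"
  proof (intro eventually_conj)
    have "(fst \<longlongrightarrow> fst p) ?F" by (intro tendsto_intros)
    then show "\<forall>\<^sub>F x in ?F. fst x \<in> ball \<kappa> r"
      by (rule topological_tendstoD) (use r p in auto)
    show "\<forall>\<^sub>F x in ?F. snd x \<in> E" by (simp add: eventually_at_filter mem_Times_iff)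
  qed
  have mem: "(\<nu>, flat_section u \<kappa>) \<in> ball \<kappa> r \<times> (E \<inter> fst -` ball \<kappa> r)" if "\<nu> \<in> ball \<kappa> r" "u \<in> E" for \<nu> u
    using r that(1) flat_section_in[OF that(2) p(2)] flat_section(4)[OF that(2) p(2)] by auto
  have "((\<lambda>x. \<tau> (fst (fst x, flat_section (snd x) \<kappa>)) (snd (fst x, flat_section (snd x) \<kappa>))) \<longlongrightarrow>
      \<tau> (fst (fst p, flat_section u0 \<kappa>)) (snd (fst p, flat_section u0 \<kappa>))) ?F"
  proof (rule continuous_on_tendsto_compose[OF cont])
    show "((\<lambda>x. (fst x, flat_section (snd x) \<kappa>)) \<longlongrightarrow> (fst p, flat_section u0 \<kappa>)) ?F"
      by (intro tendsto_intros snd_lim)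
    show "(fst p, flat_section u0 \<kappa>) \<in> ball \<kappa> r \<times> (E \<inter> fst -` ball \<kappa> r)"
      using mem[of \<kappa> u0] p r by simp
    show "\<forall>\<^sub>F x in ?F. (fst x, flat_section (snd x) \<kappa>) \<in> ball \<kappa> r \<times> (E \<inter> fst -` ball \<kappa> r)"
      using ev by eventually_elim (use mem in blast)
  qed
  then have lim: "((\<lambda>x. \<tau> (fst x) (flat_section (snd x) \<kappa>)) \<longlongrightarrow> \<tau> \<kappa> (flat_section u0 \<kappa>)) ?F"
    by (simp add: p(1))
  have eq: "flat_section u \<nu> = \<tau> \<nu> (flat_section u \<kappa>)" if "u \<in> E" "\<nu> \<in> ball \<kappa> r" for u \<nu>
    by (rule \<tau>[rule_format, OF that(1) centre_in_ball[THEN iffD2, OF r(1)] that(2)])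
  have "\<forall>\<^sub>F x in ?F. \<tau> (fst x) (flat_section (snd x) \<kappa>) = flat_section (snd x) (fst x)"
    using ev by eventually_elim (use eq in auto)
  from Lim_transform_eventually[OF lim this]
  have "((\<lambda>x. flat_section (snd x) (fst x)) \<longlongrightarrow> \<tau> \<kappa> (flat_section u0 \<kappa>)) ?F" .
  moreover have "\<tau> \<kappa> (flat_section u0 \<kappa>) = flat_section (snd p) (fst p)"
    using eq[OF p(3), of \<kappa>, symmetric] r(1) p(1) by simp
  ultimately show "((\<lambda>x. flat_section (snd x) (fst x)) \<longlongrightarrow> flat_section (snd p) (fst p)) ?F" by simp
qed

section \<open>Holonomy and trivialization\<close>

text \<open>A horizontal lift of \<open>c\<close> keeps \<open>q\<close> constant, so it is a lift of \<open>c\<close> to a covering and coincides with the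
  flat section along \<open>c\<close>.\<close>

lemma parallel_transport_eq_flat_section:
  assumes lift: "\<And>\<gamma> t. horizontal_lift E H c \<gamma> \<Longrightarrow> t \<in> {0..1} \<Longrightarrow> q (\<gamma> t) = q (pathstart \<gamma>)"
    and "transport_complete E H \<Lambda>" "valid_path c" "path_image c \<subseteq> \<Lambda>"
    and u: "u \<in> bundle_fiber E (pathstart c)"
  shows "parallel_transport E H c u = flat_section u (pathfinish c)"
proof -
  have uE: "u \<in> E" "fst u = pathstart c" using u by (auto simp: bundle_fiber_def)
  have uniq: "pathfinish \<gamma> = flat_section u (pathfinish c)"
    if \<gamma>: "horizontal_lift E H c \<gamma>" "pathstart \<gamma> = u" for \<gamma>
  proof -
    have *: "path \<gamma>" "path_image \<gamma> \<subseteq> E" "\<And>t. t \<in> {0..1} \<Longrightarrow> fst (\<gamma> t) = c t"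
      using \<gamma>(1) valid_path_imp_path unfolding horizontal_lift_def by auto
    have "\<gamma> 1 = flat_section u (fst (\<gamma> 1))"
    proof (rule flat_section_unique[OF uE(1), of "{0..1}" \<gamma> 0])
      show "continuous_on {0..1} \<gamma>" using *(1) by (simp add: path_def)
      show "\<gamma> ` {0..1} \<subseteq> leaf (q u)"
        using *(2) lift[OF \<gamma>(1)] \<gamma>(2) unfolding path_image_def leaf_def by blast
      show "\<gamma> 0 = flat_section u (fst (\<gamma> 0))"
        using \<gamma>(2) flat_section(3)[OF uE(1)] by (simp add: pathstart_def)
    qed auto
    then show ?thesis using *(3)[of 1] by (simp add: pathfinish_def)
  qed
  obtain \<gamma> where "horizontal_lift E H c \<gamma>" "pathstart \<gamma> = u"
    using assms(2-4) u unfolding transport_complete_def by blast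
  then show ?thesis
    unfolding parallel_transport_def using uniq by (intro the_equality) blast+
qed

lemma trivial_holonomy_group:
  assumes lift: "\<And>c \<gamma> t. horizontal_lift E H c \<gamma> \<Longrightarrow> t \<in> {0..1} \<Longrightarrow> q (\<gamma> t) = q (pathstart \<gamma>)"
    and "transport_complete E H \<Lambda>" "\<mu> \<in> \<Lambda>"
  shows "trivial_group (holonomy_group E H \<Lambda> \<mu>)"
proof -
  let ?S = "bundle_fiber E \<mu>"
  let ?one = "\<lambda>u\<in>?S. u"
  have id: "restrict (parallel_transport E H c) ?S = ?one"
    if c: "valid_path c" "path_image c \<subseteq> \<Lambda>" "pathstart c = \<mu>" "pathfinish c = \<mu>" for c
  proof (rule restrict_ext)
    fix u assume u: "u \<in> ?S"
    then have uE: "u \<in> E" "fst u = \<mu>" by (auto simp: bundle_fiber_def)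
    have "parallel_transport E H c u = flat_section u (pathfinish c)"
      by (rule parallel_transport_eq_flat_section[OF lift assms(2) c(1,2)]) (use u c in auto)
    then show "parallel_transport E H c u = u"
      using flat_section(3)[OF uE(1)] uE(2) c(4) by simp
  qed
  have "{restrict (parallel_transport E H c) ?S | c.
         valid_path c \<and> path_image c \<subseteq> \<Lambda> \<and> pathstart c = \<mu> \<and> pathfinish c = \<mu>} = {?one}"
  proof (intro equalityI subsetI)
    fix x assume "x \<in> {?one}"
    moreover have "valid_path (linepath \<mu> \<mu>)" "path_image (linepath \<mu> \<mu>) \<subseteq> \<Lambda>"
      using assms(3) by auto
    ultimately show "x \<in> {restrict (parallel_transport E H c) ?S | c.
         valid_path c \<and> path_image c \<subseteq> \<Lambda> \<and> pathstart c = \<mu> \<and> pathfinish c = \<mu>}"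
      using id[of "linepath \<mu> \<mu>"] by (auto intro!: exI[of _ "linepath \<mu> \<mu>"])
  qed (use id in auto)
  moreover have "\<one>\<^bsub>BijGroup ?S\<^esub> = ?one" by (simp add: BijGroup_def)
  ultimately have eq: "holonomy_group E H \<Lambda> \<mu> = BijGroup ?S\<lparr>carrier := {\<one>\<^bsub>BijGroup ?S\<^esub>}\<rparr>"
    by (simp add: holonomy_group_def)
  have "group (BijGroup ?S)" by (rule group_BijGroup)
  then show ?thesis
    unfolding eq trivial_group_def
    using subgroup.subgroup_is_group[OF group.triv_subgroup] by auto
qed

text \<open>Evaluating flat sections at one base point \<open>\<mu>\<close> is a homeomorphism onto \<open>\<Lambda> \<times> F\<close> with \<open>F\<close> the fibre over
  \<open>\<mu>\<close>; its inverse evaluates the flat section through a point of that fibre.  Both maps are continuous and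
  preserve the value of \<open>k\<close>, so near each point they are given by the local inverse \<open>Q\<close> applied to the
  base point and this value, which is a smooth expression on an open set of the ambient space.\<close>

lemma trivial_fiber_bundle_flat_section:
  assumes "E \<noteq> {}" and k: "smooth_on k UNIV" "q = (\<lambda>u. k (snd u))"
    and chart: "\<And>u. u \<in> E \<Longrightarrow> \<exists>N W Q. open N \<and> u \<in> N \<and> open W \<and> smooth_on Q W \<and>
      (\<forall>w\<in>E \<inter> N. (fst w, k (snd w)) \<in> W \<and> Q (fst w, k (snd w)) = w)"
  shows "trivial_fiber_bundle E \<Lambda>"
proof -
  have qk: "q u = k (snd u)" for u by (rule fun_cong[OF k(2)])
  obtain u0 where u0: "u0 \<in> E" using assms(1) by blast
  define \<mu> where "\<mu> = fst u0"
  have \<mu>: "\<mu> \<in> \<Lambda>" using fst_in_base[OF u0] by (simp add: \<mu>_def)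
  define F where "F = snd ` bundle_fiber E \<mu>"
  have F: "y \<in> F \<longleftrightarrow> (\<mu>, y) \<in> E" for y
    by (force simp: F_def bundle_fiber_def)
  define \<Phi> where "\<Phi> u = (fst u, snd (flat_section u \<mu>))" for u
  define \<Psi> where "\<Psi> p = flat_section (\<mu>, snd p) (fst p)" for p
  have E: "E \<inter> fst -` \<Lambda> = E" using fst_in_base by blast
  have in\<mu>: "(\<mu>, snd (flat_section u \<mu>)) = flat_section u \<mu>" if "u \<in> E" for u
    using flat_section(4)[OF that \<mu>] by (simp add: prod_eq_iff)
  have cs: "continuous_on E (\<lambda>u. flat_section u \<mu>)"
  proof -
    have "continuous_on E (\<lambda>u. flat_section (snd (\<mu>, u)) (fst (\<mu>, u)))"
      by (rule continuous_on_compose2[OF continuous_on_flat_section])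
         (use \<mu> in \<open>auto intro!: continuous_intros\<close>)
    then show ?thesis by simp
  qed
  have c\<Phi>: "continuous_on E \<Phi>"
    unfolding \<Phi>_def by (intro continuous_intros cs)
  have c\<Psi>: "continuous_on (\<Lambda> \<times> F) \<Psi>"
  proof -
    have "continuous_on (\<Lambda> \<times> F) (\<lambda>p. flat_section (snd (fst p, (\<mu>, snd p))) (fst (fst p, (\<mu>, snd p))))"
    proof (rule continuous_on_compose2[OF continuous_on_flat_section, of _ "\<lambda>p. (fst p, (\<mu>, snd p))"])
      show "continuous_on (\<Lambda> \<times> F) (\<lambda>p. (fst p, (\<mu>, snd p)))"
        by (intro continuous_on_Pair continuous_on_const continuous_on_fst continuous_on_snd continuous_on_id)
      show "(\<lambda>p. (fst p, (\<mu>, snd p))) ` (\<Lambda> \<times> F) \<subseteq> \<Lambda> \<times> E"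
      proof (rule image_subsetI)
        fix p assume "p \<in> \<Lambda> \<times> F"
        then show "(fst p, (\<mu>, snd p)) \<in> \<Lambda> \<times> E" using F[of "snd p"] by (simp add: mem_Times_iff)
      qed
    qed
    then show ?thesis by (simp only: \<Psi>_def[abs_def] fst_conv snd_conv)
  qed
  have \<Psi>E: "\<Psi> p \<in> E" "fst (\<Psi> p) = fst p" "k (snd (\<Psi> p)) = k (snd p)" if p: "p \<in> \<Lambda> \<times> F" for p
  proof -
    have "(\<mu>, snd p) \<in> E" "fst p \<in> \<Lambda>" using p F[of "snd p"] by auto
    then show "\<Psi> p \<in> E" "fst (\<Psi> p) = fst p" "k (snd (\<Psi> p)) = k (snd p)"
      using flat_section_in[of "(\<mu>, snd p)" "fst p"] flat_section(4)[of "(\<mu>, snd p)" "fst p"]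
        q_flat_section[of "(\<mu>, snd p)" "fst p"] by (simp_all add: \<Psi>_def qk)
  qed
  have \<Phi>F: "\<Phi> u \<in> \<Lambda> \<times> F" if "u \<in> E" for u
    using that fst_in_base[OF that] in\<mu>[OF that] flat_section_in[OF that \<mu>] by (simp add: \<Phi>_def F)
  have hom: "homeomorphism E (\<Lambda> \<times> F) \<Phi> \<Psi>"
  proof (rule homeomorphismI[OF c\<Phi> c\<Psi>])
    show "\<Phi> ` E \<subseteq> \<Lambda> \<times> F" using \<Phi>F by blast
    show "\<Psi> ` (\<Lambda> \<times> F) \<subseteq> E" using \<Psi>E(1) by blast
    show "\<Psi> (\<Phi> u) = u" if u: "u \<in> E" for u
    proof -
      have "\<Psi> (\<Phi> u) = flat_section (flat_section u \<mu>) (fst u)"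
        by (simp add: \<Phi>_def \<Psi>_def in\<mu>[OF u])
      also have "\<dots> = u"
        using flat_section_flat_section[OF u \<mu> fst_in_base[OF u]] flat_section(3)[OF u] by simp
      finally show ?thesis .
    qed
    show "\<Phi> (\<Psi> p) = p" if p: "p \<in> \<Lambda> \<times> F" for p
    proof -
      have y: "(\<mu>, snd p) \<in> E" "fst p \<in> \<Lambda>" using p F[of "snd p"] by auto
      have "flat_section (\<Psi> p) \<mu> = flat_section (\<mu>, snd p) \<mu>"
        unfolding \<Psi>_def by (rule flat_section_flat_section[OF y \<mu>])
      also have "\<dots> = (\<mu>, snd p)" using flat_section(3)[OF y(1)] by simp
      finally show ?thesis using \<Psi>E(2)[OF p] by (simp add: \<Phi>_def prod_eq_iff)
    qed
  qed
  \<comment> \<open>It remains to extend both maps locally to smooth maps of the ambient space.\<close>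
  have bl: "bounded_linear (\<lambda>y::'a \<times> 'b. snd y)" "bounded_linear (\<lambda>y::'a \<times> 'b. fst y)"
    by (rule bounded_linear_snd, rule bounded_linear_fst)
  have k': "smooth_on (\<lambda>y::'a \<times> 'b. k (snd y)) S" if "open S" for S
    by (rule smooth_on_compose[OF that open_UNIV smooth_on_bounded_linear[OF bl(1)] k(1)]) simp
  have nbhd: "\<exists>O'. open O' \<and> p \<in> O' \<and> g ` (D \<inter> O') \<subseteq> N"
    if "continuous_on D g" "p \<in> D" "open N" "g p \<in> N" for g :: "'a \<times> 'b \<Rightarrow> 'a \<times> 'b" and D p N
    using that unfolding continuous_on_topological by (metis IntE image_subsetI)
  have "smooth_map_on \<Phi> E"
    unfolding smooth_map_on_def
  proof
    fix p assume p: "p \<in> E"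
    let ?w = "flat_section p \<mu>"
    have w: "?w \<in> E" by (rule flat_section_in[OF p \<mu>])
    obtain N W Q where N: "open N" "?w \<in> N" and W: "open W" and Q: "smooth_on Q W"
      "\<forall>w\<in>E \<inter> N. (fst w, k (snd w)) \<in> W \<and> Q (fst w, k (snd w)) = w"
      using chart[OF w] by blast
    obtain O' where O': "open O'" "p \<in> O'" "(\<lambda>u. flat_section u \<mu>) ` (E \<inter> O') \<subseteq> N"
      using nbhd[OF cs p N] by blast
    define U where "U = (\<lambda>y::'a \<times> 'b. (\<mu>, k (snd y))) -` W"
    have base: "fst (flat_section u \<mu>) = \<mu>" "k (snd (flat_section u \<mu>)) = k (snd u)" if "u \<in> E" for u
      using flat_section(4)[OF that \<mu>] q_flat_section[OF that \<mu>] by (simp_all add: qk)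
    have U: "open U"
      unfolding U_def
      by (intro open_vimage W continuous_on_Pair continuous_on_const smooth_on_imp_continuous_on[OF k'] open_UNIV)
    have UO: "open (U \<inter> O')" using U O' by blast
    define g' where "g' y = (fst y, snd (Q (\<mu>, k (snd y))))" for y :: "'a \<times> 'b"
    have "smooth_on (\<lambda>y. Q (\<mu>, k (snd y))) (U \<inter> O')"
      by (rule smooth_on_compose[OF UO W smooth_on_Pair[OF UO smooth_on_const k'[OF UO]] Q(1)])
         (auto simp: U_def)
    then have "smooth_on g' (U \<inter> O')"
      unfolding g'_def
      by (intro smooth_on_Pair UO smooth_on_bounded_linear[OF bl(2)] smooth_on_linear_compose[OF UO bounded_linear_snd])
    moreover have "p \<in> U \<inter> O'"
      using bspec[OF Q(2), of ?w] w N(2) base[OF p] O'(2) by (simp add: U_def)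
    moreover have "g' y = \<Phi> y" if y: "y \<in> E \<inter> (U \<inter> O')" for y
    proof -
      have "flat_section y \<mu> \<in> E \<inter> N"
        using y O'(3) flat_section_in[of y \<mu>] \<mu> by blast
      from bspec[OF Q(2) this] have "Q (\<mu>, k (snd y)) = flat_section y \<mu>"
        using base[of y] y by simp
      then show ?thesis by (simp add: g'_def \<Phi>_def)
    qed
    ultimately show "\<exists>U g'. open U \<and> p \<in> U \<and> smooth_on g' U \<and> (\<forall>y\<in>E \<inter> U. g' y = \<Phi> y)"
      using UO by blast
  qed
  moreover have "smooth_map_on \<Psi> (\<Lambda> \<times> F)"
    unfolding smooth_map_on_def
  proof
    fix p assume p: "p \<in> \<Lambda> \<times> F"
    obtain N W Q where N: "open N" "\<Psi> p \<in> N" and W: "open W" and Q: "smooth_on Q W"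
      "\<forall>w\<in>E \<inter> N. (fst w, k (snd w)) \<in> W \<and> Q (fst w, k (snd w)) = w"
      using chart[OF \<Psi>E(1)[OF p]] by blast
    obtain O' where O': "open O'" "p \<in> O'" "\<Psi> ` ((\<Lambda> \<times> F) \<inter> O') \<subseteq> N"
      using nbhd[OF c\<Psi> p N] by blast
    define U where "U = (\<lambda>y::'a \<times> 'b. (fst y, k (snd y))) -` W"
    have U: "open U"
      unfolding U_def
      by (intro open_vimage W continuous_on_Pair smooth_on_imp_continuous_on[OF smooth_on_bounded_linear[OF bl(2)]]
          smooth_on_imp_continuous_on[OF k'] open_UNIV)
    have UO: "open (U \<inter> O')" using U O' by blast
    have "smooth_on (\<lambda>y. Q (fst y, k (snd y))) (U \<inter> O')"
      by (rule smooth_on_compose[OF UO W smooth_on_Pair[OF UO smooth_on_bounded_linear[OF bl(2)] k'[OF UO]] Q(1)])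
         (auto simp: U_def)
    moreover have "p \<in> U \<inter> O'"
      using bspec[OF Q(2), of "\<Psi> p"] \<Psi>E[OF p] N(2) O'(2) by (simp add: U_def)
    moreover have "Q (fst y, k (snd y)) = \<Psi> y" if y: "y \<in> (\<Lambda> \<times> F) \<inter> (U \<inter> O')" for y
    proof -
      have y': "y \<in> \<Lambda> \<times> F" using y by blast
      have "\<Psi> y \<in> E \<inter> N" using y O'(3) \<Psi>E(1)[OF y'] by blast
      from bspec[OF Q(2) this] show ?thesis using \<Psi>E(2,3)[OF y'] by simp
    qed
    ultimately show "\<exists>U g'. open U \<and> p \<in> U \<and> smooth_on g' U \<and> (\<forall>y\<in>(\<Lambda> \<times> F) \<inter> U. g' y = \<Psi> y)"
      using UO by blast
  qed
  ultimately have "trivialization E \<Lambda> F \<Phi>"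
    unfolding trivialization_def diffeomorphism_between_def E using hom by (auto simp: \<Phi>_def)
  moreover have "fst ` E = \<Lambda>"
    using fst_image_leaf[OF u0] fst_in_base by (auto simp: leaf_def)
  ultimately show ?thesis unfolding trivial_fiber_bundle_def by blast
qed

end

section \<open>The equilibrium bundle\<close>

text \<open>The function \<open>g\<close> is constant along the curves whose velocities span the tangent space.\<close>

lemma derivative_zero_on_tangent_space_of_fiber:
  assumes "(g has_derivative g') (at u)" "v \<in> tangent_space {w \<in> S. g w = g u} u"
  shows "g' v = 0"
proof -
  have lin: "linear g'" by (rule has_derivative_linear[OF assms(1)])
  show ?thesis
    using assms(2) unfolding tangent_space_def
  proof (rule span_induct)
    show "subspace {v. g' v = 0}" by (rule linear_subspace_kernel[OF lin])
    fix v
    assume "v \<in> {v. \<exists>\<gamma> \<epsilon>. \<epsilon> > 0 \<and> \<gamma> 0 = u \<and> \<gamma> ` {0..\<epsilon>} \<subseteq> {w \<in> S. g w = g u} \<and>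
             \<gamma> C1_differentiable_on {0..\<epsilon>} \<and> (\<gamma> has_vector_derivative v) (at 0)}"
    then obtain \<gamma> and \<epsilon> :: real where \<gamma>: "\<epsilon> > 0" "\<gamma> 0 = u" "\<gamma> ` {0..\<epsilon>} \<subseteq> {w \<in> S. g w = g u}"
      "(\<gamma> has_vector_derivative v) (at 0)" by blast
    have "(\<gamma> has_derivative (\<lambda>t. t *\<^sub>R v)) (at 0 within {0..\<epsilon>})"
      using \<gamma>(4) has_derivative_at_withinI by (auto simp: has_vector_derivative_def)
    from has_derivative_compose[OF this, of g g']
    have "((\<lambda>t. g (\<gamma> t)) has_derivative (\<lambda>t. g' (t *\<^sub>R v))) (at 0 within {0..\<epsilon>})"
      using assms(1) \<gamma>(2) by simp
    then have "((\<lambda>t. g (\<gamma> t)) has_vector_derivative g' v) (at 0 within {0..\<epsilon>})"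
      using linear_cmul[OF lin] by (simp add: has_vector_derivative_def)
    moreover have "((\<lambda>t. g (\<gamma> t)) has_vector_derivative 0) (at 0 within {0..\<epsilon>})"
    proof (rule has_vector_derivative_transform[of _ _ _ "\<lambda>_. g u"])
      show "g (\<gamma> t) = g u" if "t \<in> {0..\<epsilon>}" for t using \<gamma>(3) that by blast
    qed (use \<gamma>(1) in auto)
    moreover have "at 0 within {0..\<epsilon>} \<noteq> bot"
      using \<gamma>(1) by (simp add: at_within_Icc_at_right)
    ultimately show "g' v = 0" using vector_derivative_unique_within by blast
  qed
qed

lemma horizontal_lift_preserves_first_integrals:
  assumes "smooth_on h UNIV" "horizontal_lift E (natural_horizontal E h) c \<gamma>" "t \<in> {0..1}"
  shows "h (snd (\<gamma> t)) = h (snd (pathstart \<gamma>))"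
proof -
  obtain X where X: "finite X"
    "\<And>t. t \<in> {0..1} - X \<Longrightarrow> \<exists>v\<in>natural_horizontal E h (\<gamma> t). (\<gamma> has_vector_derivative v) (at t)"
    using assms(2) unfolding horizontal_lift_def by blast
  have "path \<gamma>" using assms(2) valid_path_imp_path by (auto simp: horizontal_lift_def)
  then have cont: "continuous_on {0..1} (\<lambda>t. h (snd (\<gamma> t)))"
    using continuous_on_compose2[OF smooth_on_imp_continuous_on[OF assms(1)], of "{0..1}" "\<lambda>t. snd (\<gamma> t)"]
    by (auto simp: path_def intro: continuous_on_snd)
  have "((\<lambda>t. h (snd (\<gamma> t))) has_derivative (\<lambda>_. 0)) (at t within {0..1})" if t: "t \<in> {0..1} - X" for t
  proof -
    let ?u = "\<gamma> t"
    obtain v where v: "v \<in> natural_horizontal E h ?u" "(\<gamma> has_vector_derivative v) (at t)"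
      using X(2)[OF t] by blast
    let ?D = "\<lambda>v. frechet_derivative h (at (snd ?u)) (snd v)"
    have D: "((\<lambda>w. h (snd w)) has_derivative ?D) (at ?u)"
      by (rule has_derivative_compose[OF has_derivative_snd[OF has_derivative_ident]
            smooth_on_has_derivative[OF assms(1)]]) simp
    have "?D v = 0"
      by (rule derivative_zero_on_tangent_space_of_fiber[OF D, of _ E])
         (use v(1) in \<open>simp add: natural_horizontal_def\<close>)
    moreover have "((\<lambda>t. h (snd (\<gamma> t))) has_derivative (\<lambda>s. ?D (s *\<^sub>R v))) (at t)"
      using has_derivative_compose[OF v(2)[unfolded has_vector_derivative_def] D] .
    moreover have "?D (s *\<^sub>R v) = s *\<^sub>R ?D v" for s
      by (rule linear_cmul[OF has_derivative_linear[OF D]])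
    ultimately have "((\<lambda>t. h (snd (\<gamma> t))) has_derivative (\<lambda>_. 0)) (at t)" by simp
    then show ?thesis by (rule has_derivative_at_withinI)
  qed
  then have "h (snd (\<gamma> t)) = h (snd (\<gamma> 0))"
    by (rule has_derivative_zero_unique_strong_interval[OF X(1) cont refl _ assms(3)])
  then show ?thesis by (simp add: pathstart_def)
qed

lemma compact_equilibrium_locus_over:
  fixes f :: "'a::euclidean_space \<times> 'b::euclidean_space \<Rightarrow> 'c::euclidean_space"
  assumes "compact V" "continuous_on (\<Lambda> \<times> V) f" "compact C" "C \<subseteq> \<Lambda>"
  shows "compact (equilibrium_locus \<Lambda> V f \<inter> fst -` C)"
proof -
  have cp: "compact (C \<times> V)" using assms by (intro compact_Times)
  have "closed ((C \<times> V) \<inter> f -` {0})"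
  proof (rule continuous_closed_preimage)
    show "continuous_on (C \<times> V) f" using assms by (auto intro: continuous_on_subset)
  qed (use compact_imp_closed[OF cp] in simp_all)
  then have "compact ((C \<times> V) \<inter> ((C \<times> V) \<inter> f -` {0}))" using cp by (rule compact_Int_closed[rotated])
  moreover have "(C \<times> V) \<inter> ((C \<times> V) \<inter> f -` {0}) = equilibrium_locus \<Lambda> V f \<inter> fst -` C"
    using assms(4) by (auto simp: equilibrium_locus_def)
  ultimately show ?thesis by simp
qed

theorem theorem4:
  fixes \<Lambda> :: "(real^'m) set"
    and V :: "(real^'n) set"
    and f :: "(real^'m) \<times> (real^'n) \<Rightarrow> real^'n"
    and h :: "real^'n \<Rightarrow> real^'k"
  defines "M \<equiv> \<Lambda> \<times> V"
    and "E \<equiv> equilibrium_locus \<Lambda> V f"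
    and "H \<equiv> natural_horizontal (equilibrium_locus \<Lambda> V f) h"
  assumes "open \<Lambda>" and "connected \<Lambda>"
    and "compact V" and "codim0_submanifold V" and "stratified_manifold (frontier V)"
    and "real_analytic_on f M"
    and "\<And>\<mu>. \<mu> \<in> \<Lambda> \<Longrightarrow> inward_or_tangent V (\<lambda>x. f (\<mu>, x))"
    and "\<And>l. smooth_on (\<lambda>x. h x $ l) UNIV"
    and "\<And>\<mu> l. \<mu> \<in> \<Lambda> \<Longrightarrow> first_integral V (\<lambda>x. f (\<mu>, x)) (\<lambda>x. h x $ l)"
    and "independent_functions h"
    and "E \<noteq> {}"
    and "analytic_variety_in M (CARD('m) + CARD('k)) E"
    and "\<And>u. u \<in> M \<Longrightarrow> rank (jacobian_param f u) = min CARD('m) (CARD('n) - CARD('k))"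
    and "\<And>u. u \<in> E \<Longrightarrow> rank (jacobian_state f u) = CARD('n) - CARD('k)"
    and "\<And>u. u \<in> M - E \<Longrightarrow> \<exists>p\<le>CARD('k). rank (jacobian_state f u) = CARD('n) - p"
    and "\<And>u. u \<in> E \<Longrightarrow>
           direct_sum (matrix_ker (jacobian_state f u)) (matrix_im (jacobian_state f u)) UNIV"
    and "fst ` E = \<Lambda>"
    and "fiber_bundle E \<Lambda>"
    and "ehresmann_splitting E H"
    and "transport_complete E H \<Lambda>"
    and "simply_connected \<Lambda>"
  shows "(\<forall>\<mu>\<in>\<Lambda>. trivial_group (holonomy_group E H \<Lambda> \<mu>)) \<and> trivial_fiber_bundle E \<Lambda>"
proof -
  note complete = \<open>transport_complete E H \<Lambda>\<close>
  have h: "smooth_on h UNIV"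
    by (rule smooth_on_vec_componentwise[OF open_UNIV]) fact
  have V: "V \<subseteq> closure (interior V)"
    by (rule codim0_submanifold_subset_closure_interior) fact
  have f: "real_analytic_on f (\<Lambda> \<times> V)"
    using \<open>real_analytic_on f M\<close> by (simp add: M_def)
  have contf: "continuous_on (\<Lambda> \<times> V) f"
  proof (rule continuous_at_imp_continuous_on, rule ballI)
    fix p assume "p \<in> \<Lambda> \<times> V"
    then obtain U where "open U" "p \<in> U" "smooth_on f U"
      using real_analytic_on_imp_locally_smooth[OF f] by blast
    then show "isCont f p"
      using smooth_on_imp_continuous_on continuous_on_eq_continuous_at by blast
  qed
  define q where "q u = h (snd u)" for u :: "(real^'m) \<times> (real^'n)"
  have contq: "continuous_on S q" for S
    unfolding q_def
    by (rule continuous_on_compose2[OF smooth_on_imp_continuous_on[OF h]]) (auto intro!: continuous_intros)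
  have E0: "f w = 0" "fst w \<in> \<Lambda>" if "w \<in> E" for w
    using that by (auto simp: E_def equilibrium_locus_def)
  have chart: "\<exists>N W Q. open N \<and> u \<in> N \<and> open W \<and> smooth_on Q W \<and>
      (\<forall>w\<in>E \<inter> N. (fst w, h (snd w)) \<in> W \<and> Q (fst w, h (snd w)) = w)" if u: "u \<in> E" for u
  proof (rule equilibrium_locus_parametrized[OF V u[unfolded E_def] f _ h])
    fix N W Q
    assume "open N" "u \<in> N" "open W" "smooth_on Q W"
      "\<forall>w\<in>N. f w = 0 \<longrightarrow> (fst w, h (snd w)) \<in> W \<and> Q (fst w, h (snd w)) = w"
    then show ?thesis using E0(1) by blast
  next
    show "first_integral V (\<lambda>x. f (\<mu>, x)) (\<lambda>x. h x $ l)" if "\<mu> \<in> \<Lambda>" for \<mu> l using assms that by blast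
    show "independent_functions h" by fact
    show "rank (jacobian_state f u) = CARD('n) - CARD('k)" using assms u by blast
    show "direct_sum (matrix_ker (jacobian_state f u)) (matrix_im (jacobian_state f u)) UNIV"
      using assms u by blast
  qed
  have lift_const: "q (\<gamma> t) = q (pathstart \<gamma>)" if "horizontal_lift E H c \<gamma>" "t \<in> {0..1}" for c \<gamma> t
    using horizontal_lift_preserves_first_integrals[OF h _ that(2)] that(1) by (simp add: q_def H_def E_def)
  interpret proper_separated_family E \<Lambda> q
  proof
    show "open \<Lambda>" "simply_connected \<Lambda>" by fact+
    show "fst u \<in> \<Lambda>" if "u \<in> E" for u using E0(2) that .
    show "continuous_on E q" by (rule contq)
    show "compact (E \<inter> fst -` C)" if "compact C" "C \<subseteq> \<Lambda>" for C
      unfolding E_def by (rule compact_equilibrium_locus_over[OF _ contf that]) fact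
    show "\<exists>N. open N \<and> u \<in> N \<and> inj_on (\<lambda>w. (fst w, q w)) (E \<inter> N)" if u: "u \<in> E" for u
    proof -
      obtain N W Q where "open N" "u \<in> N"
        and Q: "\<forall>w\<in>E \<inter> N. (fst w, h (snd w)) \<in> W \<and> Q (fst w, h (snd w)) = w"
        using chart[OF u] by blast
      moreover have "inj_on (\<lambda>w. (fst w, q w)) (E \<inter> N)"
        by (rule inj_on_inverseI[of _ Q]) (use Q in \<open>simp add: q_def\<close>)
      ultimately show ?thesis by blast
    qed
    show "\<exists>\<gamma>. path \<gamma> \<and> path_image \<gamma> \<subseteq> E \<and> pathstart \<gamma> = u \<and>
        (\<forall>t\<in>{0..1}. fst (\<gamma> t) = linepath (fst u) b t \<and> q (\<gamma> t) = q u)"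
      if "u \<in> E" "closed_segment (fst u) b \<subseteq> \<Lambda>" for u b
    proof -
      have "valid_path (linepath (fst u) b)" "path_image (linepath (fst u) b) \<subseteq> \<Lambda>"
        "u \<in> bundle_fiber E (pathstart (linepath (fst u) b))"
        using that by (simp_all add: bundle_fiber_def)
      then obtain \<gamma> where \<gamma>: "horizontal_lift E H (linepath (fst u) b) \<gamma>" "pathstart \<gamma> = u"
        using complete unfolding transport_complete_def by blast
      then have "path \<gamma>" "path_image \<gamma> \<subseteq> E" "\<forall>t\<in>{0..1}. fst (\<gamma> t) = linepath (fst u) b t"
        using valid_path_imp_path unfolding horizontal_lift_def by blast+
      then show ?thesis using \<gamma> lift_const[OF \<gamma>(1)] by (intro exI[of _ \<gamma>]) simp
    qed
  qed
  have "trivial_fiber_bundle E \<Lambda>"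
    by (rule trivial_fiber_bundle_flat_section[OF \<open>E \<noteq> {}\<close> h _ chart]) (auto simp: q_def)
  moreover have "trivial_group (holonomy_group E H \<Lambda> \<mu>)" if "\<mu> \<in> \<Lambda>" for \<mu>
    by (rule trivial_holonomy_group[OF lift_const complete that])
  ultimately show ?thesis by blast
qed

end
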